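(* Let $n\ge 1$ and consider the parameter sequence $(\alpha_{2i})_{1\le i\le n}$ with $\alpha_{2i}=(0,0,\ldots,0)\in\{0,1\}^{i-1}$ for all $i=1,\ldots,n$. Let $\mathcal{C}_{2n+1}$ be the 2-factor of $Q_{2n+1}(n,n+1)$ obtained from the construction described in the context for this parameter sequence. There is a bijection between the cycles in $\mathcal{C}_{2n+1}$ and the trees in the set $\mathcal{T}_{n+1}$ such that any cycle $C\in\mathcal{C}_{2n+1}$ and any tree $T\in\mathcal{T}_{n+1}$ that are mapped onto each other satisfy $$e(C)=(4n+2)\cdot|[T^*]_{\curvearrowright}|,$$ where $T^*\in\mathcal{T}_{n+1}^*$ is obtained by rooting $T$ arbitrarily. Consequently, the length of a shortest cycle in $\mathcal{C}_{2n+1}$ is $2(4n+2)$ for all $n\ge 2$, and the length of a longest cycle is $2n(4n+2)$ for all $n\ge 4$. Furthermore, the total number of cycles in the 2-factor is $|\mathcal{C}_{2n+1}|=|\mathcal{T}_{n+1}|$, and the number of cycles of length $2n(4n+2)$ is $|\mathcal{T}_{n+1}^{\mathrm{asym}}|=(1-o(1))|\mathcal{T}_{n+1}|$ (as $n\to\infty$).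
   Context: $e(G)$ denotes the number of edges of a graph $G$. Trees. An ordered rooted tree is a rooted tree with a specified left-to-right ordering of the children of each vertex; $\mathcal{T}_{n+1}^*$ is the set of all ordered rooted trees on $n+1$ vertices. A tree $T'\in\mathcal{T}_{n+1}^*$ is obtained by a rotation operation from $T\in\mathcal{T}_{n+1}^*$ with root $r$ and children of the root $v_1,\ldots,v_l$ (from left to right) if $T'$ arises from $T$ by making $v_1$ the new root and making the subtree rooted at $r$ without $v_1$ and its descendants (i.e. $r$ together with the subtrees rooted at $v_2,\ldots,v_l$) a new rightmost child of $v_1$. Write $T\curvearrowright T'$ if $T'$ can be obtained from $T$ by a sequence of rotation operations; this is an equivalence relation on $\mathcal{T}_{n+1}^*$, and $[T]_{\curvearrowright}$ is the equivalence class of $T$. $\mathcal{T}_{n+1}$ is the set of plane trees (trees embedded in the plane) on $n+1$ vertices; two ordered rooted trees are equivalent under $\curvearrowright$ iff they represent the same plane tree after embedding them in the plane and unmarking the roots, so plane trees on $n+1$ vertices correspond to equivalence classes of $\curvearrowright$ on $\mathcal{T}_{n+1}^*$; rooting $T\in\mathcal{T}_{n+1}$ means choosing a member $T^*$ of its class. $T\in\mathcal{T}_{n+1}$ is asymmetric if $|[T^*]_{\curvearrowright}|=2n$; $\mathcal{T}_{n+1}^{\mathrm{asym}}$ is the set of asymmetric plane trees on $n+1$ vertices. Bitstrings and layers. $B_n=\{0,1\}^n$, and $B_n(k)\subseteq B_n$ is the set of bitstrings with exactly $k$ entries equal to 1. For $0\le k\le n-1$, $Q_n(k,k+1)$ is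 the graph with vertex set $B_n(k)\cup B_n(k+1)$ in which two vertices are adjacent iff they differ in exactly one bit. $x\circ y$ denotes concatenation of bitstrings; for a graph, path, set of bitstrings, or family of graphs/paths $X$, $X\circ y$ is obtained by appending $y$ to every bitstring (vertex) involved. $\overline{x}$ is the bitwise complement of $x$, and $\mathrm{rev}(x)$ is the reversed bitstring. A 2-factor of a graph is a 2-regular spanning subgraph, also regarded as the set of its cycles. For an oriented path $P=(v_1,\ldots,v_l)$ let $F(P)=v_1$, $S(P)=v_2$, $L(P)=v_l$; for a family $\mathcal{P}$ of oriented paths, $F(\mathcal{P})=\{F(P)\mid P\in\mathcal{P}\}$, and similarly $S(\mathcal{P})$, $L(\mathcal{P})$. Maps $f_\alpha$. For $\alpha\in\{0,1\}^{n-1}$, $\pi_\alpha:B_{2n}\to B_{2n}$ swaps the bits at positions $2i$ and $2i+1$ for exactly those $i\in\{1,\ldots,n-1\}$ with $\alpha(i)=1$, leaving everything else unchanged; $f_\alpha(x):=\overline{\mathrm{rev}(\pi_\alpha(x))}$. It is applied to paths vertex by vertex and is an isomorphism from $Q_{2n}(n,n+1)$ to $Q_{2n}(n-1,n)$. Construction. Given parameters $\alpha_{2i}\in\{0,1\}^{i-1}$, define families of pairwise disjoint oriented paths $\mathcal{P}_{2n}(k,k+1)$ in $Q_{2n}(k,k+1)$, $k=n,\ldots,2n-1$, starting and ending in $B_{2n}(k)$ (depending on $\alpha_2,\ldots,\alpha_{2n-2}$), and 2-factors $\mathcal{C}_{2n+1}$ of $Q_{2n+1}(n,n+1)$ (depending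 on $\alpha_2,\ldots,\alpha_{2n}$). Base: $\mathcal{P}_2(1,2):=\{((1,0),(1,1),(0,1))\}$. 2-factor $\mathcal{C}_{2n+1}$: let $M_{2n+1}^{FL}$ be the set of edges $\{v\circ(0),v\circ(1)\}$ with $v\in F(\mathcal{P}_{2n}(n,n+1))\cup L(\mathcal{P}_{2n}(n,n+1))$, and let $$\mathcal{C}_{2n+1}:=\mathcal{P}_{2n}(n,n+1)\circ(0)\;\cup\; f_{\alpha_{2n}}(\mathcal{P}_{2n}(n,n+1))\circ(1)\;\cup\; M_{2n+1}^{FL}.$$ This is a 2-factor of $Q_{2n+1}(n,n+1)$, because the paths in $\mathcal{P}_{2n}(n,n+1)$ visit all vertices of $Q_{2n}(n,n+1)$ and $f_{\alpha_{2n}}$ maps each of $F(\mathcal{P}_{2n}(n,n+1))$ and $L(\mathcal{P}_{2n}(n,n+1))$ onto itself. Step $n\to n+1$: with the conventions $\mathcal{P}_{2n}(2n,2n+1):=\mathcal{P}_{2n}(2n+1,2n+2):=\emptyset$, for $k=n+2,\ldots,2n+1$ let $$\mathcal{P}_{2n+2}(k,k+1):=\mathcal{P}_{2n}(k,k+1)\circ(0,0)\cup\mathcal{P}_{2n}(k-1,k)\circ(1,0)\cup\mathcal{P}_{2n}(k-1,k)\circ(0,1)\cup\mathcal{P}_{2n}(k-2,k-1)\circ(1,1).$$ Let $\mathcal{C}_{2n+1}^-$ be obtained from $\mathcal{C}_{2n+1}$ by deleting every edge $(F(P),S(P))\circ(0)$, $P\in\mathcal{P}_{2n}(n,n+1)$;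 its components are paths, each joining a vertex $S(P)\circ(0)$ to a vertex $F(P')\circ(0)$ for some $P,P'\in\mathcal{P}_{2n}(n,n+1)$. Let $M_{2n+2}^S$ be the set of edges $\{s\circ(0,0),s\circ(0,1)\}$ with $s\in S(\mathcal{P}_{2n}(n,n+1))$. Let $\mathcal{P}'_{2n+2}$ be the set of components of $M_{2n+2}^S\cup\mathcal{C}_{2n+1}^-\circ(1)$, which are paths, each oriented so that its first edge is its edge from $M_{2n+2}^S$ (directed from $s\circ(0,0)$ to $s\circ(0,1)$). Finally $$\mathcal{P}_{2n+2}(n+1,n+2):=\mathcal{P}_{2n}(n+1,n+2)\circ(0,0)\cup\mathcal{P}_{2n}(n,n+1)\circ(1,0)\cup\mathcal{P}'_{2n+2}.$$ *)

theory Defs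
  imports "HOL-Library.Landau_Symbols"
begin
datatype otree = Node "otree list"

fun num_vertices :: "otree \<Rightarrow> nat" where
  "num_vertices (Node ts) = Suc (sum_list (map num_vertices ts))"

definition ordered_trees :: "nat \<Rightarrow> otree set" where
  "ordered_trees m = {t. num_vertices t = m}"

text \<open>The leftmost child of the root, with children \<open>us\<close>, becomes the new root; the old root
  with its remaining children \<open>vs\<close> becomes the rightmost child of the new root.\<close>

inductive rotates :: "otree \<Rightarrow> otree \<Rightarrow> bool" where
  "rotates (Node (Node us # vs)) (Node (us @ [Node vs]))"

definition rot_rel :: "(otree \<times> otree) set" where
  "rot_rel = {(t, t'). rotates\<^sup>*\<^sup>* t t'}"

definition rot_class :: "otree \<Rightarrow> otree set" where
  "rot_class t = rot_rel `` {t}"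

text \<open>A plane tree is represented by the class of all ordered rooted trees that arise from it
  by rooting; choosing a rooting means choosing a member of the class.\<close>

definition plane_trees :: "nat \<Rightarrow> otree set set" where
  "plane_trees m = ordered_trees m // rot_rel"

definition asym_plane_trees :: "nat \<Rightarrow> otree set set" where
  "asym_plane_trees m = {T \<in> plane_trees m. \<forall>t\<in>T. card (rot_class t) = 2 * (m - 1)}"

text \<open>An edge is a two-element set of vertices. Oriented paths are the lists of their vertices.
  None of the graphs handled as a bare edge set has isolated vertices, so no vertex is lost.\<close>

definition path_edges :: "'a list \<Rightarrow> 'a set set" where
  "path_edges p = {{p ! i, p ! Suc i} | i. Suc i < length p}"

definition cycle_subgraphs :: "'a set set \<Rightarrow> 'a set set set" where
  "cycle_subgraphs E = {path_edges (c @ [hd c]) | c.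
     distinct c \<and> 3 \<le> length c \<and> path_edges (c @ [hd c]) \<subseteq> E}"

definition component_of :: "'a set set \<Rightarrow> 'a \<Rightarrow> 'a set set" where
  "component_of E v = {e \<in> E. \<exists>u\<in>e. (\<lambda>x y. {x, y} \<in> E)\<^sup>*\<^sup>* v u}"

definition components_of :: "'a set set \<Rightarrow> 'a set set set" where
  "components_of E = component_of E ` (\<Union>E)"

definition two_factor :: "'a set \<Rightarrow> 'a set set \<Rightarrow> 'a set set \<Rightarrow> bool" where
  "two_factor V E H \<longleftrightarrow> H \<subseteq> E \<and> (\<forall>v\<in>V. card {e \<in> H. v \<in> e} = 2)"

type_synonym bitstring = "bool list"

definition layer :: "nat \<Rightarrow> nat \<Rightarrow> bitstring set" where
  "layer n k = {x. length x = n \<and> count_list x True = k}"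

definition Q_vertices :: "nat \<Rightarrow> nat \<Rightarrow> bitstring set" where
  "Q_vertices n k = layer n k \<union> layer n (Suc k)"

definition Q_edges :: "nat \<Rightarrow> nat \<Rightarrow> bitstring set set" where
  "Q_edges n k = {{x, y} | x y. x \<in> Q_vertices n k \<and> y \<in> Q_vertices n k \<and>
     card {i. i < n \<and> x ! i \<noteq> y ! i} = 1}"

fun swap_pairs :: "bool list \<Rightarrow> bitstring \<Rightarrow> bitstring" where
  "swap_pairs (a # as) (x # y # xs) = (if a then y # x # swap_pairs as xs else x # y # swap_pairs as xs)"
| "swap_pairs _ xs = xs"

text \<open>With positions counted from 1, the pairs \<open>(2, 3), (4, 5), \<dots>\<close> are governed by
  \<open>\<alpha>(1), \<alpha>(2), \<dots>\<close>; the first bit (and, for even length, the last bit) is never moved.\<close>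

fun pi_map :: "bool list \<Rightarrow> bitstring \<Rightarrow> bitstring" where
  "pi_map a (x # xs) = x # swap_pairs a xs"
| "pi_map a [] = []"

definition f_map :: "bool list \<Rightarrow> bitstring \<Rightarrow> bitstring" where
  "f_map a x = map Not (rev (pi_map a x))"

definition append_paths :: "bitstring list set \<Rightarrow> bitstring \<Rightarrow> bitstring list set" where
  "append_paths P y = map (\<lambda>v. v @ y) ` P"

definition append_edges :: "bitstring set set \<Rightarrow> bitstring \<Rightarrow> bitstring set set" where
  "append_edges E y = image (\<lambda>v. v @ y) ` E"

definition F_set :: "'a list set \<Rightarrow> 'a set" where
  "F_set P = hd ` P"

definition S_set :: "'a list set \<Rightarrow> 'a set" where
  "S_set P = (\<lambda>p. p ! 1) ` P"

definition L_set :: "'a list set \<Rightarrow> 'a set" where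
  "L_set P = last ` P"

definition family_edges :: "'a list set \<Rightarrow> 'a set set" where
  "family_edges P = \<Union> (path_edges ` P)"

definition M_FL :: "bitstring list set \<Rightarrow> bitstring set set" where
  "M_FL P = {{v @ [False], v @ [True]} | v. v \<in> F_set P \<union> L_set P}"

text \<open>Below, \<open>P\<close> stands for the family of paths between the layers \<open>n\<close> and \<open>n + 1\<close> of the
  \<open>2n\<close>-cube, and \<open>a\<close> for the parameter with index \<open>2n\<close>.\<close>

definition C_step :: "bool list \<Rightarrow> bitstring list set \<Rightarrow> bitstring set set" where
  "C_step a P = family_edges (append_paths P [False])
     \<union> family_edges (append_paths (map (f_map a) ` P) [True])
     \<union> M_FL P"

definition C_minus :: "bool list \<Rightarrow> bitstring list set \<Rightarrow> bitstring set set" where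
  "C_minus a P = C_step a P - {{hd p @ [False], p ! 1 @ [False]} | p. p \<in> P}"

definition M_S :: "bitstring list set \<Rightarrow> bitstring set set" where
  "M_S P = {{s @ [False, False], s @ [False, True]} | s. s \<in> S_set P}"

definition P_prime :: "bool list \<Rightarrow> bitstring list set \<Rightarrow> bitstring list set" where
  "P_prime a P = {p. distinct p \<and> 2 \<le> length p
     \<and> path_edges p \<in> components_of (M_S P \<union> append_edges (C_minus a P) [True])
     \<and> (\<exists>s\<in>S_set P. p ! 0 = s @ [False, False] \<and> p ! 1 = s @ [False, True])}"

text \<open>\<open>paths \<alpha> n k\<close> is the family of paths between the layers \<open>k\<close> and \<open>k + 1\<close> of the
  \<open>2n\<close>-cube. It is meant for \<open>n \<ge> 1\<close> and \<open>n \<le> k \<le> 2n - 1\<close>; it is empty for all other \<open>n, k\<close>,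
  which covers the convention for \<open>k = 2n\<close> and \<open>k = 2n + 1\<close>.
  In the last equation, the step leads from \<open>n = Suc m\<close> to \<open>n + 1\<close>.\<close>

fun paths :: "(nat \<Rightarrow> bool list) \<Rightarrow> nat \<Rightarrow> nat \<Rightarrow> bitstring list set" where
  "paths \<alpha> 0 k = {}"
| "paths \<alpha> (Suc 0) k = (if k = 1 then {[[True, False], [True, True], [False, True]]} else {})"
| "paths \<alpha> (Suc (Suc m)) k =
    (let n = Suc m in
     if k = n + 1 then
       append_paths (paths \<alpha> (Suc m) (n + 1)) [False, False]
       \<union> append_paths (paths \<alpha> (Suc m) n) [True, False]
       \<union> P_prime (\<alpha> (2 * n)) (paths \<alpha> (Suc m) n)
     else if n + 2 \<le> k \<and> k \<le> 2 * n + 1 then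
       append_paths (paths \<alpha> (Suc m) k) [False, False]
       \<union> append_paths (paths \<alpha> (Suc m) (k - 1)) [True, False]
       \<union> append_paths (paths \<alpha> (Suc m) (k - 1)) [False, True]
       \<union> append_paths (paths \<alpha> (Suc m) (k - 2)) [True, True]
     else {})"

definition C_factor :: "(nat \<Rightarrow> bool list) \<Rightarrow> nat \<Rightarrow> bitstring set set" where
  "C_factor \<alpha> n = C_step (\<alpha> (2 * n)) (paths \<alpha> n n)"

end

theory Submission
  imports Defs "HOL-Real_Asymp.Real_Asymp" "HOL-Library.FuncSet"
begin

text \<open>
  Bitstrings are read as lattice paths, 1 being an up-step, and Dyck paths are read as ordered rooted
  trees. For zero parameters, every path of the family between the layers \<open>k\<close> and \<open>k + 1\<close> of the
  \<open>2n\<close>-cube starts in a string \<open>1u0v\<close> with \<open>u\<close> a Dyck word and \<open>v\<close> never below its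
  starting height, visits \<open>1u1v\<close> next, and ends in \<open>u01v\<close>; it has \<open>2|u| + 3\<close> vertices
  and never changes \<open>v\<close>. The map \<open>f\<close> is then complementation and reversal, which mirrors trees.
  A cycle of the 2-factor thus runs from \<open>1u0v0\<close> along a path to \<open>u01v0\<close>, crosses to
  \<open>u01v1\<close>, runs back along the image of a path to \<open>u1v01\<close> and crosses to \<open>u1v00\<close>.
  These are always \<open>(2|u| + 3) + (2|v| + 3) = 4n + 2\<close> vertices, and the step from \<open>1u0v\<close> to
  \<open>u1v0\<close> is one rotation of the tree. The 2-factor is therefore a disjoint union of blocks of
  \<open>4n + 2\<close> vertices, one for each ordered tree, and its cycles link the blocks of a rotation class.

  If a tree is fixed by \<open>p\<close> rotations, then the bits of its word at positions in a fixed residue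
  class modulo \<open>p\<close> are non-increasing, so at most \<open>2n 3\<^sup>n\<close> trees with \<open>n\<close> edges have a
  nontrivial symmetry. Counting the vertices in the blocks shows that there are about \<open>4\<^sup>n\<close> trees, up
  to polynomial factors.
\<close>

section \<open>Ordered trees and Dyck words\<close>

text \<open>The construction obtains its new paths as components of a graph made from the previous
  2-factor, so their shape is hidden until the expected paths are known to be disjoint. Hence
  \<open>tree_path\<close> is defined by recursion on trees alone, its paths are shown to partition
  the vertices, and only then is it matched with \<open>paths\<close>. The partition cannot be
  proved for the middle layers alone: a new path starts in \<open>1a1b00\<close>, where
  \<open>1a1b\<close> is a vertex of layer \<open>n + 1\<close> that the family between the layers
  \<open>n + 1\<close> and \<open>n + 2\<close> misses. The induction therefore runs over all
  \<open>k >= n\<close> and records what is missed: in layer \<open>k\<close>, exactly the strings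
  that stay strictly above their starting height. For \<open>k = n\<close> the final height is 0, so
  nothing is missed. Naming a vertex by a tree and a position in its block turns the 2-factor into
  the graph of a permutation, whose cycles are orbits. The base 3 in the count of symmetric trees is
  the worst case of a proper period \<open>p\<close> with \<open>2 * n = m * p\<close>: there are at
  most \<open>(m + 1) ^ p\<close> such trees, and \<open>(m + 1) ^ 2 <= 3 ^ m\<close> for
  \<open>m >= 2\<close>, with equality for \<open>m = 2\<close>.\<close>

abbreviation ones :: "bitstring \<Rightarrow> nat" where
  "ones x \<equiv> count_list x True"

abbreviation compl_rev :: "bitstring \<Rightarrow> bitstring" where
  "compl_rev x \<equiv> map Not (rev x)"

lemma compl_rev_involution [simp]: "compl_rev (compl_rev x) = x"
  by (simp add: rev_map comp_def)

lemma ones_compl_rev: "ones (compl_rev x) + ones x = length x"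
  by (induction x) auto

fun word :: "otree \<Rightarrow> bitstring" where
  "word (Node ts) = concat (map (\<lambda>t. True # word t @ [False]) ts)"

fun mirror :: "otree \<Rightarrow> otree" where
  "mirror (Node ts) = Node (rev (map mirror ts))"

fun children :: "otree \<Rightarrow> otree list" where
  "children (Node ts) = ts"

text \<open>These are the two ways of splitting a tree at an outermost edge of the root:
  \<open>1a0b\<close> cuts the word at its first return to height 0, \<open>a1b0\<close> at the last
  ascent from height 0. A rotation turns the first form into the second.\<close>

definition cons_child :: "otree \<Rightarrow> otree \<Rightarrow> otree" where
  "cons_child a b = Node (a # children b)"

definition snoc_child :: "otree \<Rightarrow> otree \<Rightarrow> otree" where
  "snoc_child a b = Node (children a @ [b])"

lemma children_eq_iff: "children s = children t \<longleftrightarrow> s = t"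
  by (cases s; cases t) auto

lemma cons_child_inject [simp]: "cons_child a b = cons_child a' b' \<longleftrightarrow> a = a' \<and> b = b'"
  by (auto simp: cons_child_def children_eq_iff)

lemma snoc_child_inject [simp]: "snoc_child a b = snoc_child a' b' \<longleftrightarrow> a = a' \<and> b = b'"
  by (auto simp: snoc_child_def children_eq_iff)

lemma num_vertices_pos [simp]: "0 < num_vertices t"
  by (cases t) simp

lemma num_vertices_neq_0 [simp]: "num_vertices t \<noteq> 0"
  by (cases t) simp

lemma num_vertices_cons_child [simp]:
  "num_vertices (cons_child a b) = num_vertices a + num_vertices b"
  by (cases b) (simp add: cons_child_def)

lemma num_vertices_snoc_child [simp]:
  "num_vertices (snoc_child a b) = num_vertices a + num_vertices b"
  by (cases a) (simp add: snoc_child_def)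

lemma word_cons_child [simp]: "word (cons_child a b) = True # word a @ False # word b"
  by (cases b) (simp add: cons_child_def)

lemma word_snoc_child [simp]: "word (snoc_child a b) = word a @ True # word b @ [False]"
  by (cases a) (simp add: snoc_child_def)

lemma word_mirror [simp]: "word (mirror t) = compl_rev (word t)"
proof (induction t rule: word.induct)
  case (1 ts)
  then show ?case by (induction ts) auto
qed

lemma num_vertices_mirror [simp]: "num_vertices (mirror t) = num_vertices t"
proof (induction t rule: num_vertices.induct)
  case (1 ts)
  then show ?case by (induction ts) auto
qed

lemma mirror_mirror [simp]: "mirror (mirror t) = t"
proof (induction t rule: mirror.induct)
  case (1 ts)
  then show ?case by (induction ts) auto
qed

lemma otree_cons_cases:
  obtains "t = Node []" | a b where "t = cons_child a b"
proof (cases t)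
  case (Node ts)
  show ?thesis
  proof (cases ts)
    case Nil
    with Node that(1) show ?thesis by simp
  next
    case (Cons a bs)
    with Node that(2)[of a "Node bs"] show ?thesis by (simp add: cons_child_def)
  qed
qed

lemma otree_snoc_cases:
  obtains "t = Node []" | a b where "t = snoc_child a b"
proof (cases t)
  case (Node ts)
  show ?thesis
  proof (cases ts rule: rev_cases)
    case Nil
    with Node that(1) show ?thesis by simp
  next
    case (snoc bs a)
    with Node that(2)[of "Node bs" a] show ?thesis by (simp add: snoc_child_def)
  qed
qed

lemma otree_cons_induct [case_names leaf cons]:
  assumes "P (Node [])" "\<And>a b. P a \<Longrightarrow> P b \<Longrightarrow> P (cons_child a b)"
  shows "P t"
proof (induction "num_vertices t" arbitrary: t rule: less_induct)
  case less
  show ?case by (cases t rule: otree_cons_cases) (use assms less in auto)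
qed

text \<open>The mirrored second component is the one on which the recursion of the paths below runs.\<close>

lemma otree_snoc_induct [case_names leaf snoc]:
  assumes "P (Node [])" "\<And>a b. P a \<Longrightarrow> P (mirror b) \<Longrightarrow> P (snoc_child a b)"
  shows "P t"
proof (induction "num_vertices t" arbitrary: t rule: less_induct)
  case less
  show ?case by (cases t rule: otree_snoc_cases) (use assms less in auto)
qed

lemma length_word: "length (word t) + 2 = 2 * num_vertices t"
  by (induction t rule: otree_cons_induct) auto

lemma ones_word: "Suc (ones (word t)) = num_vertices t"
  by (induction t rule: otree_cons_induct) auto

text \<open>The 0 behind a Dyck word is the first step below the starting height, which forces the
  place of the cut. Without that 0, one word could be a proper prefix of another.\<close>

lemma word_append_False_inject:
  "word s @ False # x = word t @ False # y \<Longrightarrow> s = t \<and> x = y"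
proof (induction s arbitrary: t x y rule: otree_cons_induct)
  case leaf
  then show ?case by (cases t rule: otree_cons_cases) auto
next
  case (cons a b)
  show ?case
  proof (cases t rule: otree_cons_cases)
    case 1
    with cons.prems show ?thesis by simp
  next
    case (2 a' b')
    with cons.prems cons.IH(1)[of "word b @ False # x" a' "word b' @ False # y"] cons.IH(2)[of x b' y]
    show ?thesis by simp
  qed
qed

lemma word_inject [simp]: "word s = word t \<longleftrightarrow> s = t"
  using word_append_False_inject[of s "[]" t "[]"] by auto

section \<open>Lattice paths that stay above their starting height\<close>

definition ballot :: "bitstring \<Rightarrow> bool" where
  "ballot v \<longleftrightarrow> (\<forall>j\<le>length v. j \<le> 2 * ones (take j v))"

text \<open>Ballot words are the suffixes that the paths carry; strictly positive walks are the
  strings of the lower layer that no path visits.\<close>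

definition pos_walk :: "bitstring \<Rightarrow> bool" where
  "pos_walk v \<longleftrightarrow> (\<forall>j\<le>length v. 0 < j \<longrightarrow> j < 2 * ones (take j v))"

lemma ballot_Nil [simp]: "ballot []"
  by (simp add: ballot_def)

lemma ballot_snoc: "ballot (v @ [b]) \<longleftrightarrow> ballot v \<and> Suc (length v) \<le> 2 * ones (v @ [b])"
  by (auto simp: ballot_def le_Suc_eq)

lemma ballot_length: "ballot v \<Longrightarrow> length v \<le> 2 * ones v"
  unfolding ballot_def by (drule spec[of _ "length v"]) simp

lemma ballot_append:
  assumes "ballot v" "ballot w"
  shows "ballot (v @ w)"
  unfolding ballot_def
proof (intro allI impI)
  fix j assume j: "j \<le> length (v @ w)"
  show "j \<le> 2 * ones (take j (v @ w))"
  proof (cases "j \<le> length v")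
    case True
    then show ?thesis using assms(1) by (simp add: ballot_def)
  next
    case False
    then have "j - length v \<le> 2 * ones (take (j - length v) w)"
      using assms(2) j by (simp add: ballot_def)
    with ballot_length[OF assms(1)] False show ?thesis by simp
  qed
qed

lemma pos_walk_Cons: "pos_walk (True # v) \<longleftrightarrow> ballot v"
proof -
  have "pos_walk (True # v) \<longleftrightarrow>
    (\<forall>j\<le>length v. Suc j < 2 * ones (take (Suc j) (True # v)))"
    unfolding pos_walk_def by (metis Suc_le_mono gr0_conv_Suc length_Cons zero_less_Suc)
  then show ?thesis by (auto simp: ballot_def less_eq_Suc_le)
qed

lemma pos_walk_hd:
  assumes "pos_walk v" "v \<noteq> []"
  obtains w where "v = True # w"
proof (cases v)
  case (Cons b w)
  have "Suc 0 < 2 * ones (take (Suc 0) v)"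
    using assms(1) Cons unfolding pos_walk_def by (elim allE[of _ "Suc 0"]) simp
  with Cons that show ?thesis by (auto split: if_splits)
qed (use assms in simp)

lemma pos_walk_appendD: "pos_walk (v @ w) \<Longrightarrow> v \<noteq> [] \<Longrightarrow> length v < 2 * ones v"
  unfolding pos_walk_def by (drule spec[of _ "length v"]) simp

lemma pos_walk_snoc:
  "pos_walk (v @ [b]) \<longleftrightarrow> pos_walk v \<and> Suc (length v) < 2 * ones (v @ [b])"
  by (auto simp: pos_walk_def le_Suc_eq)

lemma ballot_Cons: "ballot v \<Longrightarrow> ballot (True # v)"
proof -
  assume "ballot v"
  then have "pos_walk (True # v)" by (simp add: pos_walk_Cons)
  then show ?thesis unfolding pos_walk_def ballot_def by (auto simp: less_imp_le intro: gr0I)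
qed

lemma ballot_word: "ballot (word t)"
proof (induction t rule: word.induct)
  case (1 ts)
  then show ?case
  proof (induction ts)
    case (Cons t ts)
    have "ballot (True # word t)" using Cons by (simp add: ballot_Cons)
    then have "ballot ((True # word t) @ [False])"
      using length_word[of t] ones_word[of t] by (subst ballot_snoc) simp
    then have "ballot (True # word t @ [False])" by simp
    moreover have "ballot (word (Node ts))" using Cons by simp
    ultimately have "ballot ((True # word t @ [False]) @ word (Node ts))"
      by (rule ballot_append)
    then show ?case by simp
  qed simp
qed

text \<open>This is the factorization of a ballot word at its unmatched up-steps, between which Dyck
  words stand; the final height is one less than the number of trees. The last factor comes first in
  the list, so that reading one more letter changes only the head.\<close>

fun stack_word :: "otree list \<Rightarrow> bitstring" where
  "stack_word [] = []"
| "stack_word [t] = word t"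
| "stack_word (t # u # ts) = stack_word (u # ts) @ True # word t"

lemma length_stack_word:
  "ts \<noteq> [] \<Longrightarrow> length (stack_word ts) + length ts = Suc (2 * ones (stack_word ts))"
proof (induction ts rule: stack_word.induct)
  case (2 t)
  show ?case using length_word[of t] ones_word[of t] by simp
next
  case (3 t u ts)
  then show ?case using length_word[of t] ones_word[of t] by simp
qed simp

lemma stack_word_snoc_False:
  "stack_word (snoc_child u t # ts) = stack_word (t # u # ts) @ [False]"
  by (cases ts) auto

text \<open>Reading a ballot word from left to right, an up-step opens a new subtree on the stack and a
  down-step makes the top of the stack the last child of the next tree on the stack.\<close>

lemma ballot_stack_word: "ballot v \<Longrightarrow> \<exists>ts. ts \<noteq> [] \<and> v = stack_word ts"
proof (induction v rule: rev_induct)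
  case Nil
  have "[] = stack_word [Node []]" by simp
  then show ?case by blast
next
  case (snoc b v)
  then obtain ts where ts: "ts \<noteq> []" "v = stack_word ts" by (auto simp: ballot_snoc)
  show ?case
  proof (cases b)
    case True
    then have "v @ [b] = stack_word (Node [] # ts)" using ts by (cases ts) auto
    then show ?thesis by blast
  next
    case False
    \<comment> \<open>A down-step is possible only from positive height, which guarantees a second
      tree on the stack.\<close>
    then have "Suc (length v) \<le> 2 * ones v" using snoc.prems by (simp add: ballot_snoc)
    then have "length ts \<ge> 2" using length_stack_word[OF ts(1)] ts by simp
    then obtain t u ts' where t: "ts = t # u # ts'"
      by (auto simp: numeral_2_eq_2 Suc_le_length_iff)
    have "v @ [b] = stack_word (snoc_child u t # ts')"
      using False ts t stack_word_snoc_False by simp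
    then show ?thesis by blast
  qed
qed

text \<open>Final height 0 leaves one tree on the stack, so \<open>word\<close> reaches every Dyck
  word.\<close>

lemma ballot_height_0:
  assumes "ballot v" "length v = 2 * ones v"
  obtains t where "v = word t"
proof -
  obtain ts where ts: "ts \<noteq> []" "v = stack_word ts" using ballot_stack_word assms(1) by blast
  then have "length ts = Suc 0" using length_stack_word[of ts] assms(2) by simp
  then show ?thesis using ts that by (auto simp: length_Suc_conv)
qed

lemma ballot_height_1:
  assumes "ballot v" "Suc (length v) = 2 * ones v"
  obtains s t where "v = word s @ True # word t"
proof -
  obtain ts where ts: "ts \<noteq> []" "v = stack_word ts" using ballot_stack_word assms(1) by blast
  then have "length ts = Suc (Suc 0)" using length_stack_word[of ts] assms(2) by simp
  then show ?thesis using ts that by (auto simp: length_Suc_conv)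
qed

section \<open>Paths attached to trees\<close>

text \<open>Recursion for the path from \<open>1u0\<close> to \<open>u01\<close> where \<open>u = a1b0\<close>: the first two vertices are
  joined by the edge from \<open>M_S\<close>; then the path follows the cycle of the smaller 2-factor through the
  block of the tree \<open>1a0b\<close> from its second vertex to the beginning of the next block.\<close>

function tree_path :: "otree \<Rightarrow> bitstring list" where
  "tree_path (Node ts) =
    (if ts = [] then [[True, False], [True, True], [False, True]]
     else let a = Node (butlast ts); b = last ts in
       (True # word a @ True # word b @ [False, False]) #
       map (\<lambda>x. x @ [True])
         (tl (map (\<lambda>x. x @ word b @ [False]) (tree_path a)
              @ map (\<lambda>x. word a @ compl_rev x @ [True]) (rev (tree_path (mirror b))))
          @ [word (Node ts) @ [False]]))"
  by pat_completeness auto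
termination
proof (relation "measure num_vertices")
  fix ts a b
  assume "ts \<noteq> []" and "a = Node (butlast ts)" "b = last ts"
  then have "Node ts = snoc_child a b" by (simp add: snoc_child_def)
  then have "num_vertices (Node ts) = num_vertices a + num_vertices b"
    by (simp only: num_vertices_snoc_child)
  then show "(a, Node ts) \<in> measure num_vertices" "(mirror b, Node ts) \<in> measure num_vertices"
    by (simp_all del: num_vertices.simps)
qed simp

declare tree_path.simps [simp del]

text \<open>The second half is an image under \<open>f\<close>: complementing and reversing
  \<open>x @ word (mirror a)\<close>, where \<open>x\<close> runs over the path of
  \<open>mirror b\<close>, gives \<open>word a @ compl_rev x\<close>. It is traversed backwards,
  because the image of the last vertex of that path is the partner of the last vertex of the first
  half.\<close>

definition block :: "otree \<Rightarrow> otree \<Rightarrow> bitstring list" where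
  "block a b = map (\<lambda>x. x @ word b @ [False]) (tree_path a)
     @ map (\<lambda>x. word a @ compl_rev x @ [True]) (rev (tree_path (mirror b)))"

lemma tree_path_leaf: "tree_path (Node []) = [[True, False], [True, True], [False, True]]"
  by (simp add: tree_path.simps)

lemma tree_path_snoc_child: "tree_path (snoc_child a b) =
    (True # word a @ True # word b @ [False, False]) #
    map (\<lambda>x. x @ [True]) (tl (block a b) @ [word (snoc_child a b) @ [False]])"
proof -
  have *: "Node (children a @ [b]) = snoc_child a b" "Node (children a) = a"
    by (simp_all add: snoc_child_def, cases a, simp)
  show ?thesis unfolding snoc_child_def
    by (subst tree_path.simps) (simp add: Let_def block_def * del: word.simps)
qed

lemma length_tree_path: "Suc (length (tree_path t)) = 4 * num_vertices t"
proof (induction t rule: otree_snoc_induct)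
  case (snoc a b)
  have "length (tree_path a) > 0" using snoc.IH(1) num_vertices_pos[of a] by linarith
  with snoc show ?case by (simp add: tree_path_snoc_child block_def)
qed (simp add: tree_path_leaf)

lemma length_tree_path_ge: "3 \<le> length (tree_path t)"
  using length_tree_path[of t] num_vertices_pos[of t] by linarith

lemma tree_path_nonempty [simp]: "tree_path t \<noteq> []"
  using length_tree_path_ge[of t] by auto

lemma length_block: "length (block a b) + 2 = 4 * (num_vertices a + num_vertices b)"
  using length_tree_path[of a] length_tree_path[of "mirror b"] by (simp add: block_def)

lemma tree_path_0: "tree_path t ! 0 = True # word t @ [False]"
  by (cases t rule: otree_snoc_cases) (simp_all add: tree_path_leaf tree_path_snoc_child)

text \<open>The second vertices matter because the edges of \<open>M_S\<close> are attached there.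
  The recursion hands them on: \<open>tl\<close> removes only the head of the block, so the second
  vertex of the new path comes from the second vertex of the path of \<open>a\<close>.\<close>

lemma tree_path_1: "tree_path t ! 1 = True # word t @ [True]"
proof (induction t rule: otree_snoc_induct)
  case (snoc a b)
  have "length (tree_path a) > 1" using length_tree_path_ge[of a] by simp
  then have "tl (block a b) \<noteq> []" "Suc 0 < length (block a b)"
    "tl (block a b) ! 0 = tree_path a ! 1 @ word b @ [False]"
    by (auto simp: block_def nth_tl nth_append tl_append split: list.splits)
  then show ?case
    using snoc.IH by (auto simp: tree_path_snoc_child nth_append)
qed (simp add: tree_path_leaf)

lemma last_tree_path: "last (tree_path t) = word t @ [False, True]"
  by (cases t rule: otree_snoc_cases) (simp_all add: tree_path_leaf tree_path_snoc_child)

lemma block_0: "block a b ! 0 = True # word a @ False # word b @ [False]"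
  by (simp add: block_def nth_append tree_path_0)

lemma hd_block: "hd (block a b) = True # word a @ False # word b @ [False]"
  using block_0[of a b] by (simp add: hd_conv_nth block_def)

text \<open>The block of \<open>snoc_child a b\<close>, the rotated tree, begins in the same string
  with its last bit changed; this is how consecutive blocks are linked.\<close>

lemma last_block: "last (block a b) = word (snoc_child a b) @ [True]"
  using tree_path_0[of "mirror b"]
  by (simp add: block_def last_map last_rev hd_conv_nth)

lemma block_nth_less: "i < length (tree_path a) \<Longrightarrow> block a b ! i = tree_path a ! i @ word b @ [False]"
  by (simp add: block_def nth_append)

text \<open>A block has \<open>4 * n + 2\<close> entries and its second half is reversed, so
  \<open>4 * n + 1 - i\<close> is the position counted from the end.\<close>

lemma block_nth_ge:
  assumes "length (tree_path a) \<le> i" "i < length (block a b)"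
    and "num_vertices a + num_vertices b = Suc n"
  shows "4 * n + 1 - i < length (tree_path (mirror b))"
    and "block a b ! i = word a @ compl_rev (tree_path (mirror b) ! (4 * n + 1 - i)) @ [True]"
proof -
  define L where "L = length (tree_path (mirror b))"
  have L: "Suc L = 4 * num_vertices b" using length_tree_path[of "mirror b"] by (simp add: L_def)
  have A: "Suc (length (tree_path a)) = 4 * num_vertices a" by (rule length_tree_path)
  have B: "length (block a b) = length (tree_path a) + L" by (simp add: block_def L_def)
  have e: "L - Suc (i - length (tree_path a)) = 4 * n + 1 - i"
    using assms A L B by linarith
  show "4 * n + 1 - i < length (tree_path (mirror b))"
    using assms A L B unfolding L_def[symmetric] by linarith
  have "i - length (tree_path a) < L" using assms B by linarith
  then show "block a b ! i = word a @ compl_rev (tree_path (mirror b) ! (4 * n + 1 - i)) @ [True]"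
    using assms(1) by (simp add: block_def nth_append rev_nth L_def[symmetric] e)
qed

lemma tree_path_snoc_child_nth:
  assumes "0 < i" "i < length (block a b)"
  shows "tree_path (snoc_child a b) ! i = block a b ! i @ [True]"
  using assms by (cases i) (auto simp: tree_path_snoc_child nth_append nth_tl)

lemma length_tree_path_snoc_child: "length (tree_path (snoc_child a b)) = Suc (length (block a b))"
  using length_tree_path[of "snoc_child a b"] length_block[of a b] by simp

lemma tree_path_snoc_child_last:
  "tree_path (snoc_child a b) ! length (block a b) = word (snoc_child a b) @ [False, True]"
  using last_tree_path[of "snoc_child a b"] by (simp add: last_conv_nth length_tree_path_snoc_child)

text \<open>Paths are built from blocks and blocks from paths. Facts about blocks are therefore
  first proved from hypotheses that have the form of the induction hypotheses for the two smaller
  paths; the other lemmas ending in \<open>_aux\<close> serve the same purpose.\<close>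

lemma length_block_member_aux:
  assumes "\<And>x. x \<in> set (tree_path a) \<Longrightarrow> length x = 2 * num_vertices a"
    and "\<And>x. x \<in> set (tree_path (mirror b)) \<Longrightarrow> length x = 2 * num_vertices b"
    and "x \<in> set (block a b)"
  shows "Suc (length x) = 2 * (num_vertices a + num_vertices b)"
  using assms(3) length_word[of a] length_word[of b] by (auto simp: block_def assms(1,2))

lemma length_tree_path_member: "x \<in> set (tree_path t) \<Longrightarrow> length x = 2 * num_vertices t"
proof (induction t arbitrary: x rule: otree_snoc_induct)
  case (snoc a b)
  have "Suc (length y) = 2 * (num_vertices a + num_vertices b)" if "y \<in> set (block a b)" for y
    using length_block_member_aux[of a b y] snoc.IH that by simp
  moreover have "set (tl (block a b)) \<subseteq> set (block a b)"
    by (cases "block a b") auto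
  ultimately show ?case
    using snoc.prems length_word[of a] length_word[of b] by (auto simp: tree_path_snoc_child)
qed (auto simp: tree_path_leaf)

lemma length_block_member:
  "x \<in> set (block a b) \<Longrightarrow> Suc (length x) = 2 * (num_vertices a + num_vertices b)"
  using length_block_member_aux[of a b x] length_tree_path_member[of _ a]
    length_tree_path_member[of _ "mirror b"] by simp

lemma ones_block_aux:
  assumes "\<And>i. i < length (tree_path a) \<Longrightarrow> ones (tree_path a ! i) = num_vertices a + i mod 2"
    and "\<And>i. i < length (tree_path (mirror b)) \<Longrightarrow>
      ones (tree_path (mirror b) ! i) = num_vertices b + i mod 2"
    and i: "i < length (block a b)"
  shows "Suc (ones (block a b ! i)) = num_vertices a + num_vertices b + i mod 2"
proof (cases "i < length (tree_path a)")
  case True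
  then show ?thesis using assms(1)[OF True] ones_word[of b] by (simp add: block_nth_less)
next
  case False
  obtain n where n: "num_vertices a + num_vertices b = Suc n"
    using num_vertices_pos[of a] by (cases "num_vertices a + num_vertices b") auto
  define y where "y = tree_path (mirror b) ! (4 * n + 1 - i)"
  note * = block_nth_ge[OF leI[OF False] i n]
  have "length y = 2 * num_vertices b"
    using *(1) length_tree_path_member[of y "mirror b"] by (simp add: y_def)
  moreover have "ones y = num_vertices b + (4 * n + 1 - i) mod 2"
    using assms(2)[OF *(1)] by (simp add: y_def)
  moreover have "ones (compl_rev y) + ones y = length y" by (rule ones_compl_rev)
  ultimately have y: "ones (compl_rev y) + (4 * n + 1 - i) mod 2 = num_vertices b" by simp
  \<comment> \<open>\<open>4 * n + 1\<close> is odd, so \<open>i\<close> and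
    \<open>4 * n + 1 - i\<close> have opposite parity. Complementation exchanges the two layers, and
    the two effects cancel.\<close>
  have "i \<le> 4 * n + 1" using length_block[of a b] i n by simp
  then obtain j where "4 * n + 1 = i + j" using le_Suc_ex by blast
  moreover from this have "odd (i + j)" by (metis even_add even_mult_iff even_numeral odd_one)
  then have "j mod 2 + i mod 2 = 1" by presburger
  ultimately have "(4 * n + 1 - i) mod 2 + i mod 2 = 1" by simp
  with y *(2) ones_word[of a] show ?thesis by (simp add: y_def)
qed

lemma ones_tree_path:
  "i < length (tree_path t) \<Longrightarrow> ones (tree_path t ! i) = num_vertices t + i mod 2"
proof (induction t arbitrary: i rule: otree_snoc_induct)
  case leaf
  then have "i = 0 \<or> i = 1 \<or> i = 2" by (auto simp: tree_path_leaf)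
  then show ?case by (auto simp: tree_path_leaf)
next
  case (snoc a b)
  consider "i = 0" | "0 < i" "i < length (block a b)" | "i = length (block a b)"
    using snoc.prems by (fastforce simp: length_tree_path_snoc_child)
  then show ?case
  proof cases
    case 1
    then show ?thesis using ones_word[of a] ones_word[of b] by (simp add: tree_path_snoc_child)
  next
    case 2
    then show ?thesis
      using ones_block_aux[of a b i] snoc.IH by (simp add: tree_path_snoc_child_nth)
  next
    case 3
    have "even (length (block a b) + 2)" unfolding length_block by simp
    then have "length (block a b) mod 2 = 0" by presburger
    then show ?thesis
      using 3 ones_word[of a] ones_word[of b] by (simp add: tree_path_snoc_child_last)
  qed
qed

lemma ones_block:
  "i < length (block a b) \<Longrightarrow> Suc (ones (block a b ! i)) = num_vertices a + num_vertices b + i mod 2"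
  using ones_block_aux[of a b i] ones_tree_path[of _ a] ones_tree_path[of _ "mirror b"] by simp

section \<open>Consecutive vertices differ in one bit\<close>

definition flip :: "bitstring \<Rightarrow> bitstring \<Rightarrow> bool" where
  "flip x y \<longleftrightarrow> (\<exists>p b q. x = p @ b # q \<and> y = p @ (\<not> b) # q)"

lemma flipI: "flip (p @ b # q) (p @ (\<not> b) # q)"
  by (auto simp: flip_def)

lemma flipE:
  assumes "flip x y"
  obtains p b q where "x = p @ b # q" "y = p @ (\<not> b) # q"
  using assms by (auto simp: flip_def)

lemma flip_sym: "flip x y \<Longrightarrow> flip y x"
proof (elim flipE)
  fix p b q assume "x = p @ b # q" "y = p @ (\<not> b) # q"
  then show ?thesis using flipI[of p "\<not> b" q] by simp
qed

lemma flip_append_right: "flip x y \<Longrightarrow> flip (x @ v) (y @ v)"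
proof (elim flipE)
  fix p b q assume "x = p @ b # q" "y = p @ (\<not> b) # q"
  then show ?thesis using flipI[of p b "q @ v"] by simp
qed

lemma flip_append_left: "flip x y \<Longrightarrow> flip (v @ x) (v @ y)"
proof (elim flipE)
  fix p b q assume "x = p @ b # q" "y = p @ (\<not> b) # q"
  then show ?thesis using flipI[of "v @ p" b q] by simp
qed

lemma flip_compl_rev: "flip x y \<Longrightarrow> flip (compl_rev x) (compl_rev y)"
proof (elim flipE)
  fix p b q assume "x = p @ b # q" "y = p @ (\<not> b) # q"
  then show ?thesis using flipI[of "compl_rev q" "\<not> b" "compl_rev p"] by simp
qed

lemma successively_flip_block_aux:
  assumes "successively flip (tree_path a)" "successively flip (tree_path (mirror b))"
  shows "successively flip (block a b)"
proof -
  have "successively flip (map (\<lambda>x. x @ word b @ [False]) (tree_path a))"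
    unfolding successively_map using assms(1)
    by (rule successively_mono) (rule flip_append_right)
  moreover have "successively flip (map (\<lambda>x. word a @ compl_rev x @ [True]) (rev (tree_path (mirror b))))"
    unfolding successively_map successively_rev using assms(2)
    by (rule successively_mono)
      (rule flip_sym, intro flip_append_left flip_append_right flip_compl_rev)
  moreover have "flip (word a @ [False, True] @ word b @ [False]) (word a @ [False, True] @ word b @ [True])"
    using flipI[of "word a @ [False, True] @ word b" False "[]"] by simp
  ultimately show ?thesis
    by (simp add: block_def successively_append_iff last_map hd_map last_tree_path hd_rev)
qed

lemma successively_flip_tree_path: "successively flip (tree_path t)"
proof (induction t rule: otree_snoc_induct)
  case leaf
  have "flip [True, False] [True, True]" "flip [True, True] [False, True]"
    using flipI[of "[True]" False "[]"] flipI[of "[]" True "[True]"] by simp_all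
  then show ?case by (simp add: tree_path_leaf)
next
  case (snoc a b)
  have B: "successively flip (block a b)" by (intro successively_flip_block_aux snoc.IH)
  have "2 \<le> length (block a b)"
    using length_tree_path_ge[of a] by (simp add: block_def)
  then obtain x y zs where xy: "block a b = x # y # zs"
    by (auto simp: numeral_2_eq_2 Suc_le_length_iff)
  have "tree_path (snoc_child a b) ! 1 = True # word a @ True # word b @ [False, True]"
    by (subst tree_path_1) simp
  then have y: "y @ [True] = True # word a @ True # word b @ [False, True]"
    by (simp add: tree_path_snoc_child xy)
  have l: "last (y # zs) = word (snoc_child a b) @ [True]"
    using last_block[of a b] by (simp add: xy)
  have "successively flip (y # zs)" using B by (simp add: xy)
  then have "successively flip (map (\<lambda>x. x @ [True]) (y # zs))"
    unfolding successively_map by (rule successively_mono) (rule flip_append_right)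
  moreover have "flip (True # word a @ True # word b @ [False, False]) (y @ [True])"
    using flipI[of "True # word a @ True # word b @ [False]" False "[]"] by (simp add: y)
  \<comment> \<open>The last edge of the new path is the link from the end of this block to the head
    of the next one.\<close>
  moreover have "flip (word (snoc_child a b) @ [True, True]) (word (snoc_child a b) @ [False, True])"
    using flipI[of "word (snoc_child a b)" True "[True]"] by simp
  ultimately show ?case
    using l unfolding tree_path_snoc_child xy
    by (simp add: successively_append_iff successively_Cons last_map split: if_splits)
qed

lemma successively_flip_block: "successively flip (block a b)"
  by (intro successively_flip_block_aux successively_flip_tree_path)

section \<open>Every vertex lies on exactly one path\<close>

text \<open>\<open>v\<close> is the common suffix that the recursion has appended to the path of \<open>t\<close>; the
  family to which the path belongs lives between the layers \<open>k\<close> and \<open>k + 1\<close>.\<close>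

definition on_path :: "nat \<Rightarrow> bitstring \<Rightarrow> otree \<Rightarrow> bitstring \<Rightarrow> nat \<Rightarrow> bool" where
  "on_path k x t v i \<longleftrightarrow> i < length (tree_path t) \<and> x = tree_path t ! i @ v \<and> ballot v
     \<and> num_vertices t + ones v = k"

lemma on_path_length: "on_path k x t v i \<Longrightarrow> length x = 2 * num_vertices t + length v"
  by (auto simp: on_path_def length_tree_path_member)

lemma on_path_ones: "on_path k x t v i \<Longrightarrow> ones x = k + i mod 2"
  by (auto simp: on_path_def ones_tree_path)

text \<open>At even positions the part of \<open>x\<close> that belongs to the path of
  \<open>t\<close> is nonempty and has as many ones as zeros, so the walk is back at its starting
  height there.\<close>

lemma on_path_not_pos_walk:
  assumes "on_path k x t v i" "ones x = k"
  shows "\<not> pos_walk (x @ w)"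
proof
  assume "pos_walk (x @ w)"
  define y where "y = tree_path t ! i"
  have y: "x = y @ v" "length y = 2 * num_vertices t" "ones y = num_vertices t + i mod 2"
    using assms(1) by (auto simp: on_path_def y_def length_tree_path_member ones_tree_path)
  have "i mod 2 = 0" using on_path_ones[OF assms(1)] assms(2) by simp
  moreover have "y \<noteq> []" using y(2) by auto
  ultimately show False
    using pos_walk_appendD[of y "v @ w"] \<open>pos_walk (x @ w)\<close> y by simp
qed

lemma on_path_append2:
  assumes "on_path k (z @ [p, q]) t (w @ [p', q']) i"
  shows "p' = p" "q' = q" "on_path (k - ones [p, q]) z t w i" "ones [p, q] \<le> k"
proof -
  have *: "z = tree_path t ! i @ w" "p' = p" "q' = q"
    using assms by (auto simp: on_path_def)
  moreover have "ballot w"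
    using assms ballot_snoc[of "w @ [p']" q'] ballot_snoc[of w p'] by (simp add: on_path_def)
  ultimately show "p' = p" "q' = q" "on_path (k - ones [p, q]) z t w i" "ones [p, q] \<le> k"
    using assms by (auto simp: on_path_def)
qed

text \<open>The copying part of the recursion step. The bound \<open>n + of_bool q < k\<close>
  admits a last bit 1 only for \<open>k >= n + 2\<close>: in the lowest case
  \<open>k = n + 1\<close> only the suffixes 00 and 10 are copied, and the strings ending in 1 are
  left to the new paths.\<close>

lemma on_path_append2I:
  assumes "on_path (k - ones [p, q]) z t w i" "ones [p, q] \<le> k" "length z = 2 * n"
    and "n + of_bool q < k" "Suc n \<le> k"
  shows "on_path k (z @ [p, q]) t (w @ [p, q]) i"
proof -
  have w: "ballot w" "num_vertices t + ones w = k - ones [p, q]" "2 * num_vertices t + length w = 2 * n"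
    using assms(1,3) on_path_length[OF assms(1)] by (auto simp: on_path_def)
  then have "ballot (w @ [p])"
    using assms(2,4) by (cases p; cases q) (auto simp: ballot_snoc)
  then have "ballot ((w @ [p]) @ [q])"
    unfolding ballot_snoc[of "w @ [p]"] using w assms(2,5) by (cases p; cases q) auto
  with assms(1,2) show ?thesis by (auto simp: on_path_def)
qed

text \<open>The last bit tells the halves apart. On the half ending in 1, complementation with
  reversal leads back to a path of the same family, so uniqueness and existence on paths settle both
  halves.\<close>

lemma block_cases:
  assumes n: "num_vertices a + num_vertices b = Suc n" and i: "i < length (block a b)"
  obtains x where "block a b ! i = x @ [False]" "length x = 2 * n" "on_path n x a (word b) i"
  | x where "block a b ! i = x @ [True]" "length x = 2 * n"
      "on_path n (compl_rev x) (mirror b) (word (mirror a)) (4 * n + 1 - i)"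
proof (cases "i < length (tree_path a)")
  case True
  then have "on_path n (tree_path a ! i @ word b) a (word b) i"
    using n ones_word[of b] ballot_word[of b] by (simp add: on_path_def)
  moreover from on_path_length[OF this] have "length (tree_path a ! i @ word b) = 2 * n"
    using length_word[of b] n by simp
  ultimately show ?thesis using that(1) True by (simp add: block_nth_less)
next
  case False
  note * = block_nth_ge[OF leI[OF False] i n]
  define y where "y = tree_path (mirror b) ! (4 * n + 1 - i)"
  have p: "on_path n (y @ word (mirror a)) (mirror b) (word (mirror a)) (4 * n + 1 - i)"
    unfolding on_path_def
    using * n ones_word[of "mirror a"] ballot_word[of "mirror a"] by (simp add: y_def)
  have "length (y @ word (mirror a)) = 2 * n"
    using on_path_length[OF p] length_word[of a] n by simp
  moreover have "compl_rev (word a @ compl_rev y) = y @ word (mirror a)"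
    by simp
  ultimately show ?thesis
    using that(2)[of "word a @ compl_rev y"] p *(2) by (simp add: y_def)
qed

text \<open>For \<open>k = n\<close> the suffix has final height 0 and so is the word of a tree,
  which becomes the second component of the block.\<close>

lemma on_path_block_False:
  assumes "on_path n x t v i" "length x = 2 * n"
  obtains b where "num_vertices t + num_vertices b = Suc n" "i < length (tree_path t)"
    "x @ [False] = block t b ! i"
proof -
  have "length v = 2 * ones v" using assms on_path_length[OF assms(1)] by (auto simp: on_path_def)
  then obtain b where b: "v = word b"
    using assms(1) ballot_height_0[of v] by (auto simp: on_path_def)
  then show ?thesis
    using that[of b] assms(1) ones_word[of b] by (auto simp: on_path_def block_nth_less)
qed

lemma on_path_block_True:
  assumes "on_path n (compl_rev x) t v i" "length x = 2 * n"
  obtains a b j where "num_vertices a + num_vertices b = Suc n" "0 < j" "j < length (block a b)"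
    "x @ [True] = block a b ! j"
proof -
  have "2 * n = 2 * num_vertices t + length v"
    using on_path_length[OF assms(1)] assms(2) by simp
  moreover have "num_vertices t + ones v = n" using assms(1) by (simp add: on_path_def)
  ultimately have l: "length v = 2 * ones v" by simp
  obtain c where c: "v = word c"
    using assms(1) l ballot_height_0[of v] by (auto simp: on_path_def)
  define a b j where "a = mirror c" and "b = mirror t" and "j = 4 * n + 1 - i"
  have n: "num_vertices a + num_vertices b = Suc n"
    using assms(1) ones_word[of c] c by (auto simp: on_path_def a_def b_def)
  have i: "i < length (tree_path t)" using assms(1) by (simp add: on_path_def)
  have L: "length (block a b) = 4 * n + 2" using length_block[of a b] n by simp
  have "i + 2 \<le> 4 * num_vertices b" using i length_tree_path[of t] by (simp add: b_def)
  then have i': "i < 4 * n + 1" using n num_vertices_pos[of a] by linarith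
  have "length (tree_path a) \<le> j"
    using \<open>i + 2 \<le> 4 * num_vertices b\<close> n length_tree_path[of a] unfolding j_def by linarith
  moreover have j: "0 < j" "j < length (block a b)" "4 * n + 1 - j = i"
    using i' by (auto simp: L j_def)
  ultimately have "block a b ! j = word a @ compl_rev (tree_path t ! i) @ [True]"
    using block_nth_ge(2)[of a j b n] n by (simp add: b_def)
  moreover have "x = word a @ compl_rev (tree_path t ! i)"
  proof -
    have "compl_rev (compl_rev x) = compl_rev (tree_path t ! i @ word c)"
      using assms(1) c by (simp only: on_path_def)
    then show ?thesis by (simp add: a_def)
  qed
  ultimately have "block a b ! j = x @ [True]" by simp
  with that[OF n j(1,2)] show ?thesis by simp
qed

text \<open>The premise \<open>inj\<close> is uniqueness of paths in the cube of dimension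
  \<open>2 * n\<close>. It stays a premise because the lemma is applied inside the induction that
  proves it.\<close>

lemma block_inject:
  assumes inj: "\<And>x t v i t' v' i'. length x = 2 * n \<Longrightarrow> on_path n x t v i \<Longrightarrow>
      on_path n x t' v' i' \<Longrightarrow> t = t' \<and> v = v' \<and> i = i'"
    and n: "num_vertices a + num_vertices b = Suc n" "num_vertices a' + num_vertices b' = Suc n"
    and i: "i < length (block a b)" "i' < length (block a' b')"
    and eq: "block a b ! i = block a' b' ! i'"
  shows "a = a' \<and> b = b' \<and> i = i'"
proof -
  have L: "i \<le> 4 * n + 1" "i' \<le> 4 * n + 1"
    using length_block[of a b] length_block[of a' b'] n i by simp_all
  show ?thesis
  proof (cases rule: block_cases[OF n(1) i(1)])
    case (1 x)
    show ?thesis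
    proof (cases rule: block_cases[OF n(2) i(2)])
      case (1 x')
      with \<open>block a b ! i = x @ [False]\<close> eq have "x = x'" by simp
      with 1 inj[OF _ \<open>on_path n x a (word b) i\<close>] show ?thesis by force
    qed (use 1 eq in simp)
  next
    case (2 x)
    show ?thesis
    proof (cases rule: block_cases[OF n(2) i(2)])
      case (2 x')
      with \<open>block a b ! i = x @ [True]\<close> eq have "x = x'" by simp
      with 2 inj[OF _ \<open>on_path n (compl_rev x) _ _ _\<close>]
      have "mirror b = mirror b' \<and> word (mirror a) = word (mirror a')
        \<and> 4 * n + 1 - i = 4 * n + 1 - i'" by simp
      with L show ?thesis by (metis diff_diff_cancel mirror_mirror word_inject)
    qed (use 2 eq in simp)
  qed
qed

lemma num_vertices_eq_1: "num_vertices t = Suc 0 \<longleftrightarrow> t = Node []"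
  by (cases t; cases "children t") auto

text \<open>Apart from its first vertex, the path of a tree follows the block of the preceding tree
  from its second vertex on, and then ends in the head of its own block. So \<open>(c, d, j)\<close>
  determines both the tree and the position.\<close>

lemma tree_path_tail:
  assumes "0 < i" "i < length (tree_path t)" "t \<noteq> Node []"
  obtains c d j where "num_vertices c + num_vertices d = num_vertices t"
    "j < length (block c d)" "tree_path t ! i = block c d ! j @ [True]"
    "0 < j \<and> t = snoc_child c d \<and> i = j \<or> j = 0 \<and> t = cons_child c d \<and> i = length (block c d)"
proof -
  obtain a b where t: "t = snoc_child a b" using assms(3) by (cases t rule: otree_snoc_cases) auto
  show ?thesis
  proof (cases "i < length (block a b)")
    case True
    then show ?thesis using that[of a b i] assms(1) t by (simp add: tree_path_snoc_child_nth)
  next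
    case False
    then have i: "i = length (block a b)"
      using assms(2) t by (simp add: length_tree_path_snoc_child)
    obtain c d where cd: "t = cons_child c d" using assms(3) by (cases t rule: otree_cons_cases) auto
    then have nv: "num_vertices c + num_vertices d = num_vertices a + num_vertices b"
      using t by (metis num_vertices_cons_child num_vertices_snoc_child)
    have "0 < length (block c d)" by (simp add: block_def)
    moreover have "tree_path t ! i = word (cons_child c d) @ [False, True]"
      using tree_path_snoc_child_last[of a b] i t cd by simp
    ultimately show ?thesis
      using that[of c d 0] nv t cd i length_block[of a b] length_block[of c d] block_0[of c d] by simp
  qed
qed

text \<open>A path is either copied, with a nonempty suffix \<open>v\<close> from which two bits can
  be stripped, or new, with \<open>v\<close> empty. Two copied paths are handled by induction, the
  two kinds must be kept apart, and two new paths are compared through the blocks of the smaller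
  cube.\<close>

lemma on_path_inject:
  assumes "length x = 2 * Suc n" "on_path k x t v i" "on_path k x t' v' i'"
  shows "t = t' \<and> v = v' \<and> i = i'"
  using assms
proof (induction n arbitrary: k x t v i t' v' i')
  case 0
  have "s = Node [] \<and> w = []" if "on_path k x s w j" for s w j
  proof -
    have "2 * num_vertices s + length w = 2"
      using on_path_length[OF that] 0 by simp
    then have "length w = 0" "num_vertices s = 1" using num_vertices_pos[of s] by linarith+
    then show ?thesis by (simp add: num_vertices_eq_1)
  qed
  from this[OF 0(2)] this[OF 0(3)] have *: "t = Node []" "t' = Node []" "v = []" "v' = []" by auto
  have "distinct (tree_path (Node []))" by (simp add: tree_path_leaf)
  with 0(2,3) show ?case unfolding on_path_def * by (auto simp: nth_eq_iff_index_eq)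
next
  case (Suc n)
  have len: "length x = Suc (Suc (2 * Suc n))" using Suc.prems(1) by simp
  obtain z q' where "x = z @ [q']" "length z = Suc (2 * Suc n)"
    using len by (metis length_Suc_conv_rev)
  then obtain w p q where x: "x = w @ [p, q]" and w: "length w = 2 * Suc n"
    by (metis append.assoc append_Cons append_Nil length_Suc_conv_rev)
  have suffix: "(u = [] \<and> num_vertices s = Suc (Suc n) \<and> k = Suc (Suc n))
      \<or> (\<exists>y. u = y @ [p, q])" if "on_path k x s u j" for s u j
  proof (cases u rule: rev_cases)
    case Nil
    then show ?thesis using on_path_length[OF that] len that by (simp add: on_path_def)
  next
    case (snoc y b)
    have "even (length u)" using on_path_length[OF that] Suc.prems(1) by presburger
    then have "y \<noteq> []" using snoc by auto
    then obtain y' b' where "y = y' @ [b']" by (metis append_butlast_last_id)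
    moreover from this have "b' = p" "b = q"
      using that x snoc on_path_append2[of k w p q s y' b' b j] by auto
    ultimately show ?thesis using snoc by simp
  qed
  \<comment> \<open>A new and a copied path cannot meet: in the lowest layer a nonempty suffix has
    final height 0 and so ends in 0. The only vertex of a new path ending in 0 is its first,
    \<open>1a1b00\<close>, and \<open>1a1b\<close> is strictly positive, hence on no path of the
    smaller family.\<close>
  have mixed: False if o: "on_path k x s [] j" and ns: "num_vertices s = Suc (Suc n)"
    and k: "k = Suc (Suc n)" and r: "on_path k x s' (u @ [p, q]) j'" for s j s' u j'
  proof -
    have h: "length (u @ [p, q]) = 2 * ones (u @ [p, q])" "ballot ((u @ [p]) @ [q])"
      using r on_path_length[OF r] Suc.prems(1) k by (auto simp: on_path_def)
    then have "\<not> q" unfolding ballot_snoc[of "u @ [p]"] ballot_snoc[of u]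
      by (cases p; cases q) auto
    obtain a b where s: "s = snoc_child a b" using ns by (cases s rule: otree_snoc_cases) auto
    have "j = 0"
    proof (rule ccontr)
      assume "j \<noteq> 0"
      then obtain j0 where j0: "j = Suc j0" by (cases j) auto
      then have "last x" using o
        by (auto simp: on_path_def s tree_path_snoc_child length_tree_path_snoc_child nth_append)
      with x \<open>\<not> q\<close> show False by simp
    qed
    then have "x = (True # word a @ True # word b) @ [False, False]"
      using o by (simp add: on_path_def s tree_path_snoc_child)
    then have w': "w = True # word a @ True # word b" "\<not> p" using x by auto
    have "pos_walk ((True # word a @ True # word b))"
      unfolding pos_walk_Cons by (intro ballot_append ballot_word ballot_Cons)
    then have "pos_walk w" using w' by simp
    moreover have "on_path k w s' u j'" using on_path_append2(3)[of k w p q s' u p q j'] r x w' \<open>\<not> q\<close> by simp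
    moreover have "ones w = k"
      using w' ones_word[of a] ones_word[of b] ns k s by simp
    ultimately show False using on_path_not_pos_walk[of k w s' u j' "[]"] by simp
  qed
  show ?case
  proof (cases "v = [] \<or> v' = []")
    case False
    then obtain y y' where "v = y @ [p, q]" "v' = y' @ [p, q]"
      using suffix[OF Suc.prems(2)] suffix[OF Suc.prems(3)] by auto
    with Suc.prems(2,3) Suc.IH[OF w] on_path_append2(3)[of k w p q] show ?thesis
      unfolding x by blast
  next
    case True
    then have v: "v = []" "v' = []"
      using mixed suffix[OF Suc.prems(2)] suffix[OF Suc.prems(3)] Suc.prems(2,3) by blast+
    have nv: "num_vertices t = Suc (Suc n)" "num_vertices t' = Suc (Suc n)"
      using v suffix[OF Suc.prems(2)] suffix[OF Suc.prems(3)] by auto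
    have i0: "i = 0 \<longleftrightarrow> \<not> last x" if o: "on_path k x s [] i" and ns: "num_vertices s = Suc (Suc n)" for s i
    proof -
      obtain a b where s: "s = snoc_child a b" using ns by (cases s rule: otree_snoc_cases) auto
      show ?thesis using o
        by (cases i) (auto simp: on_path_def s tree_path_snoc_child nth_append)
    qed
    show ?thesis
    proof (cases "last x")
      case False
      then have "i = 0" "i' = 0" using i0 Suc.prems(2,3) v nv by auto
      then show ?thesis using Suc.prems(2,3) v by (simp add: on_path_def tree_path_0)
    next
      case True
      then have pos: "0 < i" "0 < i'" using i0 Suc.prems(2,3) v nv by blast+
      have lt: "i < length (tree_path t)" "i' < length (tree_path t')"
        and eq: "tree_path t ! i = tree_path t' ! i'"
        using Suc.prems(2,3) v by (auto simp: on_path_def)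
      have ne: "t \<noteq> Node []" "t' \<noteq> Node []" using nv by auto
      obtain c d j where c: "num_vertices c + num_vertices d = num_vertices t"
        "j < length (block c d)" "tree_path t ! i = block c d ! j @ [True]"
        "0 < j \<and> t = snoc_child c d \<and> i = j \<or> j = 0 \<and> t = cons_child c d \<and> i = length (block c d)"
        by (rule tree_path_tail[OF pos(1) lt(1) ne(1)])
      obtain c' d' j' where c': "num_vertices c' + num_vertices d' = num_vertices t'"
        "j' < length (block c' d')" "tree_path t' ! i' = block c' d' ! j' @ [True]"
        "0 < j' \<and> t' = snoc_child c' d' \<and> i' = j' \<or> j' = 0 \<and> t' = cons_child c' d' \<and> i' = length (block c' d')"
        by (rule tree_path_tail[OF pos(2) lt(2) ne(2)])
      \<comment> \<open>Without their final 1, both vertices lie in blocks over the cube of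
        dimension \<open>2 * Suc n\<close>, where the induction hypothesis applies.\<close>
      have "c = c' \<and> d = d' \<and> j = j'"
        using c(1-3) c'(1-3) eq nv by (intro block_inject[of "Suc n"] Suc.IH) auto
      then show ?thesis using c(4) c'(4) v by auto
    qed
  qed
qed

text \<open>The exception is the converse of \<open>on_path_not_pos_walk\<close>: strictly positive
  walks in layer \<open>k\<close> are the only strings missed.\<close>

lemma on_path_exists:
  assumes "length x = 2 * Suc n" "Suc n \<le> k" "ones x = k \<or> ones x = Suc k"
    and "\<not> (pos_walk x \<and> ones x = k)"
  shows "\<exists>t v i. on_path k x t v i"
  using assms
proof (induction n arbitrary: k x)
  case 0
  then obtain p q where x: "x = [p, q]"
    by (auto simp: length_Suc_conv numeral_2_eq_2)
  have "on_path 1 (tree_path (Node []) ! i) (Node []) [] i" if "i < 3" for i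
    using that by (simp add: on_path_def tree_path_leaf)
  from this[of 0] this[of 1] this[of 2]
  have "\<exists>t v i. on_path 1 y t v i" if "y \<in> {[True, False], [True, True], [False, True]}" for y
    using that by (auto simp: tree_path_leaf numeral_2_eq_2)
  \<comment> \<open>For \<open>k = 2\<close> the only candidate is 11, and it is exempt.\<close>
  moreover have "pos_walk [True, True]" by (simp add: pos_walk_Cons ballot_Cons)
  ultimately show ?case using 0 x by (cases p; cases q) auto
next
  case (Suc n)
  have len: "length x = Suc (Suc (2 * Suc n))" using Suc.prems(1) by simp
  obtain y q where "x = y @ [q]" "length y = Suc (2 * Suc n)"
    using len by (metis length_Suc_conv_rev)
  then obtain z p where x: "x = z @ [p, q]" and z: "length z = 2 * Suc n"
    by (metis append.assoc append_Cons append_Nil length_Suc_conv_rev)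
  have z_ne: "z \<noteq> []" using z by auto
  \<comment> \<open>With \<open>Suc n\<close> ones among \<open>2 * Suc n\<close> bits the walk ends
    at its starting height, so nothing is exempt in this layer.\<close>
  have not_pos: "\<not> (pos_walk z \<and> ones z = Suc n)"
    using pos_walk_appendD[of z "[]"] z z_ne by auto
  have cover: "\<exists>t v i. on_path k' z t v i"
    if "Suc n \<le> k'" "ones z = k' \<or> ones z = Suc k'" "\<not> (pos_walk z \<and> ones z = k')" for k'
    using Suc.IH[OF z that] .
  show ?case
  proof (cases "k = Suc (Suc n)")
    case False
    then have k: "Suc (Suc (Suc n)) \<le> k" using Suc.prems(2) by simp
    have c: "ones [p, q] = of_bool p + of_bool q" "ones x = ones z + ones [p, q]"
      "ones (z @ [p]) = ones z + of_bool p" "of_bool q \<le> (1 :: nat)" "ones [p, q] \<le> 2"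
      by (auto simp: x)
    \<comment> \<open>Above the lowest layer a string with \<open>k\<close> ones has final height at
      least 2, so two more steps cannot bring a strictly positive \<open>z\<close> back down; then
      \<open>x\<close> itself would be exempt.\<close>
    have "\<not> (pos_walk z \<and> ones z = k - ones [p, q])"
    proof
      assume asm: "pos_walk z \<and> ones z = k - ones [p, q]"
      then have "ones x = k" "k \<le> Suc (ones (z @ [p]))" using c k by linarith+
      moreover have "pos_walk (z @ [p])"
        unfolding pos_walk_snoc using asm z k \<open>k \<le> Suc (ones (z @ [p]))\<close> by simp
      moreover have "pos_walk ((z @ [p]) @ [q])"
        unfolding pos_walk_snoc[of "z @ [p]"] using calculation z k x by simp
      ultimately show False using Suc.prems(4) x by simp
    qed
    moreover have "ones z = k - ones [p, q] \<or> ones z = Suc (k - ones [p, q])" "ones [p, q] \<le> k"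
      using Suc.prems(3) k c(2,5) by linarith+
    moreover have "Suc n \<le> k - ones [p, q]" using k c(5) by linarith
    ultimately obtain t v i where "on_path (k - ones [p, q]) z t v i" using cover by blast
    then have "on_path k x t (v @ [p, q]) i"
      unfolding x using k \<open>ones [p, q] \<le> k\<close> z by (intro on_path_append2I[where n = "Suc n"]) auto
    then show ?thesis by blast
  next
    case k: True
    have whole: "\<exists>t v i. on_path k x t v i"
      if "i < length (tree_path t)" "num_vertices t = Suc (Suc n)" "x = tree_path t ! i" for t i
      using that k by (intro exI[of _ t] exI[of _ "[]"] exI[of _ i]) (simp add: on_path_def)
    have inner: "\<exists>t v i. on_path k x t v i"
      if "num_vertices a + num_vertices b = Suc (Suc n)" "0 < i" "i < length (block a b)"
        "x = block a b ! i @ [True]" for a b i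
      using that by (intro whole[of i "snoc_child a b"])
        (simp_all add: tree_path_snoc_child_nth length_tree_path_snoc_child)
    \<comment> \<open>The suffix decides the source: 10 is copied; 00 is copied or, if
      \<open>z\<close> is missed there, begins a new path; 01 and 11 come from the two halves of the
      blocks of the smaller 2-factor.\<close>
    consider (TF) "p" "\<not> q" | (FF) "\<not> p" "\<not> q" | (FT) "\<not> p" q | (TT) p q by blast
    then show ?thesis
    proof cases
      case TF
      then obtain t v i where "on_path (Suc n) z t v i"
        using cover[of "Suc n"] Suc.prems(3) k x not_pos by auto
      then have "on_path k x t (v @ [p, q]) i"
        unfolding x using k z TF by (intro on_path_append2I[where n = "Suc n"]) auto
      then show ?thesis by blast
    next
      case FF
      show ?thesis
      proof (cases "pos_walk z \<and> ones z = k")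
        case True
        obtain z' where z': "z = True # z'" using pos_walk_hd[of z] True z_ne by auto
        then have "ballot z'" "Suc (length z') = 2 * ones z'"
          using True z k by (auto simp: pos_walk_Cons)
        then obtain a b where ab: "z' = word a @ True # word b" using ballot_height_1 by blast
        have "num_vertices (snoc_child a b) = Suc (Suc n)"
          using z z' ab length_word[of a] length_word[of b] by simp
        moreover have "x = tree_path (snoc_child a b) ! 0"
          using x FF z' ab by (simp add: tree_path_snoc_child)
        ultimately show ?thesis by (intro whole[of 0 "snoc_child a b"]) auto
      next
        case False
        then obtain t v i where "on_path k z t v i"
          using cover[of k] Suc.prems(3) k x FF by auto
        then have "on_path k x t (v @ [p, q]) i"
          unfolding x using k z FF by (intro on_path_append2I[where n = "Suc n"]) auto
        then show ?thesis by blast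
      qed
    next
      case FT
      then obtain t v i where o: "on_path (Suc n) z t v i"
        using cover[of "Suc n"] Suc.prems(3) k x not_pos by auto
      obtain b where b: "num_vertices t + num_vertices b = Suc (Suc n)"
        "i < length (tree_path t)" "z @ [False] = block t b ! i"
        using on_path_block_False[OF o z] by blast
      have i: "i < length (block t b)" using b(2) by (simp add: block_def)
      show ?thesis
      proof (cases "i = 0")
        case False
        then show ?thesis using inner[of t b i] b i x FT by simp
      next
        case True
        define s where "s = cons_child t b"
        have nv: "num_vertices s = Suc (Suc n)" using b(1) by (simp add: s_def)
        have "last (tree_path s) = x"
          using b(3) True x FT by (simp add: last_tree_path s_def block_0)
        \<comment> \<open>The head of a block is cut off from the new path that follows this block;
          it is instead the end of the path of the block's own tree.\<close>
        then show ?thesis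
          using nv by (intro whole[of "length (tree_path s) - 1" s]) (auto simp: last_conv_nth)
      qed
    next
      case TT
      have "length (compl_rev z) = 2 * Suc n" using z by simp
      moreover have "ones (compl_rev z) + ones z = 2 * Suc n" using ones_compl_rev[of z] z by simp
      then have "ones (compl_rev z) = Suc n \<or> ones (compl_rev z) = Suc (Suc n)"
        using Suc.prems(3) k x TT by auto
      moreover have "\<not> (pos_walk (compl_rev z) \<and> ones (compl_rev z) = Suc n)"
        using pos_walk_appendD[of "compl_rev z" "[]"] z z_ne by auto
      ultimately obtain t v i where "on_path (Suc n) (compl_rev z) t v i"
        using Suc.IH[of "compl_rev z" "Suc n"] by blast
      from on_path_block_True[OF this z] obtain a b j where
        "num_vertices a + num_vertices b = Suc (Suc n)" "0 < j" "j < length (block a b)"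
        "z @ [True] = block a b ! j" by blast
      then show ?thesis using inner[of a b j] x TT by simp
    qed
  qed
qed

section \<open>Components and cycles in edge sets\<close>

lemma path_edges_Nil [simp]: "path_edges [] = {}"
  and path_edges_singleton [simp]: "path_edges [x] = {}"
  by (auto simp: path_edges_def)

lemma path_edges_conv_image: "path_edges p = (\<lambda>i. {p ! i, p ! Suc i}) ` {i. Suc i < length p}"
  by (auto simp: path_edges_def)

lemma path_edges_Cons [simp]: "path_edges (x # y # p) = insert {x, y} (path_edges (y # p))"
proof -
  have "{i. Suc i < length (x # y # p)} = insert 0 (Suc ` {i. Suc i < length (y # p)})"
  proof (rule set_eqI)
    fix i show "i \<in> {i. Suc i < length (x # y # p)} \<longleftrightarrow> i \<in> insert 0 (Suc ` {i. Suc i < length (y # p)})"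
      by (cases i) auto
  qed
  then show ?thesis by (simp add: path_edges_conv_image image_image)
qed

lemma path_edges_map: "path_edges (map f p) = image f ` path_edges p"
  by (induction p rule: induct_list012) auto

lemma path_edges_append:
  "p \<noteq> [] \<Longrightarrow> q \<noteq> [] \<Longrightarrow> path_edges (p @ q) = path_edges p \<union> {{last p, hd q}} \<union> path_edges q"
  by (induction p rule: induct_list012) (auto simp: neq_Nil_conv)

lemma path_edges_snoc: "p \<noteq> [] \<Longrightarrow> path_edges (p @ [x]) = insert {last p, x} (path_edges p)"
  by (simp add: path_edges_append)

lemma path_edges_rev: "path_edges (rev p) = path_edges p"
proof (induction p rule: induct_list012)
  case (3 x y zs)
  have "path_edges (rev (y # zs) @ [x]) = insert {y, x} (path_edges (rev (y # zs)))"
    by (subst path_edges_snoc) auto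
  with 3 show ?case by (simp add: insert_commute)
qed auto

lemma Union_path_edges_subset: "\<Union> (path_edges p) \<subseteq> set p"
  by (auto simp: path_edges_def)

lemma Union_path_edges:
  "2 \<le> length p \<Longrightarrow> \<Union> (path_edges p) = set p"
proof (induction p rule: induct_list012)
  case (3 x y zs)
  then show ?case by (cases zs) auto
qed auto

text \<open>\<open>P_prime\<close> describes its paths by their edge sets, and this recovers the
  vertex list. The first vertex lies on a single edge, which can be peeled off on both
  sides.\<close>

lemma path_edges_inject:
  assumes "distinct p" "distinct q" "path_edges p = path_edges q" "hd p = hd q" "p \<noteq> []" "q \<noteq> []"
  shows "p = q"
  using assms
proof (induction p arbitrary: q)
  case (Cons x p)
  then obtain q' where q: "q = x # q'" by (cases q) auto
  have *: "path_edges (x # r) = {} \<longleftrightarrow> r = []" for r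
    by (cases r) auto
  show ?case
  proof (cases p)
    case Nil
    then have "path_edges (x # q') = {}" using Cons.prems(3) q by simp
    then show ?thesis using *[of q'] Nil q by simp
  next
    case (Cons y p')
    then have "path_edges (x # q') \<noteq> {}" using Cons.prems(3) q by auto
    then have "q' \<noteq> []" using *[of q'] by simp
    then obtain z q'' where q': "q' = z # q''" by (cases q') auto
    have nin: "x \<notin> \<Union> (path_edges p)" "x \<notin> \<Union> (path_edges q')"
      using Union_path_edges_subset[of p] Union_path_edges_subset[of q'] Cons.prems(1,2) q by auto
    have "insert {x, y} (path_edges p) = insert {x, z} (path_edges q')"
      using Cons.prems(3) Cons q q' by simp
    moreover have "{x, y} \<notin> path_edges q'" "{x, y} \<notin> path_edges p" using nin by auto
    ultimately have "{x, y} = {x, z}" by (metis insertI1 insertE)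
    then have yz: "y = z" by (auto simp: doubleton_eq_iff)
    then have eq: "path_edges p = path_edges q'"
      using insert_ident[of "{x, y}" "path_edges p" "path_edges q'"]
        \<open>insert {x, y} (path_edges p) = _\<close> \<open>{x, y} \<notin> path_edges q'\<close> \<open>{x, y} \<notin> path_edges p\<close> by simp
    have "p = q'"
    proof (rule Cons.IH)
      show "distinct p" "distinct q'" "p \<noteq> []" "q' \<noteq> []"
        using Cons.prems(1,2) Cons \<open>q' \<noteq> []\<close> q by auto
      show "hd p = hd q'" by (simp add: Cons q' yz)
    qed (rule eq)
    then show ?thesis by (simp add: q)
  qed
qed simp

lemma disjoint_paths_components:
  assumes p: "\<And>p. p \<in> P \<Longrightarrow> 2 \<le> length p"
    and disj: "\<And>p q x. p \<in> P \<Longrightarrow> q \<in> P \<Longrightarrow> x \<in> set p \<Longrightarrow> x \<in> set q \<Longrightarrow> p = q"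
  shows "components_of (family_edges P) = path_edges ` P"
proof -
  let ?E = "family_edges P"
  let ?R = "\<lambda>x y. {x, y} \<in> ?E"
  have edge: "q \<in> P \<Longrightarrow> e \<in> path_edges q \<Longrightarrow> e \<subseteq> set q" for q e
    using Union_path_edges_subset[of q] by blast
  have E_p: "e \<in> path_edges p" if "e \<in> ?E" "x \<in> e" "x \<in> set p" "p \<in> P" for e x p
    using that edge disj unfolding family_edges_def by blast
  have comp: "component_of ?E v = path_edges p" if "p \<in> P" "v \<in> set p" for p v
  proof -
    have closed: "?R\<^sup>*\<^sup>* v u \<Longrightarrow> u \<in> set p" for u
    proof (induction rule: rtranclp_induct)
      case (step y z)
      then have "{y, z} \<in> path_edges p" using E_p that(1) by blast
      then show ?case using edge that(1) by blast
    qed (use that in simp)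
    have sym: "symp ?R\<^sup>*\<^sup>*" by (intro symp_rtranclp) (auto simp: symp_def insert_commute)
    have *: "?R\<^sup>*\<^sup>* (p ! 0) (p ! i)" if "i < length p" for i
      using that
    proof (induction i)
      case (Suc i)
      then have "{p ! i, p ! Suc i} \<in> ?E" using \<open>p \<in> P\<close> by (auto simp: family_edges_def path_edges_def)
      with Suc show ?case by (meson Suc_lessD rtranclp.rtrancl_into_rtrancl)
    qed simp
    have reach: "?R\<^sup>*\<^sup>* v u" if "u \<in> set p" for u
    proof -
      have "?R\<^sup>*\<^sup>* (p ! 0) v" "?R\<^sup>*\<^sup>* (p ! 0) u"
        using * that \<open>v \<in> set p\<close> by (auto simp: in_set_conv_nth)
      with sym show ?thesis by (blast intro: rtranclp_trans dest: sympD)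
    qed
    show ?thesis
    proof (intro equalityI subsetI)
      fix e assume "e \<in> component_of ?E v"
      then show "e \<in> path_edges p"
        using closed E_p that(1) by (auto simp: component_of_def)
    next
      fix e assume e: "e \<in> path_edges p"
      then obtain u where "u \<in> e" by (auto simp: path_edges_def)
      then have "?R\<^sup>*\<^sup>* v u" using reach edge[OF that(1) e] by blast
      then show "e \<in> component_of ?E v"
        using e that(1) \<open>u \<in> e\<close> by (auto simp: component_of_def family_edges_def)
    qed
  qed
  have "\<Union> ?E = (\<Union>p\<in>P. set p)"
  proof -
    have "\<Union> ?E = (\<Union>p\<in>P. \<Union> (path_edges p))" by (auto simp: family_edges_def)
    also have "\<dots> = (\<Union>p\<in>P. set p)" using Union_path_edges p by (intro SUP_cong) auto
    finally show ?thesis .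
  qed
  then have "components_of ?E = (\<Union>p\<in>P. component_of ?E ` set p)"
    unfolding components_of_def by (simp only: image_UN)
  also have "\<dots> = (\<Union>p\<in>P. {path_edges p})"
  proof (rule SUP_cong)
    fix q assume q: "q \<in> P"
    then have "set q \<noteq> {}" using p[of q] by auto
    moreover have "component_of ?E ` set q = (\<lambda>_. path_edges q) ` set q"
      using comp[OF q] by (intro image_cong) auto
    ultimately show "component_of ?E ` set q = {path_edges q}" by (auto simp: neq_Nil_conv)
  qed simp
  finally show ?thesis by auto
qed

section \<open>Orbits of a permutation as cycles of a graph\<close>

definition orb :: "('a \<Rightarrow> 'a) \<Rightarrow> 'a \<Rightarrow> 'a set" where
  "orb f x = range (\<lambda>j. (f ^^ j) x)"

lemma funpow_in_orb [simp]: "(f ^^ j) x \<in> orb f x"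
  by (simp add: orb_def)

lemma self_in_orb [simp]: "x \<in> orb f x"
  using funpow_in_orb[of 0 f x] by simp

lemma orb_period:
  assumes "0 < m" "(f ^^ m) x = x"
  obtains p where "0 < p" "\<forall>k. (f ^^ k) x = x \<longleftrightarrow> p dvd k"
    "inj_on (\<lambda>i. (f ^^ i) x) {..<p}" "orb f x = (\<lambda>i. (f ^^ i) x) ` {..<p}"
proof -
  define p where "p = (LEAST p. 0 < p \<and> (f ^^ p) x = x)"
  have p: "0 < p" "(f ^^ p) x = x"
    using LeastI[of "\<lambda>p. 0 < p \<and> (f ^^ p) x = x" m] assms by (simp_all add: p_def)
  have least: "(f ^^ k) x \<noteq> x" if "0 < k" "k < p" for k
    using not_less_Least[of k "\<lambda>p. 0 < p \<and> (f ^^ p) x = x"] that by (auto simp: p_def)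
  have mult: "(f ^^ (p * k)) x = x" for k
    by (induction k) (simp_all add: funpow_add p(2))
  have red: "(f ^^ k) x = (f ^^ (k mod p)) x" for k
  proof -
    have "(f ^^ (k mod p + p * (k div p))) x = (f ^^ (k mod p)) x"
      by (simp only: funpow_add comp_apply mult)
    then show ?thesis by simp
  qed
  have "(f ^^ k) x = x \<longleftrightarrow> p dvd k" for k
    using red[of k] least[of "k mod p"] p(1) by (auto simp: dvd_eq_mod_eq_0)
  moreover have "inj_on (\<lambda>i. (f ^^ i) x) {..<p}"
  proof (rule linorder_inj_onI)
    fix i j assume ij: "i < j" "i \<in> {..<p}" "j \<in> {..<p}"
    show "(f ^^ i) x \<noteq> (f ^^ j) x"
    proof
      assume "(f ^^ i) x = (f ^^ j) x"
      then have "(f ^^ (p - j)) ((f ^^ i) x) = (f ^^ (p - j)) ((f ^^ j) x)" by simp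
      then have "(f ^^ (p - j + i)) x = (f ^^ (p - j + j)) x" by (simp only: funpow_add comp_apply)
      moreover have "p - j + j = p" "0 < p - j + i" "p - j + i < p" using ij by auto
      ultimately show False using least[of "p - j + i"] p by simp
    qed
  qed (simp add: linorder_linear)
  moreover have "orb f x = (\<lambda>i. (f ^^ i) x) ` {..<p}"
    unfolding orb_def using red p(1) by (auto simp: image_iff) (metis lessThan_iff mod_less_divisor)
  ultimately show ?thesis using that p(1) by blast
qed

lemma orb_closed: "y \<in> orb f x \<Longrightarrow> f y \<in> orb f x"
proof -
  assume "y \<in> orb f x"
  then obtain j where "y = (f ^^ j) x" by (auto simp: orb_def)
  then have "f y = (f ^^ Suc j) x" by simp
  then show ?thesis by (simp only: funpow_in_orb)
qed

lemma orb_subset: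
  assumes "x \<in> A" "\<And>y. y \<in> A \<Longrightarrow> f y \<in> A"
  shows "orb f x \<subseteq> A"
proof -
  have "(f ^^ j) x \<in> A" for j by (induction j) (use assms in auto)
  then show ?thesis by (auto simp: orb_def)
qed

lemma finite_permutation_period:
  assumes f: "bij_betw f V V" and "finite V" "x \<in> V"
  obtains m where "0 < m" "(f ^^ m) x = x"
proof -
  have V: "(f ^^ j) x \<in> V" for j
    using assms(3) f by (induction j) (auto simp: bij_betw_def)
  have "finite (range (\<lambda>j. (f ^^ j) x))"
    using V by (intro finite_subset[OF _ assms(2)]) auto
  then have "\<not> inj (\<lambda>j. (f ^^ j) x)" using finite_imageD by fastforce
  then obtain i j where ij: "i < j" "(f ^^ i) x = (f ^^ j) x"
    using linorder_injI[of "\<lambda>j. (f ^^ j) x"] by blast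
  have "(f ^^ (i + (j - i))) x = (f ^^ i) ((f ^^ (j - i)) x)"
    by (simp only: funpow_add comp_apply)
  then have "(f ^^ i) x = (f ^^ i) ((f ^^ (j - i)) x)" using ij by simp
  moreover have "inj_on (f ^^ i) V"
    using bij_betw_funpow[OF f, of i] by (simp add: bij_betw_def)
  ultimately have "x = (f ^^ (j - i)) x" using V assms(3) by (auto dest: inj_onD)
  with ij(1) that[of "j - i"] show ?thesis by simp
qed

text \<open>The condition \<open>no_short\<close> excludes fixed points as well as 2-cycles. Both
  would spoil the degree: a fixed point gives a loop, and a 2-cycle gives only one edge.\<close>

locale permutation_graph =
  fixes f :: "'a \<Rightarrow> 'a" and V :: "'a set"
  assumes finite: "finite V" and bij: "bij_betw f V V" and no_short: "x \<in> V \<Longrightarrow> f (f x) \<noteq> x"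
begin

definition edge :: "'a \<Rightarrow> 'a set" where
  "edge x = {x, f x}"

lemma f_in [simp]: "x \<in> V \<Longrightarrow> f x \<in> V"
  using bij by (auto simp: bij_betw_def)

lemma f_eq_iff: "x \<in> V \<Longrightarrow> y \<in> V \<Longrightarrow> f x = f y \<longleftrightarrow> x = y"
  using bij by (auto simp: bij_betw_def inj_on_def)

lemma f_neq: "x \<in> V \<Longrightarrow> f x \<noteq> x"
  using no_short[of x] by auto

lemma inj_edge: "inj_on edge V"
  using no_short by (fastforce simp: edge_def doubleton_eq_iff intro: inj_onI)

lemma degree_2:
  assumes "v \<in> V"
  shows "card {e \<in> edge ` V. v \<in> e} = 2"
proof -
  obtain u where u: "u \<in> V" "f u = v" using assms bij unfolding bij_betw_def by (metis imageE)
  have "{e \<in> edge ` V. v \<in> e} = {edge v, edge u}"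
    using assms u f_eq_iff by (auto simp: edge_def)
  moreover have "edge v \<noteq> edge u" using inj_edge assms u f_neq by (auto dest: inj_onD)
  ultimately show ?thesis by simp
qed

lemma edge_adjacent: "{x, y} \<in> edge ` V \<longleftrightarrow> x \<in> V \<and> y \<in> V \<and> (y = f x \<or> x = f y)"
  by (auto simp: edge_def doubleton_eq_iff)

lemma orb_in: "x \<in> V \<Longrightarrow> orb f x \<subseteq> V"
  by (intro orb_subset) auto

lemma orb_cycle: "x \<in> V \<Longrightarrow> edge ` orb f x \<in> cycle_subgraphs (edge ` V)"
proof -
  assume x: "x \<in> V"
  obtain m where m: "0 < m" "(f ^^ m) x = x"
    using finite_permutation_period[OF bij finite x] by blast
  obtain p where p: "0 < p" "\<forall>k. (f ^^ k) x = x \<longleftrightarrow> p dvd k"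
    "inj_on (\<lambda>i. (f ^^ i) x) {..<p}" "orb f x = (\<lambda>i. (f ^^ i) x) ` {..<p}"
    by (rule orb_period[OF m])
  define c where "c = map (\<lambda>i. (f ^^ i) x) [0..<p]"
  have "p \<noteq> 1" "p \<noteq> 2" using spec[OF p(2), of 1] spec[OF p(2), of 2] f_neq[OF x] no_short[OF x] by (auto simp: numeral_2_eq_2)
  then have len: "3 \<le> length c" using p(1) by (simp add: c_def)
  have px: "(f ^^ p) x = x" using p(2) by simp
  have hd: "hd c = x" using p(1) by (simp add: c_def hd_map)
  have nth: "(c @ [hd c]) ! i = (f ^^ i) x" if "i \<le> p" for i
    using that px hd by (cases "i = p") (auto simp: c_def nth_append)
  have "path_edges (c @ [hd c]) = (\<lambda>i. {(f ^^ i) x, (f ^^ Suc i) x}) ` {..<p}"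
    unfolding path_edges_conv_image
    by (intro image_cong) (use nth in \<open>auto simp: c_def simp del: funpow.simps\<close>)
  then have "path_edges (c @ [hd c]) = edge ` orb f x"
    by (simp add: p(4) image_image edge_def)
  moreover have "distinct c" using p(3) by (simp add: c_def distinct_map atLeast0LessThan)
  moreover have "edge ` orb f x \<subseteq> edge ` V" using orb_in[OF x] by blast
  ultimately show ?thesis using len unfolding cycle_subgraphs_def by (smt (verit) mem_Collect_eq)
qed

text \<open>The first edge is traversed either along \<open>f\<close> or against it. As a cycle
  never turns back at once, the direction persists, and the cycle is a whole orbit.\<close>

lemma cycle_orb:
  assumes c: "distinct c" "3 \<le> length c" "path_edges (c @ [hd c]) \<subseteq> edge ` V"
  shows "\<exists>x\<in>V. path_edges (c @ [hd c]) = edge ` orb f x"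
proof -
  define l where "l = length c"
  \<comment> \<open>The periodic continuation of \<open>c\<close> removes the special role of the
    closing edge.\<close>
  define d where "d i = c ! (i mod l)" for i
  have l: "3 \<le> l" using c(2) by (simp add: l_def)
  have d_nth: "d i = (c @ [hd c]) ! i" if "i \<le> l" for i
    using that l by (cases "i = l") (auto simp: d_def l_def nth_append intro!: hd_conv_nth[symmetric])
  have set_c: "range d = set c"
  proof -
    have "d i \<in> set c" for i
    proof -
      have "i mod l < l" using l by simp
      then show ?thesis by (simp add: d_def l_def)
    qed
    moreover have "c ! i = d i" if "i < l" for i using that by (simp add: d_def)
    ultimately show ?thesis by (auto simp: in_set_conv_nth l_def)
  qed
  have pe: "path_edges (c @ [hd c]) = range (\<lambda>i. {d i, d (Suc i)})"
  proof -
    have "path_edges (c @ [hd c]) = (\<lambda>i. {d i, d (Suc i)}) ` {..<l}"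
      unfolding path_edges_conv_image by (intro image_cong) (auto simp: d_nth l_def)
    moreover have "{d i, d (Suc i)} = {d (i mod l), d (Suc (i mod l))}" for i
      by (simp add: d_def mod_Suc_eq)
    then have "range (\<lambda>i. {d i, d (Suc i)}) = (\<lambda>i. {d i, d (Suc i)}) ` {..<l}"
      using l by (auto simp: image_iff) (metis (no_types) lessThan_iff less_le_trans mod_less_divisor zero_less_numeral)
    ultimately show ?thesis by simp
  qed
  have adj: "d i \<in> V \<and> (d (Suc i) = f (d i) \<or> d i = f (d (Suc i)))" for i
    using c(3) edge_adjacent[of "d i" "d (Suc i)"] unfolding pe by blast
  have two: "d (Suc (Suc i)) \<noteq> d i" for i
  proof
    assume "d (Suc (Suc i)) = d i"
    then have "Suc (Suc i) mod l = i mod l"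
      using nth_eq_iff_index_eq[OF c(1), of "Suc (Suc i) mod l" "i mod l"] l
      by (simp add: d_def l_def[symmetric])
    then have "l dvd Suc (Suc i) - i" by (metis mod_eq_dvd_iff_nat le_add2 add_2_eq_Suc)
    then have "l dvd 2" by simp
    then show False using l by (auto dest: dvd_imp_le)
  qed
  \<comment> \<open>Edge number \<open>i\<close> leaves \<open>d i\<close> when the cycle runs along
    \<open>f\<close>, and leaves \<open>d (Suc i)\<close> when it runs against it; \<open>g\<close>
    is \<open>id\<close> or \<open>Suc\<close> accordingly.\<close>
  have fin: "path_edges (c @ [hd c]) = edge ` orb f (d 0)"
    if e: "\<And>i. {d i, d (Suc i)} = edge (d (g i))" and g: "range (\<lambda>i. d (g i)) = range d"
      and up: "\<And>i. f (d i) \<in> range d" and down: "\<And>i. d i \<in> orb f (d 0)" for g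
  proof -
    have "path_edges (c @ [hd c]) = edge ` range (\<lambda>i. d (g i))"
      unfolding pe e by (simp add: image_image)
    also have "range (\<lambda>i. d (g i)) = orb f (d 0)"
      unfolding g using up down by (intro equalityI orb_subset) auto
    finally show ?thesis .
  qed
  have dl: "d (l * i) = d 0" for i by (simp add: d_def)
  have "path_edges (c @ [hd c]) = edge ` orb f (d 0)"
  proof (cases "d (Suc 0) = f (d 0)")
    case True
    have step: "d (Suc i) = f (d i)" for i
    proof (induction i)
      case (Suc i)
      then show ?case using adj[of "Suc i"] adj[of "Suc (Suc i)"] adj[of i] two[of i] f_eq_iff by metis
    qed (rule True)
    have pow: "d i = (f ^^ i) (d 0)" for i by (induction i) (simp_all add: step)
    show ?thesis
    proof (rule fin[of id])
      show "{d i, d (Suc i)} = edge (d (id i))" for i by (simp add: edge_def step)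
      show "f (d i) \<in> range d" for i unfolding step[symmetric] by (rule rangeI)
      show "d i \<in> orb f (d 0)" for i by (subst pow) (rule funpow_in_orb)
    qed simp
  next
    case False
    then have F: "d 0 = f (d (Suc 0))" using adj[of 0] by auto
    have step: "d i = f (d (Suc i))" for i
    proof (induction i)
      case (Suc i)
      then show ?case using adj[of "Suc i"] two[of i] by metis
    qed (rule F)
    have shift: "(f ^^ j) (d (i + j)) = d i" for i j
    proof (induction j)
      case (Suc j)
      have "(f ^^ Suc j) (d (i + Suc j)) = (f ^^ j) (f (d (Suc (i + j))))"
        by (simp only: funpow_Suc_right comp_apply add_Suc_right)
      with Suc show ?case by (simp only: step[symmetric])
    qed simp
    have per: "d (i + l) = d i" for i by (simp add: d_def)
    \<comment> \<open>Here \<open>f\<close> decreases the index, so \<open>d i\<close> is reached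
      from \<open>d (l * i)\<close>, which is \<open>d 0\<close>.\<close>
    have 1: "d i \<in> orb f (d 0)" for i
    proof -
      have "1 * i \<le> l * i" using l by (intro mult_right_mono) auto
      then have "i \<le> l * i" by simp
      then have "(f ^^ (l * i - i)) (d 0) = d i"
        using shift[of "l * i - i" i] dl[of i] by simp
      then show ?thesis by (metis funpow_in_orb)
    qed
    have 2: "d i = d (Suc (i + (l - 1)))" for i using per[of i] l by simp
    then have "range (\<lambda>i. d (Suc i)) = range d" by blast
    moreover have "f (d i) \<in> range d" for i
      using step[of "i + (l - 1)", folded 2] by (metis rangeI)
    moreover have "{d i, d (Suc i)} = edge (d (Suc i))" for i
      using step[of i] by (auto simp: edge_def)
    ultimately show ?thesis using 1 by (intro fin[of Suc])
  qed
  then show ?thesis by (rule bexI[of _ "d 0"]) (rule conjunct1[OF adj[of 0]])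
qed

lemma cycle_subgraphs_eq: "cycle_subgraphs (edge ` V) = (\<lambda>x. edge ` orb f x) ` V"
proof (intro equalityI subsetI)
  fix C assume "C \<in> cycle_subgraphs (edge ` V)"
  then show "C \<in> (\<lambda>x. edge ` orb f x) ` V"
    unfolding cycle_subgraphs_def using cycle_orb by (auto simp: image_iff)
next
  fix C assume "C \<in> (\<lambda>x. edge ` orb f x) ` V"
  then show "C \<in> cycle_subgraphs (edge ` V)" using orb_cycle by blast
qed

end

section \<open>The families of paths and the 2-factor for zero parameters\<close>

fun rotate_tree :: "otree \<Rightarrow> otree" where
  "rotate_tree (Node []) = Node []"
| "rotate_tree (Node (Node us # vs)) = Node (us @ [Node vs])"

fun tree_block :: "otree \<Rightarrow> bitstring list" where
  "tree_block (Node []) = []"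
| "tree_block (Node (a # bs)) = block a (Node bs)"

lemma rotate_cons_child [simp]: "rotate_tree (cons_child a b) = snoc_child a b"
  by (cases a; cases b) (simp add: cons_child_def snoc_child_def)

lemma tree_block_cons_child [simp]: "tree_block (cons_child a b) = block a b"
  by (cases b) (simp add: cons_child_def)

lemma num_vertices_rotate [simp]: "num_vertices (rotate_tree t) = num_vertices t"
  by (cases t rule: otree_cons_cases) simp_all

lemma rotate_in_ordered_trees [simp]: "rotate_tree t \<in> ordered_trees m \<longleftrightarrow> t \<in> ordered_trees m"
  by (simp add: ordered_trees_def)

lemma ordered_trees_Suc_cons:
  assumes "t \<in> ordered_trees (Suc n)" "1 \<le> n"
  obtains a b where "t = cons_child a b" "num_vertices a + num_vertices b = Suc n"
  using assms by (cases t rule: otree_cons_cases) (auto simp: ordered_trees_def)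

lemma ordered_trees_Suc_snoc:
  assumes "t \<in> ordered_trees (Suc n)" "1 \<le> n"
  obtains a b where "t = snoc_child a b" "num_vertices a + num_vertices b = Suc n"
  using assms by (cases t rule: otree_snoc_cases) (auto simp: ordered_trees_def)

lemma bij_rotate: "bij_betw rotate_tree (ordered_trees (Suc n)) (ordered_trees (Suc n))"
proof (cases "n = 0")
  case True
  have "ordered_trees (Suc 0) = {Node []}" by (auto simp: ordered_trees_def num_vertices_eq_1)
  then show ?thesis using True by (simp add: bij_betw_def)
next
  case False
  then have n: "1 \<le> n" by simp
  show ?thesis
  proof (rule bij_betw_imageI)
    show "inj_on rotate_tree (ordered_trees (Suc n))"
    proof (rule inj_onI)
      fix s t assume st: "s \<in> ordered_trees (Suc n)" "t \<in> ordered_trees (Suc n)"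
        "rotate_tree s = rotate_tree t"
      obtain a b where "s = cons_child a b" by (rule ordered_trees_Suc_cons[OF st(1) n])
      moreover obtain c d where "t = cons_child c d" by (rule ordered_trees_Suc_cons[OF st(2) n])
      ultimately show "s = t" using st(3) by simp
    qed
    show "rotate_tree ` ordered_trees (Suc n) = ordered_trees (Suc n)"
    proof (intro equalityI subsetI)
      fix t assume t: "t \<in> ordered_trees (Suc n)"
      obtain a b where "t = snoc_child a b" by (rule ordered_trees_Suc_snoc[OF t n])
      then have "t = rotate_tree (cons_child a b)" by simp
      with t show "t \<in> rotate_tree ` ordered_trees (Suc n)" by (metis image_eqI rotate_in_ordered_trees)
    qed auto
  qed
qed

lemma finite_ordered_trees [simp]: "finite (ordered_trees m)"
proof (rule finite_imageD)
  have "word ` ordered_trees m \<subseteq> {x. set x \<subseteq> UNIV \<and> length x \<le> 2 * m}"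
  proof (intro subsetI)
    fix x assume "x \<in> word ` ordered_trees m"
    then obtain t where "x = word t" "num_vertices t = m" by (auto simp: ordered_trees_def)
    then show "x \<in> {x. set x \<subseteq> UNIV \<and> length x \<le> 2 * m}" using length_word[of t] by simp
  qed
  then show "finite (word ` ordered_trees m)"
    using finite_lists_length_le[of "UNIV :: bool set" "2 * m"] by (rule finite_subset) simp
qed (simp add: inj_on_def)

lemma length_tree_block:
  assumes "t \<in> ordered_trees (Suc n)" "1 \<le> n"
  shows "length (tree_block t) = 4 * n + 2"
proof -
  obtain a b where "t = cons_child a b" "num_vertices a + num_vertices b = Suc n"
    by (rule ordered_trees_Suc_cons[OF assms])
  then show ?thesis using length_block[of a b] by simp
qed

lemma hd_tree_block: "t \<in> ordered_trees (Suc n) \<Longrightarrow> 1 \<le> n \<Longrightarrow> hd (tree_block t) = word t @ [False]"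
  by (elim ordered_trees_Suc_cons) (simp_all add: hd_block)

lemma last_tree_block:
  "t \<in> ordered_trees (Suc n) \<Longrightarrow> 1 \<le> n \<Longrightarrow> last (tree_block t) = word (rotate_tree t) @ [True]"
  by (elim ordered_trees_Suc_cons) (simp_all add: last_block)

lemma tree_block_inject:
  assumes "s \<in> ordered_trees (Suc n)" "t \<in> ordered_trees (Suc n)" "1 \<le> n"
    and "i < 4 * n + 2" "j < 4 * n + 2" "tree_block s ! i = tree_block t ! j"
  shows "s = t \<and> i = j"
proof -
  obtain m where m: "n = Suc m" using assms(3) by (cases n) auto
  obtain a b where s: "s = cons_child a b" "num_vertices a + num_vertices b = Suc n"
    by (rule ordered_trees_Suc_cons[OF assms(1,3)])
  obtain c d where t: "t = cons_child c d" "num_vertices c + num_vertices d = Suc n"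
    by (rule ordered_trees_Suc_cons[OF assms(2,3)])
  have "a = c \<and> b = d \<and> i = j"
    using length_block[of a b] length_block[of c d] s t assms(4-6) m
    by (intro block_inject[of n] on_path_inject[of _ m]) auto
  then show ?thesis using s t by simp
qed

lemma Q_vertices_iff:
  "x \<in> Q_vertices (2 * n + 1) n \<longleftrightarrow> length x = 2 * n + 1 \<and> (ones x = n \<or> ones x = Suc n)"
  by (auto simp: Q_vertices_def layer_def)

lemma tree_block_in_Q:
  assumes "t \<in> ordered_trees (Suc n)" "1 \<le> n" "i < 4 * n + 2"
  shows "tree_block t ! i \<in> Q_vertices (2 * n + 1) n"
proof -
  obtain a b where t: "t = cons_child a b" "num_vertices a + num_vertices b = Suc n"
    by (rule ordered_trees_Suc_cons[OF assms(1,2)])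
  have i: "i < length (block a b)" using length_tree_block[OF assms(1,2)] assms(3) t by simp
  then have "block a b ! i \<in> set (block a b)" by simp
  then have "length (block a b ! i) = 2 * n + 1"
    using length_block_member[of "block a b ! i" a b] t(2) by simp
  moreover have "ones (block a b ! i) = n + i mod 2" using ones_block[OF i] t(2) by simp
  moreover have "i mod 2 = 0 \<or> i mod 2 = 1" by linarith
  ultimately show ?thesis using t unfolding Q_vertices_iff by auto
qed

lemma tree_block_cover:
  assumes "x \<in> Q_vertices (2 * n + 1) n" "1 \<le> n"
  obtains t i where "t \<in> ordered_trees (Suc n)" "i < 4 * n + 2" "x = tree_block t ! i"
proof -
  obtain m where m: "n = Suc m" using assms(2) by (cases n) auto
  have x: "length x = Suc (2 * n)" "ones x = n \<or> ones x = Suc n"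
    using assms(1) unfolding Q_vertices_iff by simp_all
  obtain z q where zq: "x = z @ [q]" "length z = 2 * n"
    using x(1) by (metis length_Suc_conv_rev)
  have ne: "z \<noteq> []" using zq m by auto
  have "\<exists>a b i. num_vertices a + num_vertices b = Suc n \<and> i < length (block a b) \<and> x = block a b ! i"
  proof (cases q)
    case False
    have "\<not> (pos_walk z \<and> ones z = n)"
      using pos_walk_appendD[of z "[]"] zq ne by auto
    then obtain t v i where o: "on_path n z t v i"
      using on_path_exists[of z m n] x zq m False by auto
    obtain b where "num_vertices t + num_vertices b = Suc n" "i < length (tree_path t)"
      "z @ [False] = block t b ! i" by (rule on_path_block_False[OF o zq(2)])
    then show ?thesis using zq(1) False
      by (intro exI[of _ t] exI[of _ b] exI[of _ i]) (simp add: block_def)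
  next
    case True
    have "ones (compl_rev z) + ones z = 2 * n" using ones_compl_rev[of z] zq by simp
    then have "ones (compl_rev z) = n \<or> ones (compl_rev z) = Suc n" using x zq True by auto
    moreover have "\<not> (pos_walk (compl_rev z) \<and> ones (compl_rev z) = n)"
      using pos_walk_appendD[of "compl_rev z" "[]"] zq ne by auto
    ultimately obtain t v i where o: "on_path n (compl_rev z) t v i"
      using on_path_exists[of "compl_rev z" m n] zq m by auto
    obtain a b j where "num_vertices a + num_vertices b = Suc n" "0 < j" "j < length (block a b)"
      "z @ [True] = block a b ! j" by (rule on_path_block_True[OF o zq(2)])
    then show ?thesis using zq(1) True
      by (intro exI[of _ a] exI[of _ b] exI[of _ j]) simp
  qed
  then obtain a b i where *: "num_vertices a + num_vertices b = Suc n" "i < length (block a b)"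
    "x = block a b ! i" by blast
  then show ?thesis
    using that[of "cons_child a b" i] length_block[of a b] by (simp add: ordered_trees_def)
qed

lemma f_map_zero: "f_map (replicate j False) x = compl_rev x"
proof -
  have *: "swap_pairs (replicate j False) y = y" for j y
  proof (induction "replicate j False" y arbitrary: j rule: swap_pairs.induct)
    case (1 a as x y xs)
    then show ?case by (cases j) auto
  qed auto
  then have "pi_map (replicate j False) x = x" by (cases x) simp_all
  then show ?thesis by (simp add: f_map_def)
qed

text \<open>The closed form claimed for the families: the path of a tree, carrying the letters that
  later recursion steps have appended.\<close>

definition zero_paths :: "nat \<Rightarrow> nat \<Rightarrow> bitstring list set" where
  "zero_paths n k = {map (\<lambda>x. x @ v) (tree_path t) | t v.
     2 * num_vertices t + length v = 2 * n \<and> ballot v \<and> num_vertices t + ones v = k}"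

definition split_path :: "otree \<times> otree \<Rightarrow> bitstring list" where
  "split_path = (\<lambda>(a, b). map (\<lambda>x. x @ word b) (tree_path a))"

definition tree_pairs :: "nat \<Rightarrow> (otree \<times> otree) set" where
  "tree_pairs n = {(a, b). num_vertices a + num_vertices b = Suc n}"

lemma zero_paths_middle: "zero_paths n n = split_path ` tree_pairs n"
proof (intro equalityI subsetI)
  fix p assume "p \<in> zero_paths n n"
  then obtain t v where *: "p = map (\<lambda>x. x @ v) (tree_path t)"
    "2 * num_vertices t + length v = 2 * n" "ballot v" "num_vertices t + ones v = n"
    by (auto simp: zero_paths_def)
  then have "length v = 2 * ones v" by simp
  with *(3) obtain b where b: "v = word b" using ballot_height_0 by blast
  then have "p = split_path (t, b)" "(t, b) \<in> tree_pairs n"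
    using * ones_word[of b] by (auto simp: split_path_def tree_pairs_def)
  then show "p \<in> split_path ` tree_pairs n" by blast
next
  fix p assume "p \<in> split_path ` tree_pairs n"
  then obtain a b where *: "p = map (\<lambda>x. x @ word b) (tree_path a)"
    "num_vertices a + num_vertices b = Suc n" by (auto simp: split_path_def tree_pairs_def)
  have "2 * num_vertices a + length (word b) = 2 * n" "num_vertices a + ones (word b) = n"
    using *(2) length_word[of b] ones_word[of b] by linarith+
  then show "p \<in> zero_paths n n" unfolding zero_paths_def using *(1) ballot_word[of b] by blast
qed

lemma image_cons_child_tree_pairs:
  assumes "1 \<le> n"
  shows "(\<lambda>(a, b). cons_child a b) ` tree_pairs n = ordered_trees (Suc n)"
proof (intro equalityI subsetI)
  fix t assume t: "t \<in> ordered_trees (Suc n)"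
  obtain a b where "t = cons_child a b" "num_vertices a + num_vertices b = Suc n"
    by (rule ordered_trees_Suc_cons[OF t assms])
  then show "t \<in> (\<lambda>(a, b). cons_child a b) ` tree_pairs n"
    by (intro image_eqI[of _ _ "(a, b)"]) (simp_all add: tree_pairs_def)
qed (auto simp: tree_pairs_def ordered_trees_def)

lemma F_set_zero_paths: "1 \<le> n \<Longrightarrow> F_set (zero_paths n n) = word ` ordered_trees (Suc n)"
  unfolding F_set_def zero_paths_middle image_image
  by (subst image_cons_child_tree_pairs[symmetric], assumption, unfold image_image)
    (rule image_cong, auto simp: split_path_def hd_map hd_conv_nth tree_path_0)

lemma S_set_zero_paths:
  "S_set (zero_paths n n) = (\<lambda>(a, b). True # word a @ True # word b) ` tree_pairs n"
  unfolding S_set_def zero_paths_middle image_image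
proof (rule image_cong)
  fix p assume "p \<in> tree_pairs n"
  show "split_path p ! 1 = (case p of (a, b) \<Rightarrow> True # word a @ True # word b)"
    using tree_path_1[of "fst p"] length_tree_path_ge[of "fst p"]
    by (auto simp: split_path_def split: prod.splits)
qed simp

lemma L_set_zero_paths:
  "L_set (zero_paths n n) = (\<lambda>(a, b). word a @ [False, True] @ word b) ` tree_pairs n"
  unfolding L_set_def zero_paths_middle image_image
  by (rule image_cong) (auto simp: split_path_def last_map last_tree_path)

section \<open>The 2-factor in terms of trees and positions in their blocks\<close>

definition codes :: "nat \<Rightarrow> (otree \<times> nat) set" where
  "codes n = ordered_trees (Suc n) \<times> {..<4 * n + 2}"

definition decode :: "otree \<times> nat \<Rightarrow> bitstring" where
  "decode = (\<lambda>(t, i). tree_block t ! i)"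

definition next_code :: "nat \<Rightarrow> otree \<times> nat \<Rightarrow> otree \<times> nat" where
  "next_code n = (\<lambda>(t, i). if Suc i < 4 * n + 2 then (t, Suc i) else (rotate_tree t, 0))"

definition code_edge :: "nat \<Rightarrow> otree \<times> nat \<Rightarrow> bitstring set" where
  "code_edge n c = {decode c, decode (next_code n c)}"

lemma bij_decode: "1 \<le> n \<Longrightarrow> bij_betw decode (codes n) (Q_vertices (2 * n + 1) n)"
proof (rule bij_betw_imageI)
  assume n: "1 \<le> n"
  show "inj_on decode (codes n)"
    by (auto simp: inj_on_def codes_def decode_def dest: tree_block_inject[OF _ _ n])
  show "decode ` codes n = Q_vertices (2 * n + 1) n"
  proof (intro equalityI subsetI)
    fix x assume x: "x \<in> Q_vertices (2 * n + 1) n"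
    obtain t i where "t \<in> ordered_trees (Suc n)" "i < 4 * n + 2" "x = tree_block t ! i"
      by (rule tree_block_cover[OF x n])
    then show "x \<in> decode ` codes n"
      by (intro image_eqI[of _ _ "(t, i)"]) (simp_all add: decode_def codes_def)
  qed (use n tree_block_in_Q in \<open>auto simp: decode_def codes_def\<close>)
qed

lemma path_edges_tree_block:
  assumes "t \<in> ordered_trees (Suc n)" "1 \<le> n"
  shows "path_edges (tree_block t) = (\<lambda>i. code_edge n (t, i)) ` {..<4 * n + 1}"
  unfolding path_edges_conv_image length_tree_block[OF assms]
  by (rule image_cong) (auto simp: code_edge_def decode_def next_code_def)

lemma code_edge_last:
  assumes "t \<in> ordered_trees (Suc n)" "1 \<le> n"
  shows "code_edge n (t, 4 * n + 1) = {last (tree_block t), hd (tree_block (rotate_tree t))}"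
proof -
  have "length (tree_block t) = 4 * n + 2" "length (tree_block (rotate_tree t)) = 4 * n + 2"
    using length_tree_block assms by auto
  then have "tree_block t \<noteq> []" "tree_block (rotate_tree t) \<noteq> []" by auto
  then show ?thesis using length_tree_block[OF assms]
    by (simp add: code_edge_def decode_def next_code_def last_conv_nth hd_conv_nth)
qed

lemma code_edges_eq:
  assumes "1 \<le> n"
  shows "code_edge n ` codes n =
    (\<Union>t\<in>ordered_trees (Suc n). path_edges (tree_block t)
      \<union> {{last (tree_block t), hd (tree_block (rotate_tree t))}})"
proof -
  have "code_edge n ` codes n = (\<Union>t\<in>ordered_trees (Suc n). (\<lambda>i. code_edge n (t, i)) ` {..<4 * n + 2})"
    by (auto simp: codes_def)
  also have "\<dots> = (\<Union>t\<in>ordered_trees (Suc n). path_edges (tree_block t)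
      \<union> {{last (tree_block t), hd (tree_block (rotate_tree t))}})"
  proof (rule SUP_cong)
    fix t assume t: "t \<in> ordered_trees (Suc n)"
    have "{..<4 * n + 2} = insert (4 * n + 1) {..<4 * n + 1}" by auto
    then show "(\<lambda>i. code_edge n (t, i)) ` {..<4 * n + 2} = path_edges (tree_block t)
      \<union> {{last (tree_block t), hd (tree_block (rotate_tree t))}}"
      using path_edges_tree_block[OF t assms] code_edge_last[OF t assms] by simp
  qed simp
  finally show ?thesis .
qed

lemma bij_next_code: "1 \<le> n \<Longrightarrow> bij_betw (next_code n) (codes n) (codes n)"
proof -
  assume n: "1 \<le> n"
  have "inj_on (next_code n) (codes n)"
  proof (rule inj_onI)
    fix c d assume cd: "c \<in> codes n" "d \<in> codes n" "next_code n c = next_code n d"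
    obtain s i t j where e: "c = (s, i)" "d = (t, j)" by (cases c; cases d)
    have "rotate_tree s = rotate_tree t \<Longrightarrow> s = t"
      using cd(1,2) e bij_rotate[of n] by (auto simp: codes_def bij_betw_def dest: inj_onD)
    then show "c = d" using cd e by (auto simp: next_code_def codes_def split: if_splits)
  qed
  moreover have "next_code n ` codes n \<subseteq> codes n"
    by (auto simp: next_code_def codes_def split: if_splits)
  moreover have "finite (codes n)" by (simp add: codes_def)
  ultimately show ?thesis by (simp add: bij_betw_def endo_inj_surj)
qed

lemma next_next_code: "c \<in> codes n \<Longrightarrow> 1 \<le> n \<Longrightarrow> next_code n (next_code n c) \<noteq> c"
  by (auto simp: codes_def next_code_def split: if_splits)

definition next_vertex :: "nat \<Rightarrow> bitstring \<Rightarrow> bitstring" where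
  "next_vertex n x = decode (next_code n (inv_into (codes n) decode x))"

lemma next_code_in: "c \<in> codes n \<Longrightarrow> 1 \<le> n \<Longrightarrow> next_code n c \<in> codes n"
  using bij_next_code by (auto simp: bij_betw_def)

lemma inj_decode: "1 \<le> n \<Longrightarrow> inj_on decode (codes n)"
  using bij_decode by (simp add: bij_betw_def)

lemma next_vertex_decode: "c \<in> codes n \<Longrightarrow> 1 \<le> n \<Longrightarrow> next_vertex n (decode c) = decode (next_code n c)"
  by (simp add: next_vertex_def inv_into_f_f inj_decode)

lemma permutation_graph_next_vertex:
  assumes "1 \<le> n"
  shows "permutation_graph (next_vertex n) (Q_vertices (2 * n + 1) n)"
proof
  have Q: "Q_vertices (2 * n + 1) n = decode ` codes n"
    using bij_decode[OF assms] by (simp add: bij_betw_def)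
  show "finite (Q_vertices (2 * n + 1) n)" unfolding Q by (simp add: codes_def)
  have "bij_betw (\<lambda>x. decode (next_code n (inv_into (codes n) decode x)))
      (Q_vertices (2 * n + 1) n) (Q_vertices (2 * n + 1) n)"
    using bij_betw_trans[OF bij_betw_trans[OF bij_betw_inv_into[OF bij_decode[OF assms]]
      bij_next_code[OF assms]] bij_decode[OF assms]] by (simp add: comp_def)
  then show "bij_betw (next_vertex n) (Q_vertices (2 * n + 1) n) (Q_vertices (2 * n + 1) n)"
    unfolding next_vertex_def[abs_def] .
  fix x assume "x \<in> Q_vertices (2 * n + 1) n"
  then obtain c where c: "x = decode c" "c \<in> codes n" unfolding Q by blast
  have "next_vertex n (next_vertex n x) = decode (next_code n (next_code n c))"
    using c assms by (simp add: next_vertex_decode next_code_in)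
  then show "next_vertex n (next_vertex n x) \<noteq> x"
    using next_next_code[OF c(2) assms] inj_onD[OF inj_decode[OF assms]] c
      next_code_in[OF next_code_in[OF c(2) assms] assms] by metis
qed

lemma code_edge_decode:
  assumes "1 \<le> n" "c \<in> codes n"
  shows "permutation_graph.edge (next_vertex n) (decode c) = code_edge n c"
  using assms permutation_graph.edge_def[OF permutation_graph_next_vertex[OF assms(1)]]
  by (simp add: code_edge_def next_vertex_decode)

lemma inj_code_edge:
  assumes "1 \<le> n"
  shows "inj_on (code_edge n) (codes n)"
proof -
  interpret permutation_graph "next_vertex n" "Q_vertices (2 * n + 1) n"
    by (rule permutation_graph_next_vertex[OF assms])
  have "inj_on (edge \<circ> decode) (codes n)"
    using inj_decode[OF assms] inj_edge bij_decode[OF assms]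
    by (intro comp_inj_on) (simp_all add: bij_betw_def)
  then show ?thesis
    by (subst inj_on_cong[of _ _ "edge \<circ> decode"]) (simp_all add: code_edge_decode[OF assms])
qed

text \<open>The copy ending in 0 supplies the first halves of the blocks and the image under
  \<open>f\<close> the second halves. Of the links, those at last vertices join the halves of a
  block, and those at first vertices join a block to the next.\<close>

lemma C_step_zero:
  assumes "1 \<le> n"
  shows "C_step (replicate j False) (zero_paths n n) = code_edge n ` codes n"
proof -
  define U1 U2 where "U1 = (\<lambda>(a, b). map (\<lambda>x. x @ word b @ [False]) (tree_path a))"
    and "U2 = (\<lambda>(a, b). map (\<lambda>x. word a @ compl_rev x @ [True]) (tree_path (mirror b)))"
  let ?link = "\<lambda>v. {v @ [False], v @ [True]}"
  let ?T = "ordered_trees (Suc n)"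
  have "append_paths (zero_paths n n) [False] = U1 ` tree_pairs n"
    unfolding zero_paths_middle append_paths_def image_image
    by (rule image_cong) (auto simp: split_path_def U1_def)
  then have 1: "family_edges (append_paths (zero_paths n n) [False])
      = (\<Union>c\<in>tree_pairs n. path_edges (U1 c))" by (simp add: family_edges_def)
  have "append_paths (map (f_map (replicate j False)) ` zero_paths n n) [True]
      = (\<lambda>(a, b). U2 (mirror b, mirror a)) ` tree_pairs n"
    unfolding zero_paths_middle append_paths_def image_image
    by (rule image_cong) (auto simp: split_path_def U2_def f_map_zero)
  \<comment> \<open>The image of the path of \<open>(a, b)\<close> is the second half of the block
    of \<open>(mirror b, mirror a)\<close>; mirroring and exchanging permutes the pairs, so every
    second half occurs.\<close>
  also have "\<dots> = U2 ` (\<lambda>(a, b). (mirror b, mirror a)) ` tree_pairs n"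
    unfolding image_image by (rule image_cong) auto
  also have "(\<lambda>(a, b). (mirror b, mirror a)) ` tree_pairs n = tree_pairs n"
  proof (intro equalityI subsetI)
    fix c assume "c \<in> tree_pairs n"
    then show "c \<in> (\<lambda>(a, b). (mirror b, mirror a)) ` tree_pairs n"
      by (intro image_eqI[of _ _ "(mirror (snd c), mirror (fst c))"]) (auto simp: tree_pairs_def)
  qed (auto simp: tree_pairs_def)
  finally have 2: "family_edges (append_paths (map (f_map (replicate j False)) ` zero_paths n n) [True])
      = (\<Union>c\<in>tree_pairs n. path_edges (U2 c))" by (simp add: family_edges_def)
  have "M_FL (zero_paths n n) = ?link ` (F_set (zero_paths n n) \<union> L_set (zero_paths n n))"
    by (auto simp: M_FL_def)
  also have "\<dots> = ?link ` word ` ?T \<union> (\<lambda>(a, b). ?link (word a @ [False, True] @ word b)) ` tree_pairs n"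
    unfolding F_set_zero_paths[OF assms] L_set_zero_paths image_Un image_image
    by (simp add: case_prod_unfold)
  finally have 3: "M_FL (zero_paths n n) = ?link ` word ` ?T
      \<union> (\<lambda>(a, b). ?link (word a @ [False, True] @ word b)) ` tree_pairs n" .
  have "(\<lambda>t. {last (tree_block t), hd (tree_block (rotate_tree t))}) ` ?T
      = (\<lambda>t. ?link (word (rotate_tree t))) ` ?T"
    using assms by (intro image_cong) (auto simp: last_tree_block hd_tree_block)
  also have "\<dots> = ?link ` word ` rotate_tree ` ?T" by (simp only: image_image)
  also have "rotate_tree ` ?T = ?T" using bij_rotate[of n] by (simp add: bij_betw_def)
  finally have 4: "(\<lambda>t. {last (tree_block t), hd (tree_block (rotate_tree t))}) ` ?T
      = ?link ` word ` ?T" .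
  have 5: "path_edges (block a b) = path_edges (U1 (a, b))
      \<union> {?link (word a @ [False, True] @ word b)} \<union> path_edges (U2 (a, b))" for a b
  proof -
    have "block a b = U1 (a, b) @ rev (U2 (a, b))"
      by (simp add: block_def U1_def U2_def rev_map)
    moreover have "U1 (a, b) \<noteq> []" "U2 (a, b) \<noteq> []" by (simp_all add: U1_def U2_def)
    moreover have "last (U1 (a, b)) = word a @ [False, True] @ word b @ [False]"
      by (simp add: U1_def last_map last_tree_path)
    moreover have "last (U2 (a, b)) = word a @ [False, True] @ word b @ [True]"
      by (simp add: U2_def last_map last_tree_path)
    ultimately show ?thesis
      by (simp add: path_edges_append path_edges_rev hd_rev)
  qed
  have "(\<Union>t\<in>?T. path_edges (tree_block t))
      = (\<Union>c\<in>tree_pairs n. path_edges (block (fst c) (snd c)))"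
    unfolding image_cons_child_tree_pairs[OF assms, symmetric]
    by (simp add: image_image case_prod_unfold)
  also have "\<dots> = (\<Union>c\<in>tree_pairs n. path_edges (U1 c))
    \<union> (\<lambda>(a, b). ?link (word a @ [False, True] @ word b)) ` tree_pairs n
    \<union> (\<Union>c\<in>tree_pairs n. path_edges (U2 c))"
    unfolding 5 by (auto simp: case_prod_unfold)
  finally have 6: "(\<Union>t\<in>?T. path_edges (tree_block t)) = (\<Union>c\<in>tree_pairs n. path_edges (U1 c))
    \<union> (\<lambda>(a, b). ?link (word a @ [False, True] @ word b)) ` tree_pairs n
    \<union> (\<Union>c\<in>tree_pairs n. path_edges (U2 c))" .
  have 7: "code_edge n ` codes n = (\<Union>t\<in>?T. path_edges (tree_block t))
      \<union> (\<lambda>t. {last (tree_block t), hd (tree_block (rotate_tree t))}) ` ?T"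
    unfolding code_edges_eq[OF assms] UN_Un_distrib UNION_singleton_eq_range ..
  show ?thesis unfolding C_step_def 7 1 2 3 4 6 by (simp only: Un_ac)
qed

section \<open>The new paths as components\<close>

lemma C_minus_zero:
  assumes "1 \<le> n"
  shows "C_minus (replicate j False) (zero_paths n n)
    = (\<Union>t\<in>ordered_trees (Suc n). path_edges (tl (tree_block t) @ [hd (tree_block (rotate_tree t))]))"
proof -
  let ?T = "ordered_trees (Suc n)"
  have "{{hd p @ [False], p ! 1 @ [False]} |p. p \<in> zero_paths n n}
      = (\<lambda>c. {hd (split_path c) @ [False], split_path c ! 1 @ [False]}) ` tree_pairs n"
    unfolding zero_paths_middle by blast
  \<comment> \<open>The deleted edges from first to second vertices are the first edges of the
    blocks, which have position 0.\<close>
  also have "\<dots> = (\<lambda>c. code_edge n (case c of (a, b) \<Rightarrow> cons_child a b, 0)) ` tree_pairs n"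
  proof (rule image_cong)
    fix c assume "c \<in> tree_pairs n"
    obtain a b where c: "c = (a, b)" by (cases c)
    have "1 < length (tree_path a)" using length_tree_path_ge[of a] by linarith
    then show "{hd (split_path c) @ [False], split_path c ! 1 @ [False]}
        = code_edge n (case c of (a, b) \<Rightarrow> cons_child a b, 0)"
      using assms by (simp add: c split_path_def code_edge_def next_code_def decode_def block_nth_less
        hd_map hd_conv_nth)
  qed simp
  also have "\<dots> = code_edge n ` (?T \<times> {0})"
    unfolding image_cons_child_tree_pairs[OF assms, symmetric] by force
  finally have "C_minus (replicate j False) (zero_paths n n)
      = code_edge n ` codes n - code_edge n ` (?T \<times> {0})"
    unfolding C_minus_def C_step_zero[OF assms] by simp
  also have "\<dots> = code_edge n ` (codes n - ?T \<times> {0})"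
    by (rule inj_on_image_set_diff[OF inj_code_edge[OF assms], symmetric]) (auto simp: codes_def)
  also have "codes n - ?T \<times> {0} = ?T \<times> (Suc ` {..<4 * n + 1})"
  proof -
    have "{..<4 * n + 2} = insert 0 (Suc ` {..<4 * n + 1})"
      using lessThan_Suc_eq_insert_0[of "4 * n + 1"] by simp
    then show ?thesis by (auto simp: codes_def)
  qed
  also have "code_edge n ` \<dots> = (\<Union>t\<in>?T. (\<lambda>i. code_edge n (t, Suc i)) ` {..<4 * n + 1})"
    by auto
  also have "\<dots> = (\<Union>t\<in>?T. path_edges (tl (tree_block t) @ [hd (tree_block (rotate_tree t))]))"
  proof (rule SUP_cong)
    fix t assume t: "t \<in> ?T"
    have L: "length (tree_block t) = 4 * n + 2" "length (tree_block (rotate_tree t)) = 4 * n + 2"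
      using length_tree_block t assms by auto
    then have "tree_block (rotate_tree t) \<noteq> []" by auto
    then show "(\<lambda>i. code_edge n (t, Suc i)) ` {..<4 * n + 1}
        = path_edges (tl (tree_block t) @ [hd (tree_block (rotate_tree t))])"
      unfolding path_edges_conv_image using L
      by (intro image_cong) (auto simp: code_edge_def decode_def next_code_def nth_append nth_tl hd_conv_nth)
  qed simp
  finally show ?thesis .
qed

text \<open>The recursion equation of \<open>tree_path\<close>, read as edges: a block without its
  first edge, continued to the head of the next block, and extended in front by the
  \<open>M_S\<close> edge at its second vertex.\<close>

lemma path_edges_tree_path_rotate:
  assumes "t = cons_child a b" "t \<in> ordered_trees (Suc n)" "1 \<le> n"
  shows "path_edges (tree_path (rotate_tree t)) =
    insert {(True # word a @ True # word b) @ [False, False], (True # word a @ True # word b) @ [False, True]}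
      (image (\<lambda>v. v @ [True]) ` path_edges (tl (tree_block t) @ [hd (tree_block (rotate_tree t))]))"
proof -
  have "hd (tree_block (rotate_tree t)) = word (snoc_child a b) @ [False]"
    using hd_tree_block[of "snoc_child a b" n] assms by (simp add: ordered_trees_def)
  then have tp: "tree_path (rotate_tree t) = ((True # word a @ True # word b) @ [False, False]) #
      map (\<lambda>x. x @ [True]) (tl (tree_block t) @ [hd (tree_block (rotate_tree t))])"
    using assms(1) by (simp add: tree_path_snoc_child)
  obtain y ys where y: "tl (tree_block t) @ [hd (tree_block (rotate_tree t))] = y # ys"
    by (cases "tl (tree_block t) @ [hd (tree_block (rotate_tree t))]") auto
  have "tree_path (snoc_child a b) ! 1 = True # word a @ True # word b @ [False, True]"
    by (subst tree_path_1) simp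
  moreover have "tree_path (rotate_tree t) ! 1 = y @ [True]" unfolding tp y by simp
  ultimately have "y @ [True] = (True # word a @ True # word b) @ [False, True]"
    using assms(1) by simp
  moreover have "path_edges (map (\<lambda>v. v @ [True]) (y # ys)) = image (\<lambda>v. v @ [True]) ` path_edges (y # ys)"
    by (rule path_edges_map)
  ultimately show ?thesis unfolding tp y by (simp only: list.map path_edges_Cons)
qed

lemma P_prime_graph_zero:
  assumes "1 \<le> n"
  shows "M_S (zero_paths n n) \<union> append_edges (C_minus (replicate j False) (zero_paths n n)) [True]
    = family_edges (tree_path ` ordered_trees (Suc n))"
proof -
  let ?T = "ordered_trees (Suc n)"
  let ?s = "\<lambda>c. True # word (fst c) @ True # word (snd c)"
  let ?app = "image (\<lambda>v. v @ [True])"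
  let ?tail = "\<lambda>t. path_edges (tl (tree_block t) @ [hd (tree_block (rotate_tree t))])"
  have "rotate_tree ` ?T = ?T" using bij_rotate[of n] by (simp add: bij_betw_def)
  then have "family_edges (tree_path ` ?T) = family_edges (tree_path ` rotate_tree ` ?T)" by simp
  also have "\<dots> = (\<Union>t\<in>?T. path_edges (tree_path (rotate_tree t)))"
    by (simp only: family_edges_def image_image)
  also have "\<dots> = (\<Union>c\<in>tree_pairs n. path_edges (tree_path (rotate_tree (cons_child (fst c) (snd c)))))"
    unfolding image_cons_child_tree_pairs[OF assms, symmetric] by (simp add: case_prod_unfold image_image)
  also have "\<dots> = (\<Union>c\<in>tree_pairs n. insert {?s c @ [False, False], ?s c @ [False, True]}
      (?app ` ?tail (cons_child (fst c) (snd c))))"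
  proof (rule SUP_cong)
    fix c assume "c \<in> tree_pairs n"
    then have "cons_child (fst c) (snd c) \<in> ?T" by (auto simp: tree_pairs_def ordered_trees_def)
    from path_edges_tree_path_rotate[OF refl this assms]
    show "path_edges (tree_path (rotate_tree (cons_child (fst c) (snd c))))
      = insert {?s c @ [False, False], ?s c @ [False, True]} (?app ` ?tail (cons_child (fst c) (snd c)))" .
  qed simp
  also have "\<dots> = (\<lambda>c. {?s c @ [False, False], ?s c @ [False, True]}) ` tree_pairs n
      \<union> ?app ` (\<Union>c\<in>tree_pairs n. ?tail (cons_child (fst c) (snd c)))" by blast
  also have "(\<Union>c\<in>tree_pairs n. ?tail (cons_child (fst c) (snd c))) = (\<Union>t\<in>?T. ?tail t)"
    unfolding image_cons_child_tree_pairs[OF assms, symmetric] by (simp add: case_prod_unfold image_image)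
  also have "(\<lambda>c. {?s c @ [False, False], ?s c @ [False, True]}) ` tree_pairs n = M_S (zero_paths n n)"
  proof -
    have "M_S (zero_paths n n) = (\<lambda>s. {s @ [False, False], s @ [False, True]}) ` S_set (zero_paths n n)"
      unfolding M_S_def by blast
    then show ?thesis by (simp only: S_set_zero_paths image_image case_prod_unfold)
  qed
  finally show ?thesis unfolding C_minus_zero[OF assms] append_edges_def by simp
qed

lemma tree_path_nth_inject:
  assumes "s \<in> ordered_trees (Suc n)" "t \<in> ordered_trees (Suc n)"
    and "i < length (tree_path s)" "j < length (tree_path t)" "tree_path s ! i = tree_path t ! j"
  shows "s = t \<and> i = j"
proof -
  have "tree_path s ! i \<in> set (tree_path s)" using assms(3) by simp
  from length_tree_path_member[OF this] have "length (tree_path s ! i) = 2 * Suc n"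
    using assms(1) by (simp add: ordered_trees_def)
  moreover have "on_path (Suc n) (tree_path s ! i) s [] i" "on_path (Suc n) (tree_path s ! i) t [] j"
    using assms by (auto simp: on_path_def ordered_trees_def)
  ultimately show ?thesis using on_path_inject by blast
qed

lemma distinct_tree_path: "distinct (tree_path t)"
proof -
  have "t \<in> ordered_trees (Suc (num_vertices t - 1))" by (simp add: ordered_trees_def)
  from tree_path_nth_inject[OF this this] show ?thesis by (auto simp: distinct_conv_nth)
qed

lemma last_tree_path_nth:
  "i < length (tree_path t) \<Longrightarrow> t \<noteq> Node [] \<Longrightarrow> last (tree_path t ! i) \<longleftrightarrow> 0 < i"
proof -
  assume i: "i < length (tree_path t)" "t \<noteq> Node []"
  then obtain a b where t: "t = snoc_child a b" by (cases t rule: otree_snoc_cases) auto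
  then show ?thesis using i by (cases i) (auto simp: tree_path_snoc_child nth_append)
qed

lemma P_prime_zero:
  assumes "1 \<le> n"
  shows "P_prime (replicate j False) (zero_paths n n) = tree_path ` ordered_trees (Suc n)"
proof -
  let ?T = "ordered_trees (Suc n)"
  have comp: "components_of (family_edges (tree_path ` ?T)) = path_edges ` tree_path ` ?T"
  proof (rule disjoint_paths_components)
    fix p assume "p \<in> tree_path ` ?T"
    then show "2 \<le> length p" using length_tree_path_ge by (auto intro: order_trans[of 2 3])
  next
    fix p q x assume "p \<in> tree_path ` ?T" "q \<in> tree_path ` ?T" "x \<in> set p" "x \<in> set q"
    then obtain s t i j where "s \<in> ?T" "t \<in> ?T" "p = tree_path s" "q = tree_path t"
      "i < length p" "x = p ! i" "j < length q" "x = q ! j"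
      by (auto simp: in_set_conv_nth)
    then show "p = q" using tree_path_nth_inject[of s n t i j] by auto
  qed
  show ?thesis
    unfolding P_prime_def P_prime_graph_zero[OF assms] comp
  proof (intro equalityI subsetI, goal_cases)
    case (1 p)
    then obtain t s where p: "distinct p" "2 \<le> length p" "t \<in> ?T" "path_edges p = path_edges (tree_path t)"
      and s: "p ! 0 = s @ [False, False]" by auto
    have t: "t \<noteq> Node []" "2 \<le> length (tree_path t)"
      using p(3) assms length_tree_path_ge[of t] by (auto simp: ordered_trees_def)
    have "set p = set (tree_path t)"
      using Union_path_edges[OF p(2)] Union_path_edges[OF t(2)] p(4) by simp
    moreover have "p \<noteq> []" using p(2) by auto
    ultimately have "hd p \<in> set (tree_path t)" by (metis hd_in_set)
    then obtain i where i: "i < length (tree_path t)" "hd p = tree_path t ! i"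
      by (auto simp: in_set_conv_nth)
    \<comment> \<open>Orientation: the prescribed start ends in 0, and only the first vertex of a
      tree path does, so the list cannot be the reversed path.\<close>
    have "\<not> last (hd p)" using s \<open>p \<noteq> []\<close> by (simp add: hd_conv_nth)
    then have "i = 0" using last_tree_path_nth[OF i(1) t(1)] i(2) by simp
    then have "hd p = hd (tree_path t)" using i by (simp add: hd_conv_nth)
    then have "p = tree_path t"
      using path_edges_inject[OF p(1) distinct_tree_path p(4) _ \<open>p \<noteq> []\<close> tree_path_nonempty] by simp
    then show ?case using p(3) by simp
  next
    case (2 p)
    then obtain t where t: "t \<in> ?T" "p = tree_path t" by auto
    obtain a b where ab: "t = snoc_child a b" "num_vertices a + num_vertices b = Suc n"
      by (rule ordered_trees_Suc_snoc[OF t(1) assms])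
    have "True # word a @ True # word b \<in> S_set (zero_paths n n)"
      unfolding S_set_zero_paths
      by (rule image_eqI[of _ _ "(a, b)"]) (simp_all add: tree_pairs_def ab)
    moreover have "p ! 0 = (True # word a @ True # word b) @ [False, False]"
      using t(2) ab(1) by (simp add: tree_path_0)
    moreover have "p ! 1 = (True # word a @ True # word b) @ [False, True]"
      unfolding t(2) ab(1) tree_path_1 by simp
    moreover have "2 \<le> length p" using length_tree_path_ge[of t] t(2) by simp
    ultimately show ?case using t distinct_tree_path[of t] by blast
  qed
qed

section \<open>Agreement with the recursive construction\<close>

lemma ballot_append2: "ballot (v @ [p, q]) \<longleftrightarrow> ballot v \<and> length v < 2 * (ones v + of_bool p)
    \<and> length v + 2 \<le> 2 * (ones v + of_bool p + of_bool q)"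
proof -
  have "ballot ((v @ [p]) @ [q]) \<longleftrightarrow> ballot v \<and> length v < 2 * (ones v + of_bool p)
    \<and> length v + 2 \<le> 2 * (ones v + of_bool p + of_bool q)"
    unfolding ballot_snoc by (cases p; cases q) auto
  then show ?thesis by simp
qed

text \<open>An empty suffix gives the new paths, which exist only between the lowest layers;
  otherwise the last two letters of the suffix name the copy. The bound
  \<open>of_bool p + of_bool q <= k\<close> keeps the subtraction exact.\<close>

lemma zero_paths_Suc:
  "r \<in> zero_paths (Suc n) k \<longleftrightarrow> k = Suc n \<and> r \<in> tree_path ` ordered_trees (Suc n)
    \<or> (\<exists>p q. n + of_bool q < k \<and> of_bool p + of_bool q \<le> k
        \<and> r \<in> append_paths (zero_paths n (k - (of_bool p + of_bool q))) [p, q])"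
  (is "_ \<longleftrightarrow> ?A \<or> (\<exists>p q. ?B p q)")
proof (intro iffI)
  assume "r \<in> zero_paths (Suc n) k"
  then obtain t v where r: "r = map (\<lambda>x. x @ v) (tree_path t)"
    and tv: "2 * num_vertices t + length v = 2 * Suc n" "ballot v" "num_vertices t + ones v = k"
    unfolding zero_paths_def by blast
  show "?A \<or> (\<exists>p q. ?B p q)"
  proof (cases v rule: rev_cases)
    case Nil
    then show ?thesis using r tv by (simp add: ordered_trees_def)
  next
    case (snoc u q)
    moreover have "even (length v)" using tv(1) by presburger
    ultimately have "u \<noteq> []" by auto
    then obtain w p where "u = w @ [p]" by (metis append_butlast_last_id)
    then have v: "v = w @ [p, q]" using snoc by simp
    have b: "ballot w" "length w < 2 * (ones w + of_bool p)"
      "length w + 2 \<le> 2 * (ones w + of_bool p + of_bool q)"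
      using tv(2) unfolding v ballot_append2 by simp_all
    have k: "num_vertices t + (ones w + of_bool p + of_bool q) = k"
      using tv(3) v by (cases p; cases q) simp_all
    have l: "2 * num_vertices t + length w = 2 * n" using tv(1) v by simp
    have "map (\<lambda>x. x @ w) (tree_path t) \<in> zero_paths n (k - (of_bool p + of_bool q))"
      unfolding zero_paths_def using b(1) k l by fastforce
    then have "r \<in> append_paths (zero_paths n (k - (of_bool p + of_bool q))) [p, q]"
      unfolding append_paths_def r v by (rule rev_image_eqI) simp
    moreover have "n + of_bool q < k" "of_bool p + of_bool q \<le> k"
      using b(2) k l by (cases p; cases q; simp)+
    ultimately show ?thesis by blast
  qed
next
  assume "?A \<or> (\<exists>p q. ?B p q)"
  then show "r \<in> zero_paths (Suc n) k"
  proof (elim disjE exE)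
    assume A: ?A
    then obtain t where t: "r = tree_path t" "num_vertices t = Suc n" by (auto simp: ordered_trees_def)
    have "r = map (\<lambda>x. x @ []) (tree_path t) \<and> 2 * num_vertices t + length [] = 2 * Suc n
      \<and> ballot [] \<and> num_vertices t + ones [] = k" using t A by simp
    then show ?thesis unfolding zero_paths_def by blast
  next
    fix p q assume B: "?B p q"
    then obtain t w where r: "r = map (\<lambda>x. x @ [p, q]) (map (\<lambda>x. x @ w) (tree_path t))"
      and tw: "2 * num_vertices t + length w = 2 * n" "ballot w"
        "num_vertices t + ones w = k - (of_bool p + of_bool q)"
      unfolding append_paths_def zero_paths_def by blast
    have "ballot (w @ [p, q])" unfolding ballot_append2 using tw B by (cases p; cases q) auto
    moreover have "num_vertices t + ones (w @ [p, q]) = k"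
      using tw(3) B by (cases p; cases q) auto
    moreover have "r = map (\<lambda>x. x @ (w @ [p, q])) (tree_path t)" by (simp add: r)
    moreover have "2 * num_vertices t + length (w @ [p, q]) = 2 * Suc n" using tw(1) by simp
    ultimately show ?thesis unfolding zero_paths_def by blast
  qed
qed

text \<open>The suffix has nonnegative final height, so \<open>k >= n\<close>, and the tree takes up
  two bits but only one of the \<open>k\<close> ones at its root, so
  \<open>k < 2 * n\<close>.\<close>

lemma zero_paths_empty:
  assumes "k < n \<or> 2 * n \<le> k"
  shows "zero_paths n k = {}"
proof -
  have False if "2 * num_vertices t + length v = 2 * n" "ballot v" "num_vertices t + ones v = k" for t v
  proof -
    have "length v \<le> 2 * ones v" using that(2) by (rule ballot_length)
    moreover have "ones v \<le> length v" by (rule count_le_length)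
    moreover have "num_vertices t \<noteq> 0" by simp
    ultimately show False using assms that by linarith
  qed
  then show ?thesis by (auto simp: zero_paths_def)
qed

lemma zero_paths_1: "zero_paths (Suc 0) (Suc 0) = {[[True, False], [True, True], [False, True]]}"
proof -
  have "ordered_trees (Suc 0) = {Node []}" by (auto simp: ordered_trees_def num_vertices_eq_1)
  moreover have "zero_paths 0 k = {}" for k by (auto simp: zero_paths_def)
  ultimately show ?thesis
    by (auto simp: zero_paths_Suc append_paths_def tree_path_leaf)
qed

text \<open>The bound \<open>i < n\<close> is strict because the parameter with index
  \<open>2 * n\<close> first enters in the 2-factor.\<close>

lemma paths_zero:
  assumes "1 \<le> n" "\<And>i. 1 \<le> i \<Longrightarrow> i < n \<Longrightarrow> \<alpha> (2 * i) = replicate (i - 1) False"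
  shows "paths \<alpha> n k = zero_paths n k"
  using assms
proof (induction n arbitrary: k rule: nat_induct_at_least)
  case base
  have "zero_paths 1 k = {}" if "k \<noteq> 1" using that by (intro zero_paths_empty) auto
  then show ?case using zero_paths_1 by simp
next
  case (Suc n)
  obtain m where m: "n = Suc m" using Suc.hyps by (cases n) auto
  have IH: "paths \<alpha> n k = zero_paths n k" for k using Suc by simp
  have a: "\<alpha> (2 * n) = replicate (n - 1) False" using Suc by simp
  consider "k < Suc n" | "k = Suc n" | "n + 2 \<le> k" "k \<le> 2 * n + 1" | "2 * n + 2 \<le> k" by linarith
  then show ?case
  proof cases
    case 1
    then show ?thesis using zero_paths_empty[of k "Suc n"] by (simp add: m)
  next
    case 2
    have "paths \<alpha> (Suc n) k = append_paths (zero_paths n (Suc n)) [False, False]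
       \<union> append_paths (zero_paths n n) [True, False] \<union> tree_path ` ordered_trees (Suc n)"
      using 2 IH a P_prime_zero[OF Suc.hyps, of "n - 1"] by (simp add: m Let_def)
    also have "\<dots> = zero_paths (Suc n) k"
      unfolding set_eq_iff zero_paths_Suc using 2 by (simp add: ex_bool_eq) blast
    finally show ?thesis .
  next
    case 3
    have "paths \<alpha> (Suc n) k = append_paths (zero_paths n k) [False, False]
       \<union> append_paths (zero_paths n (k - 1)) [True, False]
       \<union> append_paths (zero_paths n (k - 1)) [False, True]
       \<union> append_paths (zero_paths n (k - 2)) [True, True]"
      using 3 IH by (simp add: m Let_def)
    also have "\<dots> = zero_paths (Suc n) k"
      unfolding set_eq_iff zero_paths_Suc using 3 by (simp add: ex_bool_eq numeral_2_eq_2) blast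
    finally show ?thesis .
  next
    case 4
    then show ?thesis using zero_paths_empty[of k "Suc n"] by (simp add: m)
  qed
qed

lemma C_factor_zero:
  assumes "1 \<le> n" "\<forall>i\<in>{1..n}. \<alpha> (2 * i) = replicate (i - 1) False"
  shows "C_factor \<alpha> n = code_edge n ` codes n"
proof -
  have "paths \<alpha> n n = zero_paths n n" using assms by (intro paths_zero) auto
  then show ?thesis using assms C_step_zero[OF assms(1), of "n - 1"] by (simp add: C_factor_def)
qed

section \<open>Cycles and rotation classes\<close>

text \<open>Periodicity makes forward orbits symmetric: completing the last period leads from
  \<open>y\<close> back to \<open>x\<close>.\<close>

lemma orb_eq:
  assumes "0 < m" "(f ^^ m) x = x" "y \<in> orb f x"
  shows "orb f y = orb f x"
proof -
  obtain j where j: "y = (f ^^ j) x" using assms(3) by (auto simp: orb_def)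
  have mult: "(f ^^ (m * k)) x = x" for k
    by (induction k) (simp_all add: funpow_add assms(2))
  have "1 * j \<le> m * j" using assms(1) by (intro mult_right_mono) auto
  then have "m * j = (m * j - j) + j" by simp
  then have "x = (f ^^ (m * j - j)) y"
    using mult[of j] unfolding j by (metis comp_apply funpow_add)
  then have "x \<in> orb f y" by (metis funpow_in_orb)
  then show ?thesis
    using assms(3) by (intro equalityI orb_subset orb_closed)
qed

lemma rotates_iff: "rotates s t \<longleftrightarrow> s \<noteq> Node [] \<and> t = rotate_tree s"
  by (cases s rule: rotate_tree.cases) (auto elim: rotates.cases intro: rotates.intros)

lemma rot_class_eq_orb: "rot_class t = orb rotate_tree t"
proof (intro equalityI subsetI)
  fix u assume "u \<in> rot_class t"
  then have "rotates\<^sup>*\<^sup>* t u" by (simp add: rot_class_def rot_rel_def)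
  then show "u \<in> orb rotate_tree t"
    by (induction rule: rtranclp_induct) (auto simp: rotates_iff intro: orb_closed)
next
  fix u assume "u \<in> orb rotate_tree t"
  moreover have "rotates\<^sup>*\<^sup>* t ((rotate_tree ^^ j) t)" for j
  proof (induction j)
    case (Suc j)
    then show ?case
      by (cases "(rotate_tree ^^ j) t = Node []")
        (auto simp: rotates_iff intro: rtranclp.rtrancl_into_rtrancl)
  qed simp
  ultimately show "u \<in> rot_class t" by (auto simp: rot_class_def rot_rel_def orb_def)
qed

lemma plane_trees_eq: "plane_trees m = orb rotate_tree ` ordered_trees m"
  using rot_class_eq_orb unfolding plane_trees_def quotient_def rot_class_def by auto

text \<open>Each edge is traversed twice when walking around the tree, and so \<open>2 k\<close> rotations move the
  subtrees \<open>ts\<close> with \<open>k\<close> edges in total, including those to the root, behind the others.\<close>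

lemma rotate_forest:
  "(rotate_tree ^^ (2 * sum_list (map num_vertices ts))) (Node (ts @ vs)) = Node (vs @ ts)"
proof (induction "num_vertices (Node ts)" arbitrary: ts vs rule: less_induct)
  case less
  show ?case
  proof (cases ts)
    case Nil
    then show ?thesis by simp
  next
    case (Cons t ts')
    obtain us where t: "t = Node us" by (cases t)
    define k l where "k = 2 * sum_list (map num_vertices us)"
      and "l = 2 * sum_list (map num_vertices ts')"
    have "(rotate_tree ^^ k) (Node (us @ [Node (ts' @ vs)])) = Node ([Node (ts' @ vs)] @ us)"
      unfolding k_def by (rule less) (simp add: Cons t)
    moreover have "(rotate_tree ^^ l) (Node (ts' @ (vs @ [Node us]))) = Node ((vs @ [Node us]) @ ts')"
      unfolding l_def by (rule less) (simp add: Cons t)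
    \<comment> \<open>Walking around the first subtree: one rotation down its edge, \<open>k\<close>
      around its children, one back up; the remaining \<open>l\<close> pass the other
      subtrees.\<close>
    moreover have "2 * sum_list (map num_vertices ts) = l + (Suc (k + 1))"
      by (simp add: Cons t k_def l_def)
    ultimately show ?thesis
      by (simp only: funpow_add comp_apply funpow.simps id_apply) (simp add: Cons t)
  qed
qed

lemma rotate_full:
  assumes "t \<in> ordered_trees (Suc n)"
  shows "(rotate_tree ^^ (2 * n)) t = t"
proof -
  obtain ts where t: "t = Node ts" by (cases t)
  then have "n = sum_list (map num_vertices ts)" using assms by (simp add: ordered_trees_def)
  then show ?thesis using rotate_forest[of ts "[]"] t by simp
qed

lemma orb_rotate_subset: "t \<in> ordered_trees m \<Longrightarrow> orb rotate_tree t \<subseteq> ordered_trees m"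
  by (intro orb_subset) simp_all

lemma orb_rotate_period:
  assumes "t \<in> ordered_trees (Suc n)" "1 \<le> n"
  obtains p where "0 < p" "p dvd 2 * n" "card (orb rotate_tree t) = p"
    "\<forall>k. (rotate_tree ^^ k) t = t \<longleftrightarrow> p dvd k"
proof -
  have n: "0 < 2 * n" using assms(2) by simp
  obtain p where p: "0 < p" "\<forall>k. (rotate_tree ^^ k) t = t \<longleftrightarrow> p dvd k"
    "inj_on (\<lambda>i. (rotate_tree ^^ i) t) {..<p}"
    "orb rotate_tree t = (\<lambda>i. (rotate_tree ^^ i) t) ` {..<p}"
    by (rule orb_period[OF n rotate_full[OF assms(1)]])
  have "card (orb rotate_tree t) = p" unfolding p(4) using p(3) by (simp add: card_image)
  moreover have "p dvd 2 * n" using spec[OF p(2), of "2 * n"] rotate_full[OF assms(1)] by simp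
  ultimately show ?thesis by (intro that[of p] p(1,2))
qed

lemma card_orb_rotate_le: "t \<in> ordered_trees (Suc n) \<Longrightarrow> 1 \<le> n \<Longrightarrow> card (orb rotate_tree t) \<le> 2 * n"
  by (rule orb_rotate_period) (auto dest: dvd_imp_le)

lemma orb_rotate_eq:
  "t \<in> ordered_trees (Suc n) \<Longrightarrow> 1 \<le> n \<Longrightarrow> u \<in> orb rotate_tree t \<Longrightarrow> orb rotate_tree u = orb rotate_tree t"
  using rotate_full[of t n] by (intro orb_eq[of "2 * n"]) auto

definition class_cycle :: "nat \<Rightarrow> otree set \<Rightarrow> bitstring set set" where
  "class_cycle n T = code_edge n ` (T \<times> {..<4 * n + 2})"

lemma plane_tree_subset: "T \<in> plane_trees m \<Longrightarrow> T \<subseteq> ordered_trees m"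
  unfolding plane_trees_eq by (elim imageE) (simp add: orb_rotate_subset)

lemma plane_tree_codes: "T \<in> plane_trees (Suc n) \<Longrightarrow> T \<times> {..<4 * n + 2} \<subseteq> codes n"
  unfolding codes_def by (intro Sigma_mono plane_tree_subset order_refl)

lemma fst_codes: "fst ` (T \<times> {..<4 * n + 2 :: nat}) = T"
proof -
  have "0 \<in> {..<4 * n + 2 :: nat}" by simp
  then have "{..<4 * n + 2 :: nat} \<noteq> {}" by blast
  then show ?thesis by (simp only: fst_image_times if_False)
qed

lemma inj_class_cycle:
  assumes "1 \<le> n"
  shows "inj_on (class_cycle n) (plane_trees (Suc n))"
proof (rule inj_onI)
  fix S T assume ST: "S \<in> plane_trees (Suc n)" "T \<in> plane_trees (Suc n)"
    "class_cycle n S = class_cycle n T"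
  have "S \<times> {..<4 * n + 2} = T \<times> {..<4 * n + 2}"
    using ST(3) unfolding class_cycle_def
    by (rule iffD1[OF inj_on_image_eq_iff[OF inj_code_edge[OF assms]
          plane_tree_codes[OF ST(1)] plane_tree_codes[OF ST(2)]]])
  then show "S = T" using fst_codes[of S n] fst_codes[of T n] by simp
qed

lemma card_class_cycle:
  assumes "1 \<le> n" "T \<in> plane_trees (Suc n)"
  shows "card (class_cycle n T) = (4 * n + 2) * card T"
proof -
  have "inj_on (code_edge n) (T \<times> {..<4 * n + 2})"
    by (rule inj_on_subset[OF inj_code_edge[OF assms(1)] plane_tree_codes[OF assms(2)]])
  then show ?thesis by (simp add: class_cycle_def card_image card_cartesian_product)
qed

lemma orb_next_vertex:
  assumes "t \<in> ordered_trees (Suc n)" "1 \<le> n"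
  shows "orb (next_vertex n) (decode (t, 0)) = decode ` (orb rotate_tree t \<times> {..<4 * n + 2})"
proof (intro equalityI)
  have sub: "orb rotate_tree t \<times> {..<4 * n + 2} \<subseteq> codes n"
    using orb_rotate_subset[OF assms(1)] by (auto simp: codes_def)
  show "orb (next_vertex n) (decode (t, 0)) \<subseteq> decode ` (orb rotate_tree t \<times> {..<4 * n + 2})"
  proof (rule orb_subset)
    fix y assume "y \<in> decode ` (orb rotate_tree t \<times> {..<4 * n + 2})"
    then obtain c where c: "y = decode c" "c \<in> orb rotate_tree t \<times> {..<4 * n + 2}"
      by (rule imageE)
    have "next_vertex n y = decode (next_code n c)"
      unfolding c(1) by (rule next_vertex_decode[OF subsetD[OF sub c(2)] assms(2)])
    moreover have "next_code n c \<in> orb rotate_tree t \<times> {..<4 * n + 2}"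
      using c(2) by (auto simp: next_code_def intro: orb_closed)
    ultimately show "next_vertex n y \<in> decode ` (orb rotate_tree t \<times> {..<4 * n + 2})" by simp
  qed simp
  have inner: "decode (u, i) \<in> orb (next_vertex n) (decode (t, 0))"
    if "decode (u, 0) \<in> orb (next_vertex n) (decode (t, 0))" "u \<in> ordered_trees (Suc n)"
      "i < 4 * n + 2" for u i
    using that(3)
  proof (induction i)
    case (Suc i)
    then have "next_vertex n (decode (u, i)) = decode (u, Suc i)"
      using that(2) assms(2) by (subst next_vertex_decode) (auto simp: codes_def next_code_def)
    then show ?case using Suc orb_closed[of "decode (u, i)" "next_vertex n" "decode (t, 0)"] by simp
  qed (rule that(1))
  have start: "decode ((rotate_tree ^^ j) t, 0) \<in> orb (next_vertex n) (decode (t, 0))" for j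
  proof (induction j)
    case (Suc j)
    let ?u = "(rotate_tree ^^ j) t"
    have u: "?u \<in> ordered_trees (Suc n)"
      by (rule subsetD[OF orb_rotate_subset[OF assms(1)] funpow_in_orb])
    have "decode (?u, 4 * n + 1) \<in> orb (next_vertex n) (decode (t, 0))"
      by (rule inner[OF Suc u]) simp
    moreover have "next_vertex n (decode (?u, 4 * n + 1)) = decode (rotate_tree ?u, 0)"
      using u assms(2) by (subst next_vertex_decode) (auto simp: codes_def next_code_def)
    ultimately show ?case using orb_closed[of "decode (?u, 4 * n + 1)" "next_vertex n" "decode (t, 0)"] by simp
  qed simp
  show "decode ` (orb rotate_tree t \<times> {..<4 * n + 2}) \<subseteq> orb (next_vertex n) (decode (t, 0))"
  proof (rule image_subsetI)
    fix c assume c: "c \<in> orb rotate_tree t \<times> {..<4 * n + 2}"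
    obtain u i where ui: "c = (u, i)" by (cases c)
    then obtain j where j: "u = (rotate_tree ^^ j) t" and i: "i < 4 * n + 2"
      using c by (auto simp: orb_def)
    have "u \<in> ordered_trees (Suc n)" using ui c orb_rotate_subset[OF assms(1)] by auto
    then show "decode c \<in> orb (next_vertex n) (decode (t, 0))"
      unfolding ui by (rule inner[OF start[of j, folded j] _ i])
  qed
qed

lemma cycle_subgraphs_code_edges:
  assumes "1 \<le> n"
  shows "cycle_subgraphs (code_edge n ` codes n) = class_cycle n ` plane_trees (Suc n)"
proof -
  interpret permutation_graph "next_vertex n" "Q_vertices (2 * n + 1) n"
    by (rule permutation_graph_next_vertex[OF assms])
  let ?V = "Q_vertices (2 * n + 1) n" and ?T = "ordered_trees (Suc n)"
  have V: "?V = decode ` codes n" using bij_decode[OF assms] by (simp add: bij_betw_def)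
  have E: "edge ` decode ` A = code_edge n ` A" if "A \<subseteq> codes n" for A
    unfolding image_image using that code_edge_decode[OF assms] by (intro image_cong) auto
  have cyc: "edge ` orb (next_vertex n) (decode (t, i)) = class_cycle n (orb rotate_tree t)"
    if t: "t \<in> ?T" and i: "i < 4 * n + 2" for t i
  proof -
    have "decode (t, 0) \<in> ?V" unfolding V using t by (auto simp: codes_def)
    then obtain m where "0 < m" "(next_vertex n ^^ m) (decode (t, 0)) = decode (t, 0)"
      by (rule finite_permutation_period[OF bij finite])
    moreover have "decode (t, i) \<in> orb (next_vertex n) (decode (t, 0))"
      unfolding orb_next_vertex[OF t assms] using i by auto
    ultimately have "orb (next_vertex n) (decode (t, i)) = orb (next_vertex n) (decode (t, 0))"
      by (rule orb_eq)
    also have "\<dots> = decode ` (orb rotate_tree t \<times> {..<4 * n + 2})"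
      by (rule orb_next_vertex[OF t assms])
    finally show ?thesis
      using E[of "orb rotate_tree t \<times> {..<4 * n + 2}"] orb_rotate_subset[OF t]
      by (auto simp: class_cycle_def codes_def)
  qed
  have "cycle_subgraphs (code_edge n ` codes n)
      = (\<lambda>c. edge ` orb (next_vertex n) (decode c)) ` codes n"
    using cycle_subgraphs_eq E[of "codes n"] unfolding V image_image by simp
  also have "\<dots> = (\<lambda>c. class_cycle n (orb rotate_tree (fst c))) ` codes n"
  proof (rule image_cong)
    fix c assume "c \<in> codes n"
    then show "edge ` orb (next_vertex n) (decode c) = class_cycle n (orb rotate_tree (fst c))"
      using cyc[of "fst c" "snd c"] by (simp add: codes_def mem_Times_iff)
  qed simp
  also have "\<dots> = class_cycle n ` orb rotate_tree ` fst ` codes n" by (simp only: image_image)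
  also have "fst ` codes n = ?T" unfolding codes_def by (rule fst_codes)
  finally show ?thesis by (simp only: plane_trees_eq)
qed

lemma card_diff_flip: "flip x y \<Longrightarrow> card {i. i < length x \<and> x ! i \<noteq> y ! i} = 1"
proof (elim flipE)
  fix p b q assume xy: "x = p @ b # q" "y = p @ (\<not> b) # q"
  have "{i. i < length x \<and> x ! i \<noteq> y ! i} = {length p}"
    unfolding xy by (auto simp: nth_append nth_Cons' split: if_splits)
  then show ?thesis by simp
qed

lemma code_edge_flip:
  assumes "1 \<le> n" "c \<in> codes n"
  shows "flip (decode c) (decode (next_code n c)) \<or> flip (decode (next_code n c)) (decode c)"
proof -
  obtain t i where c: "c = (t, i)" by (cases c)
  then have t: "t \<in> ordered_trees (Suc n)" "i < 4 * n + 2" using assms(2) by (auto simp: codes_def)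
  obtain a b where ab: "t = cons_child a b" by (rule ordered_trees_Suc_cons[OF t(1) assms(1)])
  show ?thesis
  proof (cases "Suc i < 4 * n + 2")
    case True
    then show ?thesis
      using successively_flip_block[of a b] length_tree_block[OF t(1) assms(1)]
      by (simp add: successively_conv_nth c ab decode_def next_code_def)
  next
    case False
    then have i: "i = 4 * n + 1" using t(2) by simp
    have L: "length (tree_block t) = 4 * n + 2" "length (tree_block (rotate_tree t)) = 4 * n + 2"
      using t(1) assms(1) length_tree_block by auto
    then have ne: "tree_block t \<noteq> []" "tree_block (rotate_tree t) \<noteq> []" by auto
    then have "decode c = word (rotate_tree t) @ [True]"
      using last_tree_block[OF t(1) assms(1)] L by (simp add: c decode_def i last_conv_nth)
    moreover have "decode (next_code n c) = word (rotate_tree t) @ [False]"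
      using hd_tree_block[of "rotate_tree t" n] t(1) assms(1) ne
      by (simp add: c decode_def next_code_def i hd_conv_nth)
    ultimately show ?thesis using flipI[of "word (rotate_tree t)" False "[]"] by simp
  qed
qed

lemma two_factor_code_edges:
  assumes "1 \<le> n"
  shows "two_factor (Q_vertices (2 * n + 1) n) (Q_edges (2 * n + 1) n) (code_edge n ` codes n)"
proof -
  interpret permutation_graph "next_vertex n" "Q_vertices (2 * n + 1) n"
    by (rule permutation_graph_next_vertex[OF assms])
  let ?V = "Q_vertices (2 * n + 1) n"
  have V: "?V = decode ` codes n" using bij_decode[OF assms] by (simp add: bij_betw_def)
  have E: "edge ` ?V = code_edge n ` codes n"
    unfolding V image_image using code_edge_decode[OF assms] by (intro image_cong) auto
  have "code_edge n c \<in> Q_edges (2 * n + 1) n" if c: "c \<in> codes n" for c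
  proof -
    let ?x = "decode c" and ?y = "decode (next_code n c)"
    have xy: "?x \<in> ?V" "?y \<in> ?V" unfolding V using c next_code_in[OF c assms] by blast+
    then have "length ?x = 2 * n + 1" "length ?y = 2 * n + 1" unfolding Q_vertices_iff by simp_all
    then have "card {i. i < 2 * n + 1 \<and> ?x ! i \<noteq> ?y ! i} = 1"
      using code_edge_flip[OF assms c] card_diff_flip[of ?x ?y] card_diff_flip[of ?y ?x]
      by (auto simp: eq_commute)
    then show ?thesis unfolding Q_edges_def code_edge_def using xy by blast
  qed
  then show ?thesis
    using degree_2 unfolding two_factor_def E by blast
qed

section \<open>Asymmetric plane trees\<close>

text \<open>A rotation shifts the word by one position and turns one down-step into an up-step.\<close>

lemma word_rotate_nth:
  assumes "t \<in> ordered_trees (Suc n)" "1 \<le> n" "Suc i < 2 * n" "word t ! Suc i"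
  shows "word (rotate_tree t) ! i"
proof -
  obtain a b where ab: "t = cons_child a b" by (rule ordered_trees_Suc_cons[OF assms(1,2)])
  have "length (word t) = 2 * n" using assms(1) length_word[of t] by (simp add: ordered_trees_def)
  then have "length (word a) + length (word b) + 2 = 2 * n" by (simp add: ab)
  then show ?thesis using assms(3,4)
    by (auto simp: ab nth_append nth_Cons' split: if_splits)
qed

lemma word_funpow_rotate_nth:
  assumes "t \<in> ordered_trees (Suc n)" "1 \<le> n" "i + p < 2 * n" "word t ! (i + p)"
  shows "word ((rotate_tree ^^ p) t) ! i"
  using assms(3,4)
proof (induction p arbitrary: i)
  case (Suc p)
  have "(rotate_tree ^^ p) t \<in> ordered_trees (Suc n)"
    using orb_rotate_subset[OF assms(1)] funpow_in_orb by (rule subsetD)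
  moreover have "word ((rotate_tree ^^ p) t) ! Suc i" using Suc by simp
  ultimately show ?case using word_rotate_nth[of "(rotate_tree ^^ p) t" n i] assms(2) Suc.prems by simp
qed simp

definition periodic_trees :: "nat \<Rightarrow> nat \<Rightarrow> otree set" where
  "periodic_trees n p = {t \<in> ordered_trees (Suc n). (rotate_tree ^^ p) t = t}"

lemma length_word_ordered_trees: "t \<in> ordered_trees (Suc n) \<Longrightarrow> length (word t) = 2 * n"
  using length_word[of t] by (simp add: ordered_trees_def)

lemma periodic_word_antimono:
  assumes "t \<in> periodic_trees n p" "1 \<le> n" "i + k * p < 2 * n" "word t ! (i + k * p)" "j \<le> k"
  shows "word t ! (i + j * p)"
  using assms(3-5)
proof (induction k)
  case (Suc k)
  show ?case
  proof (cases "j = Suc k")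
    case False
    have "word t ! ((i + k * p) + p)" using Suc.prems(2) by (simp add: ac_simps)
    then have "word ((rotate_tree ^^ p) t) ! (i + k * p)"
      using assms(1,2) Suc.prems(1)
      by (intro word_funpow_rotate_nth[of t n]) (simp_all add: periodic_trees_def ac_simps)
    then have "word t ! (i + k * p)" using assms(1) by (simp add: periodic_trees_def)
    then show ?thesis using Suc False by simp
  qed (use Suc in simp)
qed simp

text \<open>Each of the \<open>p\<close> residue classes carries a non-increasing 0/1 sequence of
  length \<open>m\<close>, which is determined by its number of ones, one of \<open>m + 1\<close>
  values.\<close>

lemma card_periodic_trees_le:
  assumes n: "1 \<le> n" and mp: "m * p = 2 * n"
  shows "card (periodic_trees n p) \<le> Suc m ^ p"
proof -
  have pos: "0 < p" using assms by (cases p) auto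
  define ups where "ups t i = {j. j < m \<and> word t ! (i + j * p)}" for t i
  define g where "g t = restrict (\<lambda>i. card (ups t i)) {..<p}" for t
  have bound: "i + j * p < 2 * n" if "i < p" "j < m" for i j
  proof -
    have "i + j * p < Suc j * p" using that(1) by simp
    also have "\<dots> \<le> m * p" using that(2) by (intro mult_right_mono) auto
    finally show ?thesis by (simp add: mp)
  qed
  have ups_iff: "word t ! (i + j * p) \<longleftrightarrow> j < card (ups t i)"
    if t: "t \<in> periodic_trees n p" and i: "i < p" and j: "j < m" for t i j
  proof
    assume "word t ! (i + j * p)"
    then have *: "word t ! (i + k * p)" if "k \<le> j" for k
      by (rule periodic_word_antimono[OF t n bound[OF i j] _ that])
    have "{..j} \<subseteq> ups t i"
    proof
      fix k assume "k \<in> {..j}"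
      then show "k \<in> ups t i" using *[of k] j by (simp add: ups_def)
    qed
    moreover have "finite (ups t i)" by (simp add: ups_def)
    ultimately have "card {..j} \<le> card (ups t i)" by (intro card_mono)
    then show "j < card (ups t i)" by (simp only: card_atMost Suc_le_eq)
  next
    assume c: "j < card (ups t i)"
    show "word t ! (i + j * p)"
    proof (rule ccontr)
      assume not: "\<not> word t ! (i + j * p)"
      have "ups t i \<subseteq> {..<j}"
      proof
        fix k assume k: "k \<in> ups t i"
        show "k \<in> {..<j}"
        proof (rule ccontr)
          assume "k \<notin> {..<j}"
          then have "j \<le> k" "k < m" "word t ! (i + k * p)" using k by (auto simp: ups_def)
          then have "word t ! (i + j * p)"
            using periodic_word_antimono[OF t n bound[OF i]] by blast
          with not show False ..
        qed
      qed
      then have "card (ups t i) \<le> card {..<j}" by (intro card_mono) auto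
      with c show False by simp
    qed
  qed
  have "inj_on g (periodic_trees n p)"
  proof (rule inj_onI)
    fix s t assume st: "s \<in> periodic_trees n p" "t \<in> periodic_trees n p" "g s = g t"
    have "word s = word t"
    proof (rule nth_equalityI)
      show "length (word s) = length (word t)"
        using st(1,2) length_word_ordered_trees by (auto simp: periodic_trees_def)
      fix x assume "x < length (word s)"
      then have x: "x < m * p"
        using st(1) length_word_ordered_trees[of s n] mp by (simp add: periodic_trees_def)
      define i j where "i = x mod p" and "j = x div p"
      have ij: "i < p" "j < m" "x = i + j * p"
        using pos x by (simp_all add: i_def j_def less_mult_imp_div_less)
      have "card (ups s i) = card (ups t i)"
        using fun_cong[OF st(3), of i] ij(1) by (simp add: g_def)
      then show "word s ! x = word t ! x"
        unfolding ij(3) using ups_iff[OF st(1) ij(1,2)] ups_iff[OF st(2) ij(1,2)] by simp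
    qed
    then show "s = t" by simp
  qed
  moreover have "g ` periodic_trees n p \<subseteq> {..<p} \<rightarrow>\<^sub>E {..m}"
  proof (rule image_subsetI)
    fix t
    have "card (ups t i) \<le> m" for i
    proof -
      have "card (ups t i) \<le> card {..<m}" by (rule card_mono) (auto simp: ups_def)
      then show ?thesis by simp
    qed
    then show "g t \<in> {..<p} \<rightarrow>\<^sub>E {..m}" by (simp add: g_def)
  qed
  ultimately have "card (periodic_trees n p) \<le> card ({..<p} \<rightarrow>\<^sub>E {..m})"
    by (rule card_inj_on_le) (simp add: finite_PiE)
  then show ?thesis by (simp add: card_PiE)
qed

lemma Suc_power2_le: "2 \<le> m \<Longrightarrow> Suc m ^ 2 \<le> (3 :: nat) ^ m"
proof (induction m rule: nat_induct_at_least)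
  case (Suc m)
  have "Suc (Suc m) ^ 2 \<le> 3 * Suc m ^ 2" using Suc.hyps by (simp add: power2_eq_square)
  with Suc show ?case by simp
qed simp

text \<open>A proper divisor leaves \<open>m >= 2\<close>. Comparing squares avoids the exponent
  \<open>m / 2\<close>.\<close>

lemma card_periodic_trees_le_power:
  assumes "1 \<le> n" "p dvd 2 * n" "p < 2 * n"
  shows "card (periodic_trees n p) \<le> 3 ^ n"
proof -
  obtain m where "2 * n = p * m" using assms(2) by (rule dvdE)
  then have m: "m * p = 2 * n" by simp
  have "2 \<le> m"
  proof (rule ccontr)
    assume "\<not> 2 \<le> m"
    then have "m = 0 \<or> m = 1" by auto
    then show False using m assms by auto
  qed
  have "(Suc m ^ p) ^ 2 = (Suc m ^ 2) ^ p" by (simp only: power_mult[symmetric] mult.commute)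
  also have "\<dots> \<le> (3 ^ m) ^ p" using Suc_power2_le[OF \<open>2 \<le> m\<close>] by (rule power_mono) simp
  also have "\<dots> = (3 ^ n) ^ 2" unfolding power_mult[symmetric] m by (simp add: mult.commute)
  finally have "Suc m ^ p \<le> 3 ^ n" by (rule power2_le_imp_le) simp
  with card_periodic_trees_le[OF assms(1) m] show ?thesis by simp
qed

definition symmetric_trees :: "nat \<Rightarrow> otree set" where
  "symmetric_trees n = {t \<in> ordered_trees (Suc n). card (orb rotate_tree t) \<noteq> 2 * n}"

lemma card_symmetric_trees_le:
  assumes "1 \<le> n"
  shows "card (symmetric_trees n) \<le> 2 * n * 3 ^ n"
proof -
  let ?D = "{p. p < 2 * n \<and> p dvd 2 * n}"
  have fin: "finite (periodic_trees n p)" for p by (simp add: periodic_trees_def)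
  have "symmetric_trees n \<subseteq> (\<Union>p\<in>?D. periodic_trees n p)"
  proof
    fix t assume t: "t \<in> symmetric_trees n"
    then have tt: "t \<in> ordered_trees (Suc n)" by (simp add: symmetric_trees_def)
    obtain p where p: "0 < p" "p dvd 2 * n" "card (orb rotate_tree t) = p"
      "\<forall>k. (rotate_tree ^^ k) t = t \<longleftrightarrow> p dvd k"
      by (rule orb_rotate_period[OF tt assms])
    have "p \<noteq> 2 * n" using t p(3) by (simp add: symmetric_trees_def)
    moreover have "p \<le> 2 * n" using p(2) assms by (intro dvd_imp_le) auto
    moreover have "t \<in> periodic_trees n p" using tt p(4) by (simp add: periodic_trees_def)
    ultimately show "t \<in> (\<Union>p\<in>?D. periodic_trees n p)" using p(2) by (intro UN_I[of p]) auto
  qed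
  then have "card (symmetric_trees n) \<le> card (\<Union>p\<in>?D. periodic_trees n p)"
    using fin by (intro card_mono) auto
  also have "\<dots> \<le> (\<Sum>p\<in>?D. card (periodic_trees n p))" by (rule card_UN_le) simp
  also have "\<dots> \<le> (\<Sum>p\<in>?D. 3 ^ n)"
    using card_periodic_trees_le_power[OF assms] by (intro sum_mono) simp
  also have "\<dots> \<le> 2 * n * 3 ^ n"
  proof -
    have "card ?D \<le> card {..<2 * n}" by (intro card_mono) auto
    then show ?thesis by simp
  qed
  finally show ?thesis .
qed

section \<open>A lower bound for the number of plane trees\<close>

lemma ones_map: "ones (map f xs) = length (filter f xs)"
  by (induction xs) auto

lemma card_Q_vertices_ge: "(2 * n) choose n \<le> card (Q_vertices (2 * n + 1) n)"
proof -
  let ?S = "{B. B \<subseteq> {..<2 * n} \<and> card B = n}"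
  \<comment> \<open>The last bit is always 0, since \<open>B\<close> has no element
    \<open>2 * n\<close>; these strings alone already give the central binomial coefficient.\<close>
  define g where "g B = map (\<lambda>i. i \<in> B) [0..<2 * n + 1]" for B
  have set_g: "B = {i. i < 2 * n + 1 \<and> g B ! i}" if "B \<subseteq> {..<2 * n}" for B
  proof -
    have "g B ! i \<longleftrightarrow> i \<in> B" if "i < 2 * n + 1" for i
      using that nth_map[of i "[0..<2 * n + 1]" "\<lambda>i. i \<in> B"] by (simp add: g_def del: upt_Suc)
    then show ?thesis using that by auto
  qed
  have "inj_on g ?S"
  proof (rule inj_onI)
    fix A B assume "A \<in> ?S" "B \<in> ?S" "g A = g B"
    then show "A = B" using set_g[of A] set_g[of B] by simp
  qed
  moreover have "g ` ?S \<subseteq> Q_vertices (2 * n + 1) n"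
  proof (rule image_subsetI)
    fix B assume B: "B \<in> ?S"
    have "ones (g B) = card (set (filter (\<lambda>i. i \<in> B) [0..<2 * n + 1]))"
      unfolding g_def ones_map by (subst distinct_card) (simp_all del: upt_Suc)
    also have "set (filter (\<lambda>i. i \<in> B) [0..<2 * n + 1]) = B" using B by auto
    finally show "g B \<in> Q_vertices (2 * n + 1) n"
      using B unfolding Q_vertices_iff by (simp add: g_def)
  qed
  moreover have "finite (Q_vertices (2 * n + 1) n)"
  proof (rule finite_subset)
    show "Q_vertices (2 * n + 1) n \<subseteq> {x. set x \<subseteq> UNIV \<and> length x = 2 * n + 1}"
      unfolding Q_vertices_iff subset_iff by simp
  qed (rule finite_lists_length_eq, simp)
  ultimately have "card ?S \<le> card (Q_vertices (2 * n + 1) n)" by (rule card_inj_on_le)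
  then show ?thesis by (simp add: n_subsets)
qed

lemma finite_plane_trees [simp]: "finite (plane_trees m)"
  by (simp add: plane_trees_eq)

text \<open>In place of a formula for Catalan numbers: the blocks partition the vertices, so their
  number is \<open>4 * n + 2\<close> times that of ordered trees. One factor \<open>2 * n\<close>
  bounds the class sizes, the other comes from the bound \<open>4 ^ n / (2 * n)\<close> for the
  central binomial coefficient.\<close>

lemma card_plane_trees_ge:
  assumes "1 \<le> n"
  shows "4 ^ n \<le> 4 * n ^ 2 * (4 * n + 2) * real (card (plane_trees (Suc n)))"
proof -
  have "card (ordered_trees (Suc n)) \<le> 2 * n * card (plane_trees (Suc n))"
  proof -
    have "ordered_trees (Suc n) \<subseteq> \<Union> (plane_trees (Suc n))"
      unfolding plane_trees_eq by (auto intro: self_in_orb)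
    moreover have "finite T" if "T \<in> plane_trees (Suc n)" for T
      using plane_tree_subset[OF that] by (rule finite_subset) simp
    ultimately have "card (ordered_trees (Suc n)) \<le> card (\<Union> (plane_trees (Suc n)))"
      by (intro card_mono finite_Union) auto
    also have "\<dots> \<le> sum card (plane_trees (Suc n))" by (rule card_Union_le_sum_card)
    also have "\<dots> \<le> (\<Sum>T\<in>plane_trees (Suc n). 2 * n)"
      unfolding plane_trees_eq using card_orb_rotate_le assms by (intro sum_mono) auto
    finally show ?thesis by (simp add: mult.commute)
  qed
  moreover have "(2 * n) choose n \<le> card (ordered_trees (Suc n)) * (4 * n + 2)"
    using card_Q_vertices_ge[of n] bij_betw_same_card[OF bij_decode[OF assms]]
    by (simp add: codes_def card_cartesian_product)
  ultimately have "(2 * n) choose n \<le> 2 * n * card (plane_trees (Suc n)) * (4 * n + 2)"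
    by (meson mult_le_mono1 order_trans)
  then have "real ((2 * n) choose n) \<le> real (2 * n * card (plane_trees (Suc n)) * (4 * n + 2))"
    by (simp only: of_nat_le_iff)
  moreover have "4 ^ n / (2 * real n) \<le> real ((2 * n) choose n)"
    using assms by (intro central_binomial_lower_bound) simp
  ultimately have "4 ^ n / (2 * real n) \<le> 2 * real n * real (card (plane_trees (Suc n))) * (4 * real n + 2)"
    by (simp add: algebra_simps)
  then show ?thesis using assms by (simp add: field_simps power2_eq_square)
qed

lemma asym_plane_trees_eq:
  assumes "1 \<le> n"
  shows "asym_plane_trees (Suc n) = {T \<in> plane_trees (Suc n). card T = 2 * n}"
proof -
  have "(\<forall>t\<in>T. card (rot_class t) = 2 * (Suc n - 1)) \<longleftrightarrow> card T = 2 * n"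
    if T: "T \<in> plane_trees (Suc n)" for T
  proof -
    obtain t where t: "t \<in> ordered_trees (Suc n)" "T = orb rotate_tree t"
      using T by (auto simp: plane_trees_eq)
    have "rot_class u = T" if "u \<in> T" for u
      using orb_rotate_eq[OF t(1) assms, of u] that t(2) by (simp add: rot_class_eq_orb)
    moreover have "t \<in> T" using t(2) by simp
    ultimately show ?thesis by (metis diff_Suc_1)
  qed
  then show ?thesis unfolding asym_plane_trees_def by (intro Collect_cong conj_cong refl)
qed

lemma card_not_asym_le:
  assumes "1 \<le> n"
  shows "card (plane_trees (Suc n) - asym_plane_trees (Suc n)) \<le> 2 * n * 3 ^ n"
proof -
  have "plane_trees (Suc n) - asym_plane_trees (Suc n) \<subseteq> orb rotate_tree ` symmetric_trees n"
    unfolding asym_plane_trees_eq[OF assms] by (auto simp: plane_trees_eq symmetric_trees_def)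
  moreover have "finite (symmetric_trees n)" by (simp add: symmetric_trees_def)
  ultimately have "card (plane_trees (Suc n) - asym_plane_trees (Suc n)) \<le> card (symmetric_trees n)"
    by (intro surj_card_le)
  with card_symmetric_trees_le[OF assms] show ?thesis by simp
qed

section \<open>The smallest and the largest rotation classes\<close>

lemma star_orb:
  assumes "2 \<le> n"
  shows "\<exists>T\<in>plane_trees (Suc n). card T \<le> 2"
proof -
  let ?leaf = "Node []"
  define t where "t = Node (replicate n ?leaf)"
  obtain m where m: "n = Suc m" using assms by (cases n) auto
  have t: "t \<in> ordered_trees (Suc n)" by (simp add: t_def ordered_trees_def sum_list_replicate)
  \<comment> \<open>The root of the star moves from the centre to a leaf and back.\<close>
  have "rotate_tree (rotate_tree t) = t"
    by (simp add: t_def m replicate_append_same)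
  then have "orb rotate_tree t \<subseteq> {t, rotate_tree t}"
    by (intro orb_subset) auto
  then have "card (orb rotate_tree t) \<le> card {t, rotate_tree t}" by (intro card_mono) auto
  also have "\<dots> \<le> 2" by (simp add: card_insert_if)
  finally show ?thesis using t unfolding plane_trees_eq by blast
qed

lemma plane_tree_card_ge_2:
  assumes "2 \<le> n" "T \<in> plane_trees (Suc n)"
  shows "2 \<le> card T"
proof -
  obtain t where t: "t \<in> ordered_trees (Suc n)" "T = orb rotate_tree t"
    using assms(2) by (auto simp: plane_trees_eq)
  have "rotate_tree t \<noteq> t"
  proof
    assume r: "rotate_tree t = t"
    obtain us vs where u: "t = Node (Node us # vs)"
      using t(1) assms(1) by (cases t rule: rotate_tree.cases) (auto simp: ordered_trees_def)
    show False
    proof (cases us)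
      case Nil
      then show ?thesis using r u t(1) assms(1) by (auto simp: ordered_trees_def)
    next
      case (Cons w ws)
      \<comment> \<open>A fixed tree whose first child has children would have a first child
        containing a copy of itself; if the first child is a leaf, only the single edge
        remains.\<close>
      then have "w = Node (w # ws)" using r u by simp
      then have "size w = size (Node (w # ws))" by (rule arg_cong)
      then show ?thesis by simp
    qed
  qed
  moreover have "{t, rotate_tree t} \<subseteq> T" using t(2) orb_closed[OF self_in_orb] by simp
  moreover have "finite T" using plane_tree_subset[OF assms(2)] by (rule finite_subset) simp
  ultimately show ?thesis using card_mono[of T "{t, rotate_tree t}"] by simp
qed

text \<open>The word \<open>1100(10)\<dots>(10)\<close> of the tree below has adjacent zeros in one place
  only.\<close>

lemma spider_orb:
  assumes "4 \<le> n"
  shows "\<exists>T\<in>plane_trees (Suc n). card T = 2 * n"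
proof -
  let ?leaf = "Node []"
  define t where "t = Node (Node [?leaf] # replicate (n - 2) ?leaf)"
  have t: "t \<in> ordered_trees (Suc n)"
    using assms by (simp add: t_def ordered_trees_def sum_list_replicate)
  have w: "word t = [True, True, False, False] @ concat (replicate (n - 2) [True, False])"
    by (simp add: t_def)
  have rep: "concat (replicate k [True, False]) ! (2 * i)" if "i < k" for i k
    using that
  proof (induction k arbitrary: i)
    case (Suc k)
    then show ?case by (cases i) auto
  qed simp
  have up: "word t ! j" if "4 \<le> j" "even j" "j < 2 * n" for j
  proof -
    obtain i where i: "j = 2 * i" using \<open>even j\<close> by (rule evenE)
    have "j - 4 = 2 * (i - 2)" "i - 2 < n - 2" using i that by auto
    then show ?thesis using rep[of "i - 2" "n - 2"] that(1) unfolding w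
      by (subst nth_append) (simp add: numeral_eq_Suc)
  qed
  obtain p where p: "0 < p" "p dvd 2 * n" "card (orb rotate_tree t) = p"
    "\<forall>k. (rotate_tree ^^ k) t = t \<longleftrightarrow> p dvd k"
    by (rule orb_rotate_period[OF t]) (use assms in auto)
  have "p = 2 * n"
  proof (rule ccontr)
    assume "p \<noteq> 2 * n"
    obtain m where m: "2 * n = p * m" using p(2) by (rule dvdE)
    have "2 \<le> m"
    proof (rule ccontr)
      assume "\<not> 2 \<le> m"
      then have "m = 0 \<or> m = 1" by auto
      then show False using m \<open>p \<noteq> 2 * n\<close> assms by auto
    qed
    then have "p * 2 \<le> 2 * n" unfolding m by (rule mult_le_mono2)
    then have pn: "p \<le> n" by simp
    have tp: "(rotate_tree ^^ p) t = t" using p(4) by simp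
    have step: "word t ! i" if "i + p < 2 * n" "word t ! (i + p)" for i
      using word_funpow_rotate_nth[OF t _ that] tp assms by simp
    have "\<not> word t ! 2" "\<not> word t ! 3" by (simp_all add: w)
    \<comment> \<open>Periodicity carries zeros forward by \<open>p\<close>; both positions are in
      range because \<open>3 + p <= 3 + n < 2 * n\<close> for \<open>n >= 4\<close>. One of them is
      even and at least 4, where the word has a 1.\<close>
    then have "\<not> word t ! (2 + p)" "\<not> word t ! (3 + p)"
      using step[of 2] step[of 3] pn assms by auto
    moreover have "word t ! (2 + p) \<or> word t ! (3 + p)"
    proof (cases "even p")
      case True
      then show ?thesis using up[of "2 + p"] p(1) pn assms by (auto elim!: evenE)
    next
      case False
      then show ?thesis using up[of "3 + p"] p(1) pn assms by auto
    qed
    ultimately show False by blast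
  qed
  then show ?thesis using t p(3) unfolding plane_trees_eq by blast
qed

lemma plane_trees_nonempty: "plane_trees (Suc n) \<noteq> {}"
proof -
  have "Node (replicate n (Node [])) \<in> ordered_trees (Suc n)"
    by (simp add: ordered_trees_def sum_list_replicate)
  then show ?thesis by (auto simp: plane_trees_eq)
qed

lemma asym_fraction:
  "(\<lambda>n. 1 - real (card (asym_plane_trees (n + 1))) / real (card (plane_trees (n + 1)))) \<in> o(\<lambda>_. 1)"
proof (rule smalloI_tendsto)
  let ?e = "\<lambda>n. 1 - real (card (asym_plane_trees (n + 1))) / real (card (plane_trees (n + 1)))"
  \<comment> \<open>The ratio of the bound for symmetric trees to the lower bound for plane trees,
    of order \<open>n ^ 4 * (3 / 4) ^ n\<close>.\<close>
  let ?b = "\<lambda>n. 2 * real n * 3 ^ n * (4 * real n ^ 2 * (4 * real n + 2)) / 4 ^ n"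
  have "0 \<le> ?e n \<and> ?e n \<le> ?b n" if n: "1 \<le> n" for n
  proof -
    define P A where "P = card (plane_trees (Suc n))" and "A = card (asym_plane_trees (Suc n))"
    have sub: "asym_plane_trees (Suc n) \<subseteq> plane_trees (Suc n)" by (auto simp: asym_plane_trees_def)
    then have AP: "A \<le> P" unfolding A_def P_def by (intro card_mono) simp_all
    have "P - A \<le> 2 * n * 3 ^ n"
      using card_not_asym_le[OF n] card_Diff_subset[OF finite_subset[OF sub] sub] by (simp add: P_def A_def)
    then have "real (P - A) \<le> real (2 * n * 3 ^ n)" by (simp only: of_nat_le_iff)
    then have D: "real P - real A \<le> 2 * real n * 3 ^ n"
      using AP by (simp add: of_nat_diff)
    have L: "4 ^ n \<le> 4 * real n ^ 2 * (4 * real n + 2) * real P"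
      using card_plane_trees_ge[OF n] by (simp add: P_def)
    have "P \<noteq> 0" using plane_trees_nonempty[of n] by (simp add: P_def)
    then have e: "?e n = (real P - real A) / real P" by (simp add: P_def A_def field_simps)
    have "(real P - real A) * 4 ^ n \<le> (2 * real n * 3 ^ n) * (4 * real n ^ 2 * (4 * real n + 2) * real P)"
      using D L AP by (intro mult_mono) auto
    then have "?e n \<le> ?b n" unfolding e using \<open>P \<noteq> 0\<close> by (simp add: field_simps)
    moreover have "0 \<le> ?e n" unfolding e using AP by simp
    ultimately show ?thesis by simp
  qed
  then have "eventually (\<lambda>n. 0 \<le> ?e n) sequentially" "eventually (\<lambda>n. ?e n \<le> ?b n) sequentially"
    by (auto intro!: eventually_sequentiallyI[of 1])
  moreover have "?b \<longlonglongrightarrow> 0" by real_asymp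
  ultimately have "?e \<longlonglongrightarrow> 0" by (intro tendsto_sandwich[of "\<lambda>_. 0" ?e _ ?b]) auto
  then show "(\<lambda>n. ?e n / 1) \<longlonglongrightarrow> 0" by simp
qed simp

theorem theorem13:
  shows "(\<forall>n::nat. \<forall>\<alpha>::nat \<Rightarrow> bool list.
      1 \<le> n \<longrightarrow> (\<forall>i\<in>{1..n}. \<alpha> (2 * i) = replicate (i - 1) False) \<longrightarrow>
        two_factor (Q_vertices (2 * n + 1) n) (Q_edges (2 * n + 1) n) (C_factor \<alpha> n)
      \<and> (\<exists>\<phi>. bij_betw \<phi> (cycle_subgraphs (C_factor \<alpha> n)) (plane_trees (n + 1))
           \<and> (\<forall>C\<in>cycle_subgraphs (C_factor \<alpha> n). \<forall>t\<in>\<phi> C.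
                card C = (4 * n + 2) * card (rot_class t)))
      \<and> (2 \<le> n \<longrightarrow> Min (card ` cycle_subgraphs (C_factor \<alpha> n)) = 2 * (4 * n + 2))
      \<and> (4 \<le> n \<longrightarrow> Max (card ` cycle_subgraphs (C_factor \<alpha> n)) = 2 * n * (4 * n + 2))
      \<and> card (cycle_subgraphs (C_factor \<alpha> n)) = card (plane_trees (n + 1))
      \<and> card {C \<in> cycle_subgraphs (C_factor \<alpha> n). card C = 2 * n * (4 * n + 2)}
           = card (asym_plane_trees (n + 1)))
    \<and> (\<exists>\<epsilon>::nat \<Rightarrow> real. \<epsilon> \<in> o(\<lambda>_. 1)
         \<and> (\<forall>n\<ge>1. real (card (asym_plane_trees (n + 1)))
                = (1 - \<epsilon> n) * real (card (plane_trees (n + 1)))))"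
proof (intro conjI allI impI)
  fix n :: nat and \<alpha> :: "nat \<Rightarrow> bool list"
  assume n: "1 \<le> n" and \<alpha>: "\<forall>i\<in>{1..n}. \<alpha> (2 * i) = replicate (i - 1) False"
  let ?P = "plane_trees (Suc n)" and ?C = "cycle_subgraphs (C_factor \<alpha> n)"
  have C: "C_factor \<alpha> n = code_edge n ` codes n" by (rule C_factor_zero[OF n \<alpha>])
  have cycles: "?C = class_cycle n ` ?P" unfolding C by (rule cycle_subgraphs_code_edges[OF n])
  have inj: "inj_on (class_cycle n) ?P" by (rule inj_class_cycle[OF n])
  have cards: "card ` ?C = (\<lambda>T. (4 * n + 2) * card T) ` ?P"
    unfolding cycles image_image using card_class_cycle[OF n] by (intro image_cong) auto
  show "two_factor (Q_vertices (2 * n + 1) n) (Q_edges (2 * n + 1) n) (C_factor \<alpha> n)"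
    unfolding C by (rule two_factor_code_edges[OF n])
  show "card ?C = card (plane_trees (n + 1))"
    unfolding cycles using inj by (simp add: card_image)
  show "\<exists>\<phi>. bij_betw \<phi> ?C (plane_trees (n + 1))
      \<and> (\<forall>C\<in>?C. \<forall>t\<in>\<phi> C. card C = (4 * n + 2) * card (rot_class t))"
  proof (intro exI[of _ "inv_into ?P (class_cycle n)"] conjI ballI)
    show "bij_betw (inv_into ?P (class_cycle n)) ?C (plane_trees (n + 1))"
      using inj cycles bij_betw_inv_into[of "class_cycle n" ?P ?C] by (simp add: bij_betw_def)
  next
    fix C t assume "C \<in> ?C" and t: "t \<in> inv_into ?P (class_cycle n) C"
    then obtain T where T: "T \<in> ?P" "C = class_cycle n T" unfolding cycles by (elim imageE) simp
    then have tT: "t \<in> T" using t inv_into_f_f[OF inj T(1)] by simp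
    obtain s where s: "s \<in> ordered_trees (Suc n)" "T = orb rotate_tree s"
      using T(1) by (auto simp: plane_trees_eq)
    have "rot_class t = T"
      using orb_rotate_eq[OF s(1) n, of t] tT s(2) by (simp add: rot_class_eq_orb)
    then show "card C = (4 * n + 2) * card (rot_class t)"
      using T card_class_cycle[OF n T(1)] by simp
  qed
  have "card (class_cycle n T) = 2 * n * (4 * n + 2) \<longleftrightarrow> card T = 2 * n" if "T \<in> ?P" for T
  proof -
    have "card (class_cycle n T) = card T * (4 * n + 2)"
      using card_class_cycle[OF n that] by (simp only: mult.commute)
    then show ?thesis by (simp only: mult_cancel2) simp
  qed
  then have "{C \<in> ?C. card C = 2 * n * (4 * n + 2)} = class_cycle n ` asym_plane_trees (Suc n)"
    unfolding cycles asym_plane_trees_eq[OF n] by (auto simp del: mult_Suc_right distrib_left)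
  moreover have "inj_on (class_cycle n) (asym_plane_trees (Suc n))"
    using inj by (rule inj_on_subset) (auto simp: asym_plane_trees_def)
  ultimately show "card {C \<in> ?C. card C = 2 * n * (4 * n + 2)} = card (asym_plane_trees (n + 1))"
    by (simp add: card_image)
  show "Min (card ` ?C) = 2 * (4 * n + 2)" if n2: "2 \<le> n"
  proof (rule Min_eqI)
    show "finite (card ` ?C)" unfolding cards by simp
    fix y assume "y \<in> card ` ?C"
    then obtain T where T: "T \<in> ?P" "y = (4 * n + 2) * card T" unfolding cards by blast
    have "(4 * n + 2) * 2 \<le> (4 * n + 2) * card T"
      using plane_tree_card_ge_2[OF n2 T(1)] by (rule mult_le_mono2)
    then show "2 * (4 * n + 2) \<le> y" using T(2) by (simp only: mult.commute)
  next
    obtain T where "T \<in> ?P" "card T \<le> 2" using star_orb[OF n2] by blast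
    moreover from this have "card T = 2" using plane_tree_card_ge_2[OF n2, of T] by simp
    ultimately show "2 * (4 * n + 2) \<in> card ` ?C"
      unfolding cards by (intro image_eqI[of _ _ T]) simp_all
  qed
  show "Max (card ` ?C) = 2 * n * (4 * n + 2)" if n4: "4 \<le> n"
  proof (rule Max_eqI)
    show "finite (card ` ?C)" unfolding cards by simp
    fix y assume "y \<in> card ` ?C"
    then obtain T where T: "T \<in> ?P" "y = (4 * n + 2) * card T" unfolding cards by blast
    then have "card T \<le> 2 * n" using card_orb_rotate_le n by (auto simp: plane_trees_eq)
    then have "(4 * n + 2) * card T \<le> (4 * n + 2) * (2 * n)" by (rule mult_le_mono2)
    then show "y \<le> 2 * n * (4 * n + 2)" using T(2) by (simp only: mult.commute)
  next
    obtain T where "T \<in> ?P" "card T = 2 * n" using spider_orb[OF n4] by blast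
    then show "2 * n * (4 * n + 2) \<in> card ` ?C"
      unfolding cards by (intro image_eqI[of _ _ T]) simp_all
  qed
next
  let ?e = "\<lambda>n. 1 - real (card (asym_plane_trees (n + 1))) / real (card (plane_trees (n + 1)))"
  have "real (card (asym_plane_trees (n + 1))) = (1 - ?e n) * real (card (plane_trees (n + 1)))"
    for n
    using plane_trees_nonempty[of n] by simp
  then show "\<exists>\<epsilon>::nat \<Rightarrow> real. \<epsilon> \<in> o(\<lambda>_. 1)
         \<and> (\<forall>n\<ge>1. real (card (asym_plane_trees (n + 1)))
                = (1 - \<epsilon> n) * real (card (plane_trees (n + 1))))"
    using asym_fraction by blast
qed

end
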